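(* Let $\mathcal F^{reg}_{T_3}$ be the family of regular embeddings between $T_3$-algebras. Then $\mathcal F^{reg}_{T_3}$ and $\tilde{\mathcal F}^{reg}_{T_3}$ are isoclassic families.
   Context: An operator algebra $A$ is given with its generated C*-algebra $C^*(A)$. A homomorphism $A\to B$ is star-extendible if it is the restriction of a *-homomorphism $C^*(A)\to C^*(B)$; a star-extendible isomorphism is the restriction of a *-isomorphism $C^*(A)\to C^*(B)$ carrying $A$ onto $B$. $T_3\subseteq M_3$ is the algebra of upper triangular matrices; a $T_3$-algebra is an algebra $T_3\otimes M_n$. A star-extendible homomorphism $T_3\otimes M_n\to T_3\otimes M_m$ is regular if it is a direct sum of star-extendible homomorphisms of multiplicity one (the multiplicity is that of the *-extension $M_3\otimes M_n\to M_3\otimes M_m$); equivalently, there are maximal abelian self-adjoint subalgebras $C_1,C_2$ of $M_3\otimes M_n$ and $M_3\otimes M_m$, contained in $T_3\otimes M_n$ and $T_3\otimes M_m$ respectively, such that every partial isometry in the domain algebra normalising $C_1$ is mapped to a partial isometry in the range algebra normalising $C_2$. $\tilde{\mathcal F}^{reg}_{T_3}$ is the family of star-extendible homomorphisms between finite direct sums of $T_3$-algebras all of whose partial maps (summand to summand) are in $\mathcal F^{reg}_{T_3}$. For a family $\mathcal F$ of maps, $\mathrm{Sys}(\mathcal F)$ is the category of direct systems $A_1\to A_2\to\cdots$ with maps in $\mathcal F$; two systems are isomorphic in $\mathrm{Sys}(\mathcal F)$ if there are subsequences $(n_k),(m_k)$ and maps $A_{n_k}\to A'_{m_k}$, $A'_{m_k}\to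 A_{n_{k+1}}$ in $\mathcal F$ forming a commuting diagram with the compositions of the given maps. $\mathrm{Alglim}(\mathcal F)$ is the category of algebraic direct limits $\mathrm{alg}\varinjlim A_k$ of such systems (as subalgebras of $\varinjlim C^*(A_k)$), with star-extendible homomorphisms as morphisms. $\mathcal F$ is isoclassic if the natural functor $\mathrm{Sys}(\mathcal F)\to\mathrm{Alglim}(\mathcal F)$ induces a bijection between isomorphism classes of objects, i.e. systems in $\mathrm{Sys}(\mathcal F)$ with star-extendibly isomorphic algebraic limits are isomorphic in $\mathrm{Sys}(\mathcal F)$. *)

theory Defs
  imports Complex_Main "Jordan_Normal_Form.Schur_Decomposition"
begin

section \<open>Operator algebras inside C*-algebras\<close>

text \<open>An operator algebra is a subset \<open>alg\<close> of an ambient C*-algebra. Only the instances built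
  below (matrix algebras, their finite direct sums, and sequence algebras over these) are used, so
  the C*-algebra axioms are not part of the record. The ambient algebra may be larger than the generated
  C*-algebra.\<close>

record 'a opalg =
  car :: "'a set"
  cadd :: "'a \<Rightarrow> 'a \<Rightarrow> 'a"
  czero :: 'a
  cmult :: "'a \<Rightarrow> 'a \<Rightarrow> 'a"
  cscale :: "complex \<Rightarrow> 'a \<Rightarrow> 'a"
  cadj :: "'a \<Rightarrow> 'a"
  cnorm :: "'a \<Rightarrow> real"
  alg :: "'a set"

definition cdist :: "'a opalg \<Rightarrow> 'a \<Rightarrow> 'a \<Rightarrow> real" where
  "cdist A x y = cnorm A (cadd A x (cscale A (-1) y))"

definition cstar_subalgebra :: "'a opalg \<Rightarrow> 'a set \<Rightarrow> bool" where
  "cstar_subalgebra A D \<longleftrightarrow>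
     D \<subseteq> car A \<and> czero A \<in> D \<and>
     (\<forall>x\<in>D. \<forall>y\<in>D. cadd A x y \<in> D \<and> cmult A x y \<in> D) \<and>
     (\<forall>c. \<forall>x\<in>D. cscale A c x \<in> D) \<and>
     (\<forall>x\<in>D. cadj A x \<in> D) \<and>
     (\<forall>x\<in>car A. (\<forall>e>0. \<exists>d\<in>D. cdist A x d < e) \<longrightarrow> x \<in> D)"

definition Cstar :: "'a opalg \<Rightarrow> 'a set" where
  "Cstar A = \<Inter>{D. cstar_subalgebra A D \<and> alg A \<subseteq> D}"

definition star_hom :: "'a opalg \<Rightarrow> 'b opalg \<Rightarrow> ('a \<Rightarrow> 'b) \<Rightarrow> bool" where
  "star_hom A B \<Phi> \<longleftrightarrow>
     (\<forall>x\<in>Cstar A. \<Phi> x \<in> Cstar B) \<and>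
     (\<forall>x\<in>Cstar A. \<forall>y\<in>Cstar A.
        \<Phi> (cadd A x y) = cadd B (\<Phi> x) (\<Phi> y) \<and> \<Phi> (cmult A x y) = cmult B (\<Phi> x) (\<Phi> y)) \<and>
     (\<forall>c. \<forall>x\<in>Cstar A. \<Phi> (cscale A c x) = cscale B c (\<Phi> x)) \<and>
     (\<forall>x\<in>Cstar A. \<Phi> (cadj A x) = cadj B (\<Phi> x))"

text \<open>Maps between operator algebras are HOL functions of which only the values on \<open>alg\<close> matter.\<close>

definition star_extension :: "'a opalg \<Rightarrow> 'b opalg \<Rightarrow> ('a \<Rightarrow> 'b) \<Rightarrow> ('a \<Rightarrow> 'b) \<Rightarrow> bool" where
  "star_extension A B \<phi> \<Phi> \<longleftrightarrow>
     star_hom A B \<Phi> \<and> (\<forall>a\<in>alg A. \<Phi> a = \<phi> a \<and> \<phi> a \<in> alg B)"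

definition star_extendible :: "'a opalg \<Rightarrow> 'b opalg \<Rightarrow> ('a \<Rightarrow> 'b) \<Rightarrow> bool" where
  "star_extendible A B \<phi> \<longleftrightarrow> (\<exists>\<Phi>. star_extension A B \<phi> \<Phi>)"

definition star_extendibly_isomorphic :: "'a opalg \<Rightarrow> 'b opalg \<Rightarrow> bool" where
  "star_extendibly_isomorphic A B \<longleftrightarrow>
     (\<exists>\<Phi>. star_hom A B \<Phi> \<and> bij_betw \<Phi> (Cstar A) (Cstar B) \<and> \<Phi> ` alg A = alg B)"


section \<open>Direct systems and their algebraic limits\<close>

type_synonym 'a family = "('a opalg \<times> 'a opalg \<times> ('a \<Rightarrow> 'a)) set"

definition direct_system :: "'a family \<Rightarrow> (nat \<Rightarrow> 'a opalg) \<Rightarrow> (nat \<Rightarrow> 'a \<Rightarrow> 'a) \<Rightarrow> bool" where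
  "direct_system F A \<phi> \<longleftrightarrow> (\<forall>k. (A k, A (Suc k), \<phi> k) \<in> F)"

primrec iterate_maps :: "(nat \<Rightarrow> 'a \<Rightarrow> 'a) \<Rightarrow> nat \<Rightarrow> nat \<Rightarrow> 'a \<Rightarrow> 'a" where
  "iterate_maps \<phi> k 0 = id"
| "iterate_maps \<phi> k (Suc d) = \<phi> (k + d) \<circ> iterate_maps \<phi> k d"

text \<open>The composition \<open>A k \<rightarrow> A l\<close> of the given maps, for \<open>k \<le> l\<close>.\<close>

definition connecting_map :: "(nat \<Rightarrow> 'a \<Rightarrow> 'a) \<Rightarrow> nat \<Rightarrow> nat \<Rightarrow> 'a \<Rightarrow> 'a" where
  "connecting_map \<phi> k l = iterate_maps \<phi> k (l - k)"

text \<open>The C*-algebra limit is realized, as usual, inside the quotient of the bounded sequences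
  \<open>x k \<in> car (A k)\<close> by the null sequences; elements of the quotient are equivalence classes, and
  its norm is the quotient norm.\<close>

definition bounded_seqs :: "(nat \<Rightarrow> 'a opalg) \<Rightarrow> (nat \<Rightarrow> 'a) set" where
  "bounded_seqs A = {x. (\<forall>k. x k \<in> car (A k)) \<and> (\<exists>C. \<forall>k. cnorm (A k) (x k) \<le> C)}"

definition seq_class :: "(nat \<Rightarrow> 'a opalg) \<Rightarrow> (nat \<Rightarrow> 'a) \<Rightarrow> (nat \<Rightarrow> 'a) set" where
  "seq_class A x = {y \<in> bounded_seqs A. (\<lambda>k. cdist (A k) (x k) (y k)) \<longlonglongrightarrow> 0}"

text \<open>\<open>thread A \<phi> k a\<close> represents the image of \<open>a \<in> A k\<close> in the limit. Such classes form the
  algebraic direct limit; the C*-algebra they generate is the C*-algebra limit of the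
  \<open>Cstar (A k)\<close>.\<close>

definition thread :: "(nat \<Rightarrow> 'a opalg) \<Rightarrow> (nat \<Rightarrow> 'a \<Rightarrow> 'a) \<Rightarrow> nat \<Rightarrow> 'a \<Rightarrow> nat \<Rightarrow> 'a" where
  "thread A \<phi> k a = (\<lambda>l. if l < k then czero (A l) else connecting_map \<phi> k l a)"

definition alglim :: "(nat \<Rightarrow> 'a opalg) \<Rightarrow> (nat \<Rightarrow> 'a \<Rightarrow> 'a) \<Rightarrow> (nat \<Rightarrow> 'a) set opalg" where
  "alglim A \<phi> =
     \<lparr> car = seq_class A ` bounded_seqs A,
       cadd = (\<lambda>X Y. \<Union>x\<in>X. \<Union>y\<in>Y. seq_class A (\<lambda>k. cadd (A k) (x k) (y k))),
       czero = seq_class A (\<lambda>k. czero (A k)),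
       cmult = (\<lambda>X Y. \<Union>x\<in>X. \<Union>y\<in>Y. seq_class A (\<lambda>k. cmult (A k) (x k) (y k))),
       cscale = (\<lambda>c X. \<Union>x\<in>X. seq_class A (\<lambda>k. cscale (A k) c (x k))),
       cadj = (\<lambda>X. \<Union>x\<in>X. seq_class A (\<lambda>k. cadj (A k) (x k))),
       cnorm = (\<lambda>X. INF x\<in>X. SUP k. cnorm (A k) (x k)),
       alg = {seq_class A (thread A \<phi> k a) | k a. a \<in> alg (A k)} \<rparr>"

definition Sys_isomorphic ::
  "'a family \<Rightarrow> (nat \<Rightarrow> 'a opalg) \<Rightarrow> (nat \<Rightarrow> 'a \<Rightarrow> 'a) \<Rightarrow>
     (nat \<Rightarrow> 'a opalg) \<Rightarrow> (nat \<Rightarrow> 'a \<Rightarrow> 'a) \<Rightarrow> bool" where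
  "Sys_isomorphic F A \<phi> A' \<phi>' \<longleftrightarrow>
     (\<exists>(n :: nat \<Rightarrow> nat) (m :: nat \<Rightarrow> nat) \<alpha> \<beta>.
        strict_mono n \<and> strict_mono m \<and>
        (\<forall>k. (A (n k), A' (m k), \<alpha> k) \<in> F) \<and>
        (\<forall>k. (A' (m k), A (n (Suc k)), \<beta> k) \<in> F) \<and>
        (\<forall>k. \<forall>a\<in>alg (A (n k)). \<beta> k (\<alpha> k a) = connecting_map \<phi> (n k) (n (Suc k)) a) \<and>
        (\<forall>k. \<forall>b\<in>alg (A' (m k)).
           \<alpha> (Suc k) (\<beta> k b) = connecting_map \<phi>' (m k) (m (Suc k)) b))"

definition isoclassic :: "'a family \<Rightarrow> bool" where
  "isoclassic F \<longleftrightarrow>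
     (\<forall>A \<phi> A' \<phi>'.
        direct_system F A \<phi> \<and> direct_system F A' \<phi>' \<and>
        star_extendibly_isomorphic (alglim A \<phi>) (alglim A' \<phi>') \<longrightarrow>
        Sys_isomorphic F A \<phi> A' \<phi>')"


section \<open>Finite direct sums\<close>

definition direct_sum :: "'a opalg list \<Rightarrow> 'a list opalg" where
  "direct_sum As =
     \<lparr> car = {xs. list_all2 (\<lambda>A x. x \<in> car A) As xs},
       cadd = (\<lambda>xs ys. map (\<lambda>i. cadd (As ! i) (xs ! i) (ys ! i)) [0..<length As]),
       czero = map czero As,
       cmult = (\<lambda>xs ys. map (\<lambda>i. cmult (As ! i) (xs ! i) (ys ! i)) [0..<length As]),
       cscale = (\<lambda>c xs. map (\<lambda>i. cscale (As ! i) c (xs ! i)) [0..<length As]),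
       cadj = (\<lambda>xs. map (\<lambda>i. cadj (As ! i) (xs ! i)) [0..<length As]),
       cnorm = (\<lambda>xs. Max ((\<lambda>i. cnorm (As ! i) (xs ! i)) ` {..<length As})),
       alg = {xs. list_all2 (\<lambda>A x. x \<in> alg A) As xs} \<rparr>"

text \<open>From the \<open>i\<close>-th summand of \<open>direct_sum As\<close> to the \<open>j\<close>-th summand of the range.\<close>

definition partial_map :: "'a opalg list \<Rightarrow> ('a list \<Rightarrow> 'a list) \<Rightarrow> nat \<Rightarrow> nat \<Rightarrow> 'a \<Rightarrow> 'a" where
  "partial_map As \<phi> i j = (\<lambda>a. \<phi> ((map czero As)[i := a]) ! j)"

text \<open>A partial map is in the family or zero. Zero has to be admitted explicitly as the families
  of interest consist of embeddings, while for instance the identity map of a direct sum has zero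
  partial maps.\<close>

definition direct_sum_family :: "'a opalg set \<Rightarrow> 'a family \<Rightarrow> 'a list family" where
  "direct_sum_family K F =
     {(direct_sum As, direct_sum Bs, \<phi>) | As Bs \<phi>.
        As \<noteq> [] \<and> Bs \<noteq> [] \<and> set As \<subseteq> K \<and> set Bs \<subseteq> K \<and>
        star_extendible (direct_sum As) (direct_sum Bs) \<phi> \<and>
        (\<forall>i<length As. \<forall>j<length Bs.
           (As ! i, Bs ! j, partial_map As \<phi> i j) \<in> F \<or>
           (\<forall>a\<in>alg (As ! i). partial_map As \<phi> i j a = czero (Bs ! j)))}"


section \<open>The algebras \<open>T\<^sub>3 \<otimes> M\<^sub>n\<close> and regular embeddings\<close>

definition op_norm :: "complex mat \<Rightarrow> real" where
  "op_norm a =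
     (SUP v\<in>{v \<in> carrier_vec (dim_col a). Re (v \<bullet>c v) \<le> 1}. sqrt (Re ((a *\<^sub>v v) \<bullet>c (a *\<^sub>v v))))"

text \<open>\<open>M\<^sub>3 \<otimes> M\<^sub>n\<close> is the algebra of \<open>3n \<times> 3n\<close> matrices, the matrix unit
  \<open>e\<^sub>p\<^sub>q \<otimes> e\<^sub>i\<^sub>j\<close> being the one at position \<open>(pn + i, qn + j)\<close>. Then \<open>T\<^sub>3 \<otimes> M\<^sub>n\<close>
  consists of the block upper triangular matrices.\<close>

definition T3_alg :: "nat \<Rightarrow> complex mat opalg" where
  "T3_alg n =
     \<lparr> car = carrier_mat (3 * n) (3 * n),
       cadd = (+),
       czero = 0\<^sub>m (3 * n) (3 * n),
       cmult = (*),
       cscale = (\<cdot>\<^sub>m),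
       cadj = mat_adjoint,
       cnorm = op_norm,
       alg = {a \<in> carrier_mat (3 * n) (3 * n).
                \<forall>i<3 * n. \<forall>j<3 * n. i div n > j div n \<longrightarrow> a $$ (i, j) = 0} \<rparr>"

definition T3_algebras :: "complex mat opalg set" where
  "T3_algebras = {T3_alg n | n. n > 0}"

text \<open>A *-homomorphism \<open>\<Phi> : M\<^sub>N \<rightarrow> M\<^sub>M\<close> of multiplicity \<open>r\<close> is unitarily equivalent to
  \<open>a \<mapsto> a \<oplus> \<cdots> \<oplus> a \<oplus> 0\<close> with \<open>r\<close> copies of \<open>a\<close>.\<close>

definition has_multiplicity ::
  "nat \<Rightarrow> nat \<Rightarrow> (complex mat \<Rightarrow> complex mat) \<Rightarrow> nat \<Rightarrow> bool" where
  "has_multiplicity N M \<Phi> r \<longleftrightarrow>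
     r * N \<le> M \<and>
     (\<exists>u\<in>carrier_mat M M. u * mat_adjoint u = 1\<^sub>m M \<and> mat_adjoint u * u = 1\<^sub>m M \<and>
        (\<forall>a\<in>carrier_mat N N.
           \<Phi> a = u * diag_block_mat (replicate r a @ [0\<^sub>m (M - r * N) (M - r * N)])
                   * mat_adjoint u))"

definition multiplicity_one :: "nat \<Rightarrow> nat \<Rightarrow> (complex mat \<Rightarrow> complex mat) \<Rightarrow> bool" where
  "multiplicity_one n m \<psi> \<longleftrightarrow>
     (\<exists>\<Psi>. star_extension (T3_alg n) (T3_alg m) \<psi> \<Psi> \<and> has_multiplicity (3 * n) (3 * m) \<Psi> 1)"

text \<open>The direct sum is internal: the summands map into \<open>T\<^sub>3 \<otimes> M\<^sub>m\<close> and have orthogonal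
  ranges. The empty sum, i.e. the zero map, is regular.\<close>

definition regular :: "nat \<Rightarrow> nat \<Rightarrow> (complex mat \<Rightarrow> complex mat) \<Rightarrow> bool" where
  "regular n m \<phi> \<longleftrightarrow>
     star_extendible (T3_alg n) (T3_alg m) \<phi> \<and>
     (\<exists>\<psi>s. (\<forall>\<psi>\<in>set \<psi>s. multiplicity_one n m \<psi>) \<and>
        (\<forall>i<length \<psi>s. \<forall>j<length \<psi>s. i \<noteq> j \<longrightarrow>
           (\<forall>a\<in>alg (T3_alg n). \<forall>b\<in>alg (T3_alg n).
              (\<psi>s ! i) a * (\<psi>s ! j) b = 0\<^sub>m (3 * m) (3 * m))) \<and>
        (\<forall>a\<in>alg (T3_alg n). \<phi> a = foldr (\<lambda>\<psi> s. \<psi> a + s) \<psi>s (0\<^sub>m (3 * m) (3 * m))))"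

definition F_reg_T3 :: "complex mat family" where
  "F_reg_T3 =
     {(T3_alg n, T3_alg m, \<phi>) | n m \<phi>.
        n > 0 \<and> m > 0 \<and> regular n m \<phi> \<and> inj_on \<phi> (alg (T3_alg n))}"

definition F_reg_T3_tilde :: "complex mat list family" where
  "F_reg_T3_tilde = direct_sum_family T3_algebras F_reg_T3"

end

(* A star-extendible map h : T_3 (x) M_n -> T_3 (x) M_m gives, for each of the three block rows of the
   domain, a decomposition of the unit of the commutant of its *-extension into three projections,
   decreasing with the row as nests. The map is regular iff these three decompositions commute: a basis
   of common eigenvectors splits h into maps of multiplicity one. Two facts follow by computation in
   tensor products. If g o h is regular, then h or g is regular. If g o h and k o g are regular, then so
   is k o g o h: this is clear if h is regular, and if g is regular it follows by expanding commutators.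

   Isomorphic algebraic limits are intertwined by star-extendible maps a_k, b_k whose successive
   composites b_k a_k and a_(k+1) b_k are connecting maps of the two systems, hence regular. Each composite of three
   successive maps is then regular, and grouping the maps in threes gives an isomorphism of systems.
   For direct sums the partial maps of a composite are sums of composites with orthogonal ranges, and
   such a sum is regular iff each of its terms is. *)

theory Submission
  imports Defs "HOL-Analysis.L2_Norm"
begin

section \<open>Finitely supported matrices\<close>

text \<open>Why the size three: let two nests with two proper members each be given, one below the
  other. Among their members only the first member of the larger nest and the second member of the
  smaller one can fail to be comparable, so regularity comes down to one commutator for each pair of
  block rows. For a composite this commutator is a sum of products of an element of the range of the
  second map and an element of its commutant. Matrix algebras are simple, so nonzero first factors
  can be cancelled: if the first map is not regular, the commutator of the composite yields
  equations in the commutant, and these make the nests of the second map commute. Nothing tells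
  which of the two maps is the regular one, and in direct sums the answer may vary from path to
  path. Hence the intertwining maps are grouped and not selected: only an odd number of them leads
  from one system to the other, and with three both alternatives end in a regular composite. On the
  analytic side everything rests on finitely many matrix units: they bound images uniformly, leave a
  gap above zero, and let identities of the limit hold at a finite level.\<close>

text \<open>One ring type containing the matrices of all sizes frees ring identities from carrier conditions.
  It has no unit; \<open>idm N\<close> below is the unit of the \<open>N \<times> N\<close> corner.\<close>

typedef fmat = "{f :: nat \<Rightarrow> nat \<Rightarrow> complex. \<exists>N. \<forall>i j. i \<ge> N \<or> j \<ge> N \<longrightarrow> f i j = 0}"
  morphisms entry Fmat
  by auto

setup_lifting type_definition_fmat

lemma fmat_eqI: "(\<And>i j. entry x i j = entry y i j) \<Longrightarrow> x = y"
  by transfer auto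

lemma entry_bound: "\<exists>N. \<forall>i j. i \<ge> N \<or> j \<ge> N \<longrightarrow> entry x i j = 0"
  by transfer auto

lemma entry_bound2: "\<exists>N. (\<forall>i j. i \<ge> N \<or> j \<ge> N \<longrightarrow> entry x i j = 0) \<and> (\<forall>i j. i \<ge> N \<or> j \<ge> N \<longrightarrow> entry y i j = 0)"
proof -
  obtain N M where "\<forall>i j. i \<ge> N \<or> j \<ge> N \<longrightarrow> entry x i j = 0" "\<forall>i j. i \<ge> M \<or> j \<ge> M \<longrightarrow> entry y i j = 0"
    using entry_bound by meson
  then show ?thesis by (intro exI[of _ "max N M"]) auto
qed

lift_definition mx_of :: "nat \<Rightarrow> (nat \<Rightarrow> nat \<Rightarrow> complex) \<Rightarrow> fmat"
  is "\<lambda>N f i j. if i < N \<and> j < N then f i j else 0"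
  subgoal for N f by (intro exI[of _ N]) auto
  done

lemma entry_mx_of: "entry (mx_of N f) i j = (if i < N \<and> j < N then f i j else 0)"
  by transfer auto

instantiation fmat :: ring
begin

lift_definition zero_fmat :: fmat is "\<lambda>i j. 0" by auto
lift_definition plus_fmat :: "fmat \<Rightarrow> fmat \<Rightarrow> fmat" is "\<lambda>f g i j. f i j + g i j"
  proof -
    fix f g :: "nat \<Rightarrow> nat \<Rightarrow> complex"
    assume "\<exists>N. \<forall>i j. i \<ge> N \<or> j \<ge> N \<longrightarrow> f i j = 0" "\<exists>N. \<forall>i j. i \<ge> N \<or> j \<ge> N \<longrightarrow> g i j = 0"
    then obtain N M where "\<forall>i j. i \<ge> N \<or> j \<ge> N \<longrightarrow> f i j = 0" "\<forall>i j. i \<ge> M \<or> j \<ge> M \<longrightarrow> g i j = 0"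
      by blast
    then show "\<exists>N. \<forall>i j. i \<ge> N \<or> j \<ge> N \<longrightarrow> f i j + g i j = 0" by (intro exI[of _ "max N M"]) auto
  qed
lift_definition minus_fmat :: "fmat \<Rightarrow> fmat \<Rightarrow> fmat" is "\<lambda>f g i j. f i j - g i j"
  proof -
    fix f g :: "nat \<Rightarrow> nat \<Rightarrow> complex"
    assume "\<exists>N. \<forall>i j. i \<ge> N \<or> j \<ge> N \<longrightarrow> f i j = 0" "\<exists>N. \<forall>i j. i \<ge> N \<or> j \<ge> N \<longrightarrow> g i j = 0"
    then obtain N M where "\<forall>i j. i \<ge> N \<or> j \<ge> N \<longrightarrow> f i j = 0" "\<forall>i j. i \<ge> M \<or> j \<ge> M \<longrightarrow> g i j = 0"
      by blast
    then show "\<exists>N. \<forall>i j. i \<ge> N \<or> j \<ge> N \<longrightarrow> f i j - g i j = 0" by (intro exI[of _ "max N M"]) auto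
  qed
lift_definition uminus_fmat :: "fmat \<Rightarrow> fmat" is "\<lambda>f i j. - f i j" by auto
text \<open>Each row has finite support, so summing over the nonzero entries of the row of the left
  factor gives a finite sum that mentions no size.\<close>

lift_definition times_fmat :: "fmat \<Rightarrow> fmat \<Rightarrow> fmat"
  is "\<lambda>f g i j. \<Sum>k\<in>{k. f i k \<noteq> 0}. f i k * g k j"
  proof -
    fix f g :: "nat \<Rightarrow> nat \<Rightarrow> complex"
    assume "\<exists>N. \<forall>i j. i \<ge> N \<or> j \<ge> N \<longrightarrow> f i j = 0" "\<exists>N. \<forall>i j. i \<ge> N \<or> j \<ge> N \<longrightarrow> g i j = 0"
    then obtain N M where "\<forall>i j. i \<ge> N \<or> j \<ge> N \<longrightarrow> f i j = 0" "\<forall>i j. i \<ge> M \<or> j \<ge> M \<longrightarrow> g i j = 0"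
      by blast
    then show "\<exists>N. \<forall>i j. i \<ge> N \<or> j \<ge> N \<longrightarrow> (\<Sum>k\<in>{k. f i k \<noteq> 0}. f i k * g k j) = 0" by (intro exI[of _ "max N M"]) auto
  qed

lemma entry_times_raw: "entry (x * y) i j = (\<Sum>k\<in>{k. entry x i k \<noteq> 0}. entry x i k * entry y k j)"
  by transfer auto

text \<open>Any range covering the nonzero terms may be summed over, so a bound on either of the two
  factors determines the range.\<close>

lemma entry_times: 
  assumes "\<And>k. k \<ge> N \<Longrightarrow> entry x i k = 0 \<or> entry y k j = 0"
  shows "entry (x * y) i j = (\<Sum>k<N. entry x i k * entry y k j)"
proof -
  obtain M where "\<forall>i j. i \<ge> M \<or> j \<ge> M \<longrightarrow> entry x i j = 0" using entry_bound by blast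
  then have "finite {k. entry x i k \<noteq> 0}"
    by (intro finite_subset[of "{k. entry x i k \<noteq> 0}" "{..<M}"]) (auto simp: not_le[symmetric])
  then show ?thesis unfolding entry_times_raw
    using assms by (intro sum.mono_neutral_cong) (auto simp: not_less)
qed

instance
proof
  fix x y z :: fmat
  obtain N where N: "\<forall>i j. i \<ge> N \<or> j \<ge> N \<longrightarrow> entry x i j = 0" using entry_bound by blast
  obtain M where M: "\<forall>i j. i \<ge> M \<or> j \<ge> M \<longrightarrow> entry y i j = 0" using entry_bound by blast
  show "x * y * z = x * (y * z)"
  proof (rule fmat_eqI)
    fix i j
    have "entry (x * y * z) i j = (\<Sum>k<M. entry (x*y) i k * entry z k j)"
      by (rule entry_times) (simp add: entry_times_raw M)
    also have "\<dots> = (\<Sum>k<M. \<Sum>l<N. entry x i l * entry y l k * entry z k j)"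
      by (subst entry_times[of N]) (auto simp: N sum_distrib_right)
    also have "\<dots> = (\<Sum>l<N. \<Sum>k<M. entry x i l * entry y l k * entry z k j)"
      by (rule sum.swap)
    also have "\<dots> = (\<Sum>l<N. entry x i l * entry (y * z) l j)"
      by (subst entry_times[of M]) (auto simp: M sum_distrib_left mult.assoc)
    also have "\<dots> = entry (x * (y * z)) i j"
      by (subst entry_times[of N]) (auto simp: N)
    finally show "entry (x * y * z) i j = entry (x * (y * z)) i j" .
  qed
  have pl: "entry (a + b) i j = entry a i j + entry b i j" for a b i j by transfer auto
  show "x * (y + z) = x * y + x * z"
    by (rule fmat_eqI) (simp add: pl entry_times_raw distrib_left sum.distrib)
  obtain K where K: "\<forall>i j. i \<ge> K \<or> j \<ge> K \<longrightarrow> entry z i j = 0" using entry_bound by blast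
  show "(x + y) * z = x * z + y * z"
  proof (rule fmat_eqI)
    fix i j show "entry ((x + y) * z) i j = entry (x * z + y * z) i j"
      unfolding pl
      by (subst (1 2 3) entry_times[of K]) (auto simp: K pl distrib_right sum.distrib)
  qed
qed (transfer; auto simp: fun_eq_iff)+

end

lemma entry_zero[simp]: "entry 0 i j = 0" by transfer auto
lemma entry_plus[simp]: "entry (a + b) i j = entry a i j + entry b i j" by transfer auto
lemma entry_minus[simp]: "entry (a - b) i j = entry a i j - entry b i j" by transfer auto
lemma entry_uminus[simp]: "entry (- a) i j = - entry a i j" by transfer auto
lemma entry_sum[simp]: "entry (sum f A) i j = (\<Sum>a\<in>A. entry (f a) i j)"
  by (induction A rule: infinite_finite_induct) auto

section \<open>Scalars, adjoints and matrix units\<close>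

lift_definition scl :: "complex \<Rightarrow> fmat \<Rightarrow> fmat" is "\<lambda>c f i j. c * f i j" by auto
lift_definition adj :: "fmat \<Rightarrow> fmat" is "\<lambda>f i j. cnj (f j i)" by auto

lemma entry_scl[simp]: "entry (scl c x) i j = c * entry x i j" by transfer auto
lemma entry_adj[simp]: "entry (adj x) i j = cnj (entry x j i)" by transfer auto

definition E :: "nat \<Rightarrow> nat \<Rightarrow> fmat" where
  "E s t = mx_of (Suc (max s t)) (\<lambda>i j. if i = s \<and> j = t then 1 else 0)"

lemma entry_E[simp]: "entry (E s t) i j = (if i = s \<and> j = t then 1 else 0)"
  by (auto simp: E_def entry_mx_of)

lemma scl_simps:
  "scl c (x + y) = scl c x + scl c y" "scl c (x - y) = scl c x - scl c y" "scl (c + d) x = scl c x + scl d x"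
  "scl c (scl d x) = scl (c * d) x" "scl 1 x = x" "scl 0 x = 0" "scl c 0 = 0" "scl (-1) x = - x"
  by (auto intro!: fmat_eqI simp: algebra_simps)

lemma scl_sum: "scl c (sum f A) = (\<Sum>a\<in>A. scl c (f a))"
  by (auto intro!: fmat_eqI simp: sum_distrib_left)

lemma scl_mult_left: "scl c x * y = scl c (x * y)"
proof (rule fmat_eqI)
  fix i j
  obtain N where N: "\<forall>i j. i \<ge> N \<or> j \<ge> N \<longrightarrow> entry x i j = 0" using entry_bound by blast
  then show "entry (scl c x * y) i j = entry (scl c (x * y)) i j"
    by (simp add: entry_times[of N] sum_distrib_left mult.assoc)
qed

lemma scl_mult_right: "x * scl c y = scl c (x * y)"
proof (rule fmat_eqI)
  fix i j
  obtain N where N: "\<forall>i j. i \<ge> N \<or> j \<ge> N \<longrightarrow> entry x i j = 0" using entry_bound by blast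
  then show "entry (x * scl c y) i j = entry (scl c (x * y)) i j"
    by (simp add: entry_times[of N] sum_distrib_left mult.left_commute)
qed

lemma adj_simps [simp]:
  "adj (x + y) = adj x + adj y" "adj (x - y) = adj x - adj y" "adj 0 = 0" "adj (adj x) = x"
  "adj (scl c x) = scl (cnj c) (adj x)" "adj (E s t) = E t s" "adj (- x) = - adj x"
  by (auto intro!: fmat_eqI)

lemma adj_sum[simp]: "adj (sum f A) = (\<Sum>a\<in>A. adj (f a))"
  by (auto intro!: fmat_eqI)

lemma adj_mult[simp]: "adj (x * y) = adj y * adj x"
proof (rule fmat_eqI)
  fix i j
  obtain N where N: "\<forall>i j. i \<ge> N \<or> j \<ge> N \<longrightarrow> entry x i j = 0" using entry_bound by blast
  then show "entry (adj (x * y)) i j = entry (adj y * adj x) i j"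
    by (simp add: entry_times[of N] mult.commute)
qed

text \<open>Rectangular shapes are predicates on one type: columns are elements of
  \<open>mx N 1\<close> and isometries elements of \<open>mx N K\<close>, all multiplied in the same
  ring.\<close>

definition mx :: "nat \<Rightarrow> nat \<Rightarrow> fmat set" where
  "mx N K = {x. \<forall>i j. entry x i j \<noteq> 0 \<longrightarrow> i < N \<and> j < K}"

lemma mx_zero: "x \<in> mx N K \<Longrightarrow> i \<ge> N \<or> j \<ge> K \<Longrightarrow> entry x i j = 0"
  by (force simp: mx_def)

lemma entry_mult_mx: "x \<in> mx N K \<or> y \<in> mx K L \<Longrightarrow> entry (x * y) i j = (\<Sum>k<K. entry x i k * entry y k j)"
  by (rule entry_times) (auto simp: mx_zero)

lemma mx_closed [intro]:
  "0 \<in> mx N K" "x \<in> mx N K \<Longrightarrow> y \<in> mx N K \<Longrightarrow> x + y \<in> mx N K"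
  "x \<in> mx N K \<Longrightarrow> y \<in> mx N K \<Longrightarrow> x - y \<in> mx N K"
  "x \<in> mx N K \<Longrightarrow> scl c x \<in> mx N K" "x \<in> mx N K \<Longrightarrow> adj x \<in> mx K N"
  "s < N \<Longrightarrow> t < K \<Longrightarrow> E s t \<in> mx N K" "mx_of N f \<in> mx N N"
proof -
  assume "x \<in> mx N K" "y \<in> mx N K"
  then show "x + y \<in> mx N K" "x - y \<in> mx N K"
    unfolding mx_def mem_Collect_eq entry_plus entry_minus by (metis add_0 diff_0_right)+
qed (auto simp: mx_def entry_mx_of split: if_splits)

lemma mx_sum [intro]: "(\<And>a. a \<in> A \<Longrightarrow> f a \<in> mx N K) \<Longrightarrow> sum f A \<in> mx N K"
  by (induction A rule: infinite_finite_induct) auto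

lemma mx_mult [intro]: "x \<in> mx N K \<Longrightarrow> y \<in> mx K L \<Longrightarrow> x * y \<in> mx N L"
  unfolding mx_def mem_Collect_eq
proof (intro allI impI)
  fix i j assume x: "\<forall>i j. entry x i j \<noteq> 0 \<longrightarrow> i < N \<and> j < K" and y: "\<forall>i j. entry y i j \<noteq> 0 \<longrightarrow> i < K \<and> j < L"
    and "entry (x * y) i j \<noteq> 0"
  then obtain k where "entry x i k \<noteq> 0" "entry y k j \<noteq> 0"
    unfolding entry_times_raw by (elim sum.not_neutral_contains_not_neutral) auto
  then show "i < N \<and> j < L" using x y by auto
qed

lemma mx_mono: "x \<in> mx N K \<Longrightarrow> N \<le> N' \<Longrightarrow> K \<le> K' \<Longrightarrow> x \<in> mx N' K'"
  by (force simp: mx_def)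

lemma entry_E_mult: "entry (E s t * x) i j = (if i = s then entry x t j else 0)"
proof -
  have "entry (E s t * x) i j = (\<Sum>k<Suc t. entry (E s t) i k * entry x k j)"
    by (rule entry_times) auto
  also have "\<dots> = (\<Sum>k<Suc t. if k = t then (if i = s then entry x t j else 0) else 0)"
    by (rule sum.cong) auto
  finally show ?thesis by simp
qed

lemma entry_mult_E: "entry (x * E s t) i j = (if j = t then entry x i s else 0)"
proof -
  have "entry (x * E s t) i j = (\<Sum>k<Suc s. entry x i k * entry (E s t) k j)"
    by (rule entry_times) auto
  also have "\<dots> = (\<Sum>k<Suc s. if k = s then (if j = t then entry x i s else 0) else 0)"
    by (rule sum.cong) auto
  finally show ?thesis by simp
qed

lemma E_mult: "E s t * E u v = (if t = u then E s v else 0)"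
  by (rule fmat_eqI) (simp add: entry_E_mult)

text \<open>Matrix units read off single entries. Through this the simplicity of matrix algebras
  enters in \<open>slice\<close>, and the scalars in \<open>sandwich_commuting\<close>.\<close>

lemma E_sandwich: "E s s' * x * E t' t = scl (entry x s' t') (E s t)"
  by (rule fmat_eqI) (simp add: entry_E_mult entry_mult_E)

definition idm :: "nat \<Rightarrow> fmat" where "idm N = (\<Sum>s<N. E s s)"

lemma entry_idm[simp]: "entry (idm N) i j = (if i = j \<and> i < N then 1 else 0)"
proof -
  have "entry (idm N) i j = (\<Sum>s<N. if s = i then (if i = j then 1 else 0) else 0)"
    unfolding idm_def entry_sum by (rule sum.cong) auto
  then show ?thesis by auto
qed

lemma idm_mx[intro]: "idm N \<in> mx N N" by (auto simp: mx_def)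

lemma idm_mult: "x \<in> mx N K \<Longrightarrow> idm N * x = x"
proof (rule fmat_eqI)
  fix i j assume x: "x \<in> mx N K"
  have "entry (idm N * x) i j = (\<Sum>k<N. entry (idm N) i k * entry x k j)"
    by (rule entry_mult_mx) auto
  also have "\<dots> = (\<Sum>k<N. if k = i then entry x i j else 0)"
    by (rule sum.cong) auto
  finally show "entry (idm N * x) i j = entry x i j" using mx_zero[OF x, of i j] by (auto simp: not_less)
qed

lemma adj_idm[simp]: "adj (idm N) = idm N" by (auto intro!: fmat_eqI)

lemma mult_idm: assumes "x \<in> mx K N" shows "x * idm N = x"
proof -
  have "idm N * adj x = adj x" using assms by (intro idm_mult[of _ N K]) auto
  then have "adj (idm N * adj x) = adj (adj x)" by simp
  then show ?thesis by simp
qed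

lemma mx_expand: assumes "x \<in> mx N K" shows "x = (\<Sum>s<N. \<Sum>t<K. scl (entry x s t) (E s t))"
proof (rule fmat_eqI)
  fix i j
  have "entry (\<Sum>s<N. \<Sum>t<K. scl (entry x s t) (E s t)) i j
     = (\<Sum>s<N. \<Sum>t<K. if t = j then (if s = i then entry x i j else 0) else 0)"
    unfolding entry_sum by (intro sum.cong) auto
  also have "\<dots> = (\<Sum>s<N. if s = i then (if j < K then entry x i j else 0) else 0)"
    by (intro sum.cong) (auto)
  finally show "entry x i j = entry (\<Sum>s<N. \<Sum>t<K. scl (entry x s t) (E s t)) i j"
    using assms by (auto simp: mx_def)
qed

section \<open>Traces, projections and common eigenvectors\<close>

definition tr :: "fmat \<Rightarrow> complex" where "tr x = (\<Sum>i | entry x i i \<noteq> 0. entry x i i)"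

lemma tr_mx: "x \<in> mx N K \<Longrightarrow> tr x = (\<Sum>i<N. entry x i i)"
  unfolding tr_def by (rule sum.mono_neutral_left) (auto simp: mx_def)

lemma tr_common: "\<exists>N. x \<in> mx N N \<and> y \<in> mx N N"
  using entry_bound2[of x y] unfolding mx_def mem_Collect_eq by (meson not_le)

lemma tr_add: "tr (x + y) = tr x + tr y"
proof -
  obtain N where "x \<in> mx N N" "y \<in> mx N N" using tr_common by blast
  moreover from this have "x + y \<in> mx N N" by auto
  ultimately show ?thesis by (simp add: tr_mx sum.distrib)
qed

lemma tr_minus: "tr (x - y) = tr x - tr y"
  using tr_add[of "x - y" y] by simp

lemma tr_commute: "tr (x * y) = tr (y * x)"
proof -
  obtain N where N: "x \<in> mx N N" "y \<in> mx N N" using tr_common by blast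
  moreover from this have "x * y \<in> mx N N" "y * x \<in> mx N N" by auto
  ultimately have "tr (x * y) = (\<Sum>i<N. \<Sum>k<N. entry x i k * entry y k i)"
      "tr (y * x) = (\<Sum>k<N. \<Sum>i<N. entry y k i * entry x i k)"
    using entry_mult_mx[of x N N y N] entry_mult_mx[of y N N x N] by (auto simp: tr_mx)
  then show ?thesis using sum.swap[of "\<lambda>i k. entry x i k * entry y k i" "{..<N}" "{..<N}"] by (simp add: mult.commute)
qed

lemma tr_E[simp]: "tr (E s t) = (if s = t then 1 else 0)"
proof -
  have "{i. entry (E s t) i i \<noteq> 0} = (if s = t then {s} else {})" by auto
  then show ?thesis by (auto simp: tr_def)
qed

lemma tr_idm: "tr (idm N) = of_nat N"
  by (subst tr_mx[of _ N N]) auto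

lemma tr_adj_mult: assumes "x \<in> mx N K" shows "tr (adj x * x) = of_real (\<Sum>i<K. \<Sum>k<N. (cmod (entry x k i))\<^sup>2)"
proof -
  have "adj x * x \<in> mx K K" using assms by auto
  then have "tr (adj x * x) = (\<Sum>i<K. \<Sum>k<N. cnj (entry x k i) * entry x k i)"
    using assms by (simp add: tr_mx entry_mult_mx[of "adj x" K N x K])
  then show ?thesis by (simp add: complex_norm_square mult.commute del: of_real_power)
qed

definition proj :: "fmat \<Rightarrow> bool" where "proj p \<longleftrightarrow> adj p = p \<and> p * p = p"

lemma proj_tr_nonneg: "proj p \<Longrightarrow> Re (tr p) \<ge> 0"
proof -
  assume "proj p"
  moreover obtain N where "p \<in> mx N N" using tr_common by blast
  ultimately show ?thesis using tr_adj_mult[of p N N] by (auto simp: proj_def intro!: sum_nonneg)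
qed

text \<open>The product \<open>adj v * v\<close> lies in the one-by-one corner, whose unit is
  \<open>E 0 0\<close>; inner products of columns are treated as multiples of that unit.\<close>

lemma col_sq: assumes "v \<in> mx N 1"
  shows "adj v * v = scl (of_real (\<Sum>k<N. (cmod (entry v k 0))\<^sup>2)) (E 0 0)"
proof (rule fmat_eqI)
  fix i j
  have "entry (adj v * v) i j = (\<Sum>k<N. cnj (entry v k i) * entry v k j)"
    using assms by (subst entry_mult_mx[of _ 1 N _ 1]) auto
  moreover have "entry v k j = 0" if "j \<noteq> 0" for k j using assms mx_zero[of v N 1] that by (cases j) auto
  ultimately show "entry (adj v * v) i j = entry (scl (of_real (\<Sum>k<N. (cmod (entry v k 0))\<^sup>2)) (E 0 0)) i j"
    by (auto simp: complex_norm_square mult.commute simp del: of_real_power)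
qed

lemma col_normalize:
  assumes "v \<in> mx N 1" "v \<noteq> 0"
  shows "\<exists>c. c \<noteq> 0 \<and> adj (scl c v) * scl c v = E 0 0"
proof -
  define r where "r = (\<Sum>k<N. (cmod (entry v k 0))\<^sup>2)"
  have "\<exists>i j. entry v i j \<noteq> 0" using assms(2) fmat_eqI[of v 0] by auto
  then obtain k where k: "entry v k 0 \<noteq> 0" "k < N" using assms(1) by (force simp: mx_def)
  have "r > 0" unfolding r_def by (rule sum_pos2[of _ k]) (use k in auto)
  then have "of_real (1 / sqrt r) \<noteq> (0::complex)" by simp
  moreover have c1: "adj (scl (of_real (1 / sqrt r)) v) * scl (of_real (1 / sqrt r)) v
      = scl (of_real (1 / sqrt r * (1 / sqrt r) * r)) (E 0 0)"
    unfolding adj_simps scl_mult_left scl_mult_right scl_simps(4) col_sq[OF assms(1), folded r_def]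
    by (simp del: real_sqrt_mult_self)
  moreover have "1 / sqrt r * (1 / sqrt r) * r = 1" using \<open>r > 0\<close> by simp
  ultimately show ?thesis by (metis of_real_1 scl_simps(5))
qed

text \<open>The projections are treated one at a time: if \<open>q * w\<close> is nonzero it
  replaces \<open>w\<close>, otherwise \<open>w\<close> is kept. Since the projections commute with
  each other and with \<open>P\<close>, the eigenvalue equations found earlier survive the
  replacement.\<close>

lemma common_eigenvector:
  assumes "v \<noteq> 0" "v \<in> mx N 1" "P * v = v"
    and "\<And>p. p \<in> set ps \<Longrightarrow> p * p = p \<and> p \<in> mx N N \<and> p * P = P * p"
    and "\<And>p q. p \<in> set ps \<Longrightarrow> q \<in> set ps \<Longrightarrow> p * q = q * p"
  shows "\<exists>w. w \<noteq> 0 \<and> w \<in> mx N 1 \<and> P * w = w \<and> (\<forall>p\<in>set ps. p * w = w \<or> p * w = 0)"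
  using assms(4,5)
proof (induction ps)
  case Nil
  then show ?case using assms(1-3) by auto
next
  case (Cons q ps)
  then obtain w where w: "w \<noteq> 0" "w \<in> mx N 1" "P * w = w" "\<forall>p\<in>set ps. p * w = w \<or> p * w = 0"
    by auto
  show ?case
  proof (cases "q * w = 0")
    case True then show ?thesis using w by auto
  next
    case False
    have q: "q * q = q" "q \<in> mx N N" "q * P = P * q" using Cons.prems(1)[of q] by auto
    have "P * (q * w) = q * w" by (metis q(3) w(3) mult.assoc)
    moreover have "q * (q * w) = q * w" by (metis q(1) mult.assoc)
    moreover have "p * (q * w) = q * w \<or> p * (q * w) = 0" if "p \<in> set ps" for p
    proof -
      have "p * (q * w) = q * (p * w)" using Cons.prems(2)[of p q] that by (simp flip: mult.assoc)
      then show ?thesis using w(4) that by auto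
    qed
    ultimately show ?thesis using False q w by (intro exI[of _ "q * w"]) auto
  qed
qed

text \<open>Rank-one projections are split off \<open>P\<close> one at a time. Each lowers the trace
  by one, and the trace of a projection is nonnegative, so the process stops; the induction is on a
  natural number above the trace.\<close>

lemma adapted_basis:
  assumes "proj P" "P \<in> mx N N"
    and "\<And>p. p \<in> set ps \<Longrightarrow> proj p \<and> p \<in> mx N N \<and> p * P = P * p"
    and "\<And>p q. p \<in> set ps \<Longrightarrow> q \<in> set ps \<Longrightarrow> p * q = q * p"
  shows "\<exists>\<xi>s. P = (\<Sum>i<length \<xi>s. \<xi>s ! i * adj (\<xi>s ! i)) \<and>
     (\<forall>\<xi>\<in>set \<xi>s. \<xi> \<in> mx N 1 \<and> P * \<xi> = \<xi> \<and> (\<forall>p\<in>set ps. p * \<xi> = \<xi> \<or> p * \<xi> = 0)) \<and>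
     (\<forall>i<length \<xi>s. \<forall>j<length \<xi>s. adj (\<xi>s ! i) * \<xi>s ! j = (if i = j then E 0 0 else 0))"
proof -
  obtain k :: nat where "Re (tr P) < real k" using reals_Archimedean2 by blast
  then show ?thesis using assms(1-3)
  proof (induction k arbitrary: P)
    case 0 then show ?case using proj_tr_nonneg[of P] by auto
  next
    case (Suc k)
    show ?case
    proof (cases "P = 0")
      case True then show ?thesis by (intro exI[of _ "[]"]) auto
    next
      case False
      then obtain i j where ij: "entry P i j \<noteq> 0" using fmat_eqI[of P 0] by auto
      have P: "adj P = P" "P * P = P" using Suc.prems by (auto simp: proj_def)
      \<comment> \<open>A nonzero column of \<open>P\<close>, moved to position 0, is a starting
        vector in the range of \<open>P\<close>.\<close>
      have "P * E j 0 \<noteq> 0" using ij by (metis entry_mult_E entry_zero)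
      moreover have "P * E j 0 \<in> mx N 1" using Suc.prems(3) ij by (intro mx_mult[of P N N] mx_closed) (auto simp: mx_def)
      moreover have "P * (P * E j 0) = P * E j 0" by (metis P(2) mult.assoc)
      ultimately obtain w where w: "w \<noteq> 0" "w \<in> mx N 1" "P * w = w" "\<forall>p\<in>set ps. p * w = w \<or> p * w = 0"
        using common_eigenvector[of "P * E j 0" N P ps] Suc.prems(4) assms(4) by (auto simp: proj_def)
      obtain c where c: "adj (scl c w) * scl c w = E 0 0" using col_normalize[OF w(2,1)] by auto
      define x where "x = scl c w"
      have x: "adj x * x = E 0 0" "x \<in> mx N 1" "P * x = x" "\<forall>p\<in>set ps. p * x = x \<or> p * x = 0"
        using c w unfolding x_def by (auto simp: scl_mult_right scl_simps)
      have xE: "x * E 0 0 = x" using mult_idm[OF x(2)] by (simp add: idm_def)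
      have xP: "adj x * P = adj x" by (metis P(1) x(3) adj_mult)
      \<comment> \<open>A self-adjoint \<open>p\<close> with eigenvector \<open>x\<close> commutes
        with the rank-one projection of \<open>x\<close>, and therefore also with the remainder
        \<open>P'\<close>.\<close>
      have p1: "p * (x * adj x) = x * adj x * p" if "p \<in> set ps" for p
      proof -
        have ap: "adj p = p" using Suc.prems(4)[OF that] by (auto simp: proj_def)
        have "adj x * p = adj (p * x)" using ap by simp
        with x(4) that show ?thesis by (metis adj_simps(3) mult.assoc mult_zero_left mult_zero_right)
      qed
      have xx: "x * adj x * (x * adj x) = x * adj x"
        by (metis mult.assoc x(1) xE)
      define P' where "P' = P - x * adj x"
      have a1: "P * (x * adj x) = x * adj x" by (metis mult.assoc x(3))
      have a2: "x * adj x * P = x * adj x" by (metis mult.assoc xP)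
      have h1: "proj P'" unfolding proj_def P'_def using a1 a2 xx P by (simp add: algebra_simps)
      have h2: "P' \<in> mx N N" unfolding P'_def using Suc.prems(3) x(2) by (intro mx_closed mx_mult) auto
      have h3: "Re (tr P') < real k"
        unfolding P'_def tr_minus tr_commute[of x] x(1) using Suc.prems(1) by simp
      have h4: "proj p \<and> p \<in> mx N N \<and> p * P' = P' * p" if "p \<in> set ps" for p
        using Suc.prems(4)[OF that] p1[OF that] unfolding P'_def by (auto simp: right_diff_distrib left_diff_distrib)
      have ih: "\<exists>\<xi>s. P' = (\<Sum>i<length \<xi>s. \<xi>s ! i * adj (\<xi>s ! i)) \<and>
         (\<forall>\<xi>\<in>set \<xi>s. \<xi> \<in> mx N 1 \<and> P' * \<xi> = \<xi> \<and> (\<forall>p\<in>set ps. p * \<xi> = \<xi> \<or> p * \<xi> = 0)) \<and>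
         (\<forall>i<length \<xi>s. \<forall>j<length \<xi>s. adj (\<xi>s ! i) * \<xi>s ! j = (if i = j then E 0 0 else 0))"
        by (rule Suc.IH[OF h3 h1 h2 h4])
      obtain \<xi>s where xs: "P' = (\<Sum>i<length \<xi>s. \<xi>s ! i * adj (\<xi>s ! i))"
        "\<forall>\<xi>\<in>set \<xi>s. \<xi> \<in> mx N 1 \<and> P' * \<xi> = \<xi> \<and> (\<forall>p\<in>set ps. p * \<xi> = \<xi> \<or> p * \<xi> = 0)"
        "\<forall>i<length \<xi>s. \<forall>j<length \<xi>s. adj (\<xi>s ! i) * \<xi>s ! j = (if i = j then E 0 0 else 0)"
        using ih by (elim exE conjE) (rule that)
      have "E 0 0 * adj x = adj x" using arg_cong[OF xE, of adj] by simp
      then have b0: "adj x * P' = 0"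
        unfolding P'_def right_diff_distrib xP using x(1) by (simp flip: mult.assoc)
      have b1: "adj x * \<xi> = 0" if "\<xi> \<in> set \<xi>s" for \<xi> using bspec[OF xs(2) that] b0
        by (metis mult.assoc mult_zero_left)
      have b2: "adj \<xi> * x = 0" if "\<xi> \<in> set \<xi>s" for \<xi>
        using arg_cong[OF b1[OF that], of adj] by simp
      have b3: "P * \<xi> = \<xi>" if "\<xi> \<in> set \<xi>s" for \<xi>
        using bspec[OF xs(2) that] b1[OF that] unfolding P'_def
        by (simp add: left_diff_distrib mult.assoc)
      have c1: "P = (\<Sum>i<length (x # \<xi>s). (x # \<xi>s) ! i * adj ((x # \<xi>s) ! i))"
        by (simp add: sum.lessThan_Suc_shift xs(1)[symmetric] P'_def del: sum.lessThan_Suc)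
      have c2: "\<forall>\<xi>\<in>set (x # \<xi>s). \<xi> \<in> mx N 1 \<and> P * \<xi> = \<xi> \<and> (\<forall>p\<in>set ps. p * \<xi> = \<xi> \<or> p * \<xi> = 0)"
        using x(2-4) xs(2) b3 by simp
      have "adj ((x # \<xi>s) ! i) * (x # \<xi>s) ! j = (if i = j then E 0 0 else 0)"
        if "i < length (x # \<xi>s)" "j < length (x # \<xi>s)" for i j
        using that x(1) xs(3) b1 b2 by (cases i; cases j) auto
      then have c3: "\<forall>i<length (x # \<xi>s). \<forall>j<length (x # \<xi>s). adj ((x # \<xi>s) ! i) * (x # \<xi>s) ! j = (if i = j then E 0 0 else 0)"
        by blast
      from c1 c2 c3 show ?thesis by (intro exI[of _ "x # \<xi>s"] conjI)
    qed
  qed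
qed

section \<open>Star-extendible maps and their spreads\<close>

abbreviation M3 :: "nat \<Rightarrow> fmat set" where "M3 n \<equiv> mx (3 * n) (3 * n)"

text \<open>The size \<open>Suc i * m\<close> is the least one that contains all indices with
  quotient \<open>i\<close>.\<close>

definition block_proj :: "nat \<Rightarrow> nat \<Rightarrow> fmat" where
  "block_proj m i = mx_of (Suc i * m) (\<lambda>s t. if s = t \<and> s div m = i then 1 else 0)"

text \<open>These are the invariant projections of \<open>tri m\<close>; their spreads form the
  nests attached to the rows of a map.\<close>

definition flag_proj :: "nat \<Rightarrow> nat \<Rightarrow> fmat" where
  "flag_proj m i = (\<Sum>j<i. block_proj m j)"

definition tri :: "nat \<Rightarrow> fmat set" where
  "tri m = {x \<in> M3 m. \<forall>i j. j div m < i div m \<longrightarrow> entry x i j = 0}"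

lemma entry_block_proj: "m > 0 \<Longrightarrow> entry (block_proj m i) s t = (if s = t \<and> s div m = i then 1 else 0)"
  by (auto simp: block_proj_def entry_mx_of) (metis dividend_less_div_times add.commute mult.commute mult_Suc_right)+

lemma entry_flag_proj: "m > 0 \<Longrightarrow> entry (flag_proj m i) s t = (if s = t \<and> s div m < i then 1 else 0)"
proof -
  assume "m > 0"
  then have "entry (flag_proj m i) s t = (\<Sum>j<i. if j = s div m then (if s = t then 1 else 0) else 0)"
    unfolding flag_proj_def entry_sum by (intro sum.cong) (auto simp: entry_block_proj)
  then show ?thesis by auto
qed

lemma entry_diag_mult:
  assumes "\<And>s t. entry d s t = (if s = t \<and> P s then 1 else 0)"
  shows "entry (d * x) i j = (if P i then entry x i j else 0)"
    and "entry (x * d) i j = (if P j then entry x i j else 0)"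
proof -
  have "entry (d * x) i j = (\<Sum>k<Suc i. entry d i k * entry x k j)"
    by (rule entry_times) (auto simp: assms)
  also have "\<dots> = (\<Sum>k<Suc i. if k = i then (if P i then entry x i j else 0) else 0)"
    by (rule sum.cong) (auto simp: assms)
  finally show "entry (d * x) i j = (if P i then entry x i j else 0)" by simp
  have "entry (x * d) i j = (\<Sum>k<Suc j. entry x i k * entry d k j)"
    by (rule entry_times) (auto simp: assms)
  also have "\<dots> = (\<Sum>k<Suc j. if k = j then (if P j then entry x i j else 0) else 0)"
    by (rule sum.cong) (auto simp: assms)
  finally show "entry (x * d) i j = (if P j then entry x i j else 0)" by simp
qed

lemma entry_block_proj_mult: "m > 0 \<Longrightarrow> entry (block_proj m i * x) s t = (if s div m = i then entry x s t else 0)"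
  "m > 0 \<Longrightarrow> entry (x * block_proj m i) s t = (if t div m = i then entry x s t else 0)"
  by (rule entry_diag_mult, simp add: entry_block_proj)+

lemma entry_flag_proj_mult: "m > 0 \<Longrightarrow> entry (flag_proj m i * x) s t = (if s div m < i then entry x s t else 0)"
  "m > 0 \<Longrightarrow> entry (x * flag_proj m i) s t = (if t div m < i then entry x s t else 0)"
  by (rule entry_diag_mult, simp add: entry_flag_proj)+

lemma div_lt: "m > 0 \<Longrightarrow> s < 3 * m \<longleftrightarrow> s div m < (3::nat)"
  by (simp add: div_less_iff_less_mult)

lemma block_proj_mx: "m > 0 \<Longrightarrow> i < 3 \<Longrightarrow> block_proj m i \<in> M3 m"
  by (auto simp: mx_def entry_block_proj div_lt split: if_splits)

lemma flag_proj_mx: "m > 0 \<Longrightarrow> i \<le> 3 \<Longrightarrow> flag_proj m i \<in> M3 m"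
  by (auto simp: mx_def entry_flag_proj div_lt split: if_splits)

lemma flag_proj_3: "m > 0 \<Longrightarrow> flag_proj m 3 = idm (3 * m)"
  by (auto intro!: fmat_eqI simp: entry_flag_proj div_lt)

lemma sum_block_proj: "m > 0 \<Longrightarrow> (\<Sum>j<3. block_proj m j) = idm (3 * m)"
  by (simp add: flag_proj_3[symmetric] flag_proj_def)

lemma block_proj_mult: "m > 0 \<Longrightarrow> block_proj m i * block_proj m j = (if i = j then block_proj m i else 0)"
  by (auto intro!: fmat_eqI simp: entry_block_proj_mult entry_block_proj)

lemma adj_block_proj[simp]: "m > 0 \<Longrightarrow> adj (block_proj m i) = block_proj m i"
  by (auto intro!: fmat_eqI simp: entry_block_proj)

lemma adj_flag_proj[simp]: "m > 0 \<Longrightarrow> adj (flag_proj m i) = flag_proj m i"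
  by (auto intro!: fmat_eqI simp: entry_flag_proj)

lemma tri_flag_proj: "m > 0 \<Longrightarrow> x \<in> tri m \<Longrightarrow> flag_proj m i * (x * flag_proj m i) = x * flag_proj m i"
  by (rule fmat_eqI) (auto simp: entry_flag_proj_mult tri_def)

lemma tri_I:
  assumes "m > 0" "x \<in> M3 m" "\<And>i j. j < i \<Longrightarrow> i < 3 \<Longrightarrow> block_proj m i * x * block_proj m j = 0"
  shows "x \<in> tri m"
  unfolding tri_def
proof (safe intro!: assms(2))
  fix i j assume ij: "j div m < i div m"
  show "entry x i j = 0"
  proof (cases "i < 3 * m")
    case True
    then have "entry (block_proj m (i div m) * x * block_proj m (j div m)) i j = 0"
      using assms(1,3) ij by (simp add: div_lt)
    then show ?thesis using assms(1) by (simp add: entry_block_proj_mult)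
  qed (use assms(2) in \<open>auto simp: mx_def\<close>)
qed

text \<open>The two membership hypotheses kill the entries on both sides of the block
  diagonal.\<close>

lemma tri_diag_commute:
  assumes "m > 0" "x \<in> tri m" "adj x \<in> tri m"
  shows "x * block_proj m i = block_proj m i * x"
proof (rule fmat_eqI)
  fix a b
  have "entry x a b = 0" if "a div m \<noteq> b div m"
  proof -
    have "a div m < b div m \<or> b div m < a div m" using that by auto
    then show ?thesis using assms(2,3) unfolding tri_def by (auto simp: )
  qed
  then show "entry (x * block_proj m i) a b = entry (block_proj m i * x) a b"
    using assms(1) by (auto simp: entry_block_proj_mult)
qed

lemma E_tri: "n > 0 \<Longrightarrow> s < 3 * n \<Longrightarrow> t < 3 * n \<Longrightarrow> s div n \<le> t div n \<Longrightarrow> E s t \<in> tri n"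
  by (auto simp: tri_def)

text \<open>For \<open>q\<close> commuting with \<open>h (E t t)\<close>, \<open>spread n h t q\<close> is the element of the commutant of the range of
  \<open>h\<close> that agrees with \<open>q\<close> on the range of \<open>h (E t t)\<close>. The spreads of the block projections describe how
  \<open>h\<close> distributes the row \<open>t\<close> over the three blocks of the target.\<close>

definition spread :: "nat \<Rightarrow> (fmat \<Rightarrow> fmat) \<Rightarrow> nat \<Rightarrow> fmat \<Rightarrow> fmat" where
  "spread n h t q = (\<Sum>s<3 * n. h (E s t) * q * h (E t s))"

lemma spread_sum: "spread n h t (sum f A) = (\<Sum>a\<in>A. spread n h t (f a))"
  unfolding spread_def sum_distrib_left sum_distrib_right by (rule sum.swap)

text \<open>The criterion for regularity, stated for all rows instead of one row per block; rows of
  the same block have the same spreads by \<open>spread_block\<close>.\<close>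

definition commuting :: "nat \<Rightarrow> nat \<Rightarrow> (fmat \<Rightarrow> fmat) \<Rightarrow> bool" where
  "commuting n m h \<longleftrightarrow> (\<forall>t<3 * n. \<forall>u<3 * n. \<forall>i<3. \<forall>j<3.
     spread n h t (block_proj m i) * spread n h u (block_proj m j) = spread n h u (block_proj m j) * spread n h t (block_proj m i))"

locale tri_hom =
  fixes n m :: nat and h :: "fmat \<Rightarrow> fmat"
  assumes n0: "n > 0" and m0: "m > 0"
    and h_mx: "x \<in> M3 n \<Longrightarrow> h x \<in> M3 m"
    and h_add: "x \<in> M3 n \<Longrightarrow> y \<in> M3 n \<Longrightarrow> h (x + y) = h x + h y"
    and h_mult: "x \<in> M3 n \<Longrightarrow> y \<in> M3 n \<Longrightarrow> h (x * y) = h x * h y"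
    and h_scl: "x \<in> M3 n \<Longrightarrow> h (scl c x) = scl c (h x)"
    and h_adj: "x \<in> M3 n \<Longrightarrow> h (adj x) = adj (h x)"
    and h_tri: "x \<in> tri n \<Longrightarrow> h x \<in> tri m"
begin

lemma h_zero: "h 0 = 0"
  using h_scl[of 0 0] by (auto simp: scl_simps)

lemma h_sum: "(\<And>a. a \<in> A \<Longrightarrow> f a \<in> M3 n) \<Longrightarrow> h (sum f A) = (\<Sum>a\<in>A. h (f a))"
proof (induction A rule: infinite_finite_induct)
  case (insert a A)
  then show ?case by (simp add: h_add mx_sum)
qed (auto simp: h_zero)

lemma h_diff: "x \<in> M3 n \<Longrightarrow> y \<in> M3 n \<Longrightarrow> h (x - y) = h x - h y"
  using h_add[of "x - y" y] by (simp add: mx_closed)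

abbreviation "V s t \<equiv> h (E s t)"

lemma EM: "s < 3 * n \<Longrightarrow> t < 3 * n \<Longrightarrow> E s t \<in> M3 n" by auto

lemma V_mult: "s < 3 * n \<Longrightarrow> t < 3 * n \<Longrightarrow> u < 3 * n \<Longrightarrow> v < 3 * n \<Longrightarrow> V s t * V u v = (if t = u then V s v else 0)"
  using h_mult[OF EM EM, of s t u v] by (auto simp: E_mult h_zero)

lemma V_adj: "s < 3 * n \<Longrightarrow> t < 3 * n \<Longrightarrow> adj (V s t) = V t s"
  using h_adj[OF EM, of s t] by auto

lemma V_mx: "s < 3 * n \<Longrightarrow> t < 3 * n \<Longrightarrow> V s t \<in> M3 m"
  using h_mx EM by auto

text \<open>Inside one block row both \<open>E s t\<close> and its adjoint are triangular, so the
  image is block diagonal.\<close>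

lemma V_diag: "s < 3 * n \<Longrightarrow> t < 3 * n \<Longrightarrow> s div n = t div n \<Longrightarrow> V s t * block_proj m i = block_proj m i * V s t"
  by (rule tri_diag_commute) (auto simp: m0 n0 V_adj intro!: h_tri E_tri)

lemma h_expand: "x \<in> M3 n \<Longrightarrow> h x = (\<Sum>s<3*n. \<Sum>t<3*n. scl (entry x s t) (V s t))"
proof -
  assume x: "x \<in> M3 n"
  have "h x = h (\<Sum>s<3*n. \<Sum>t<3*n. scl (entry x s t) (E s t))"
    using mx_expand[OF x] by simp
  also have "\<dots> = (\<Sum>s<3*n. h (\<Sum>t<3*n. scl (entry x s t) (E s t)))"
    by (rule h_sum) (auto intro!: mx_sum mx_closed)
  also have "\<dots> = (\<Sum>s<3*n. \<Sum>t<3*n. scl (entry x s t) (V s t))"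
    by (rule sum.cong[OF refl], subst h_sum) (auto intro!: mx_sum mx_closed sum.cong h_scl)
  finally show ?thesis .
qed

text \<open>The relations of the matrix units collapse the sum to one term, and the two products
  give the same expression. Hence spreads commute with the range of \<open>h\<close>.\<close>

lemma V_spread:
  assumes "u < 3 * n" "v < 3 * n" "t < 3 * n"
  shows "V u v * spread n h t q = V u t * q * V t v" "spread n h t q * V u v = V u t * q * V t v"
proof -
  have "V u v * spread n h t q = (\<Sum>s<3*n. V u v * V s t * q * V t s)"
    by (simp add: spread_def sum_distrib_left mult.assoc)
  also have "\<dots> = (\<Sum>s<3*n. if s = v then V u t * q * V t v else 0)"
    by (rule sum.cong) (use assms V_mult in auto)
  finally show "V u v * spread n h t q = V u t * q * V t v" using assms by simp
  have "spread n h t q * V u v = (\<Sum>s<3*n. V s t * q * (V t s * V u v))"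
    by (simp add: spread_def sum_distrib_right mult.assoc)
  also have "\<dots> = (\<Sum>s<3*n. if s = u then V u t * q * V t v else 0)"
    by (rule sum.cong) (use assms V_mult in auto)
  finally show "spread n h t q * V u v = V u t * q * V t v" using assms by simp
qed

lemma spread_commute: "t < 3 * n \<Longrightarrow> x \<in> M3 n \<Longrightarrow> h x * spread n h t q = spread n h t q * h x"
  by (simp add: h_expand sum_distrib_left sum_distrib_right scl_mult_left scl_mult_right V_spread)

lemma h_idm: "h (idm (3 * n)) = (\<Sum>s<3*n. V s s)"
  unfolding idm_def by (rule h_sum) auto

lemma h_idm_mult: "x \<in> M3 n \<Longrightarrow> h (idm (3*n)) * h x = h x" "x \<in> M3 n \<Longrightarrow> h x * h (idm (3*n)) = h x"
  using h_mult[of "idm (3*n)" x] h_mult[of x "idm (3*n)"] by (simp_all add: idm_mx idm_mult mult_idm)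

lemma idm_spread: "t < 3 * n \<Longrightarrow> h (idm (3*n)) * spread n h t q = spread n h t q" 
  unfolding spread_def sum_distrib_left
  by (rule sum.cong) (auto simp: mult.assoc[symmetric] h_idm_mult EM)

lemma spread_idm: "t < 3 * n \<Longrightarrow> spread n h t q * h (idm (3*n)) = spread n h t q" 
  unfolding spread_def sum_distrib_right
  by (rule sum.cong) (auto simp: mult.assoc h_idm_mult EM)

lemma spread_one: "t < 3 * n \<Longrightarrow> spread n h t (idm (3*m)) = h (idm (3*n))"
  unfolding spread_def h_idm by (rule sum.cong) (auto simp: mult_idm[OF V_mx] V_mult)

lemma spread_mx: "t < 3 * n \<Longrightarrow> q \<in> M3 m \<Longrightarrow> spread n h t q \<in> M3 m"
  unfolding spread_def by (intro mx_sum mx_mult[of _ "3*m" "3*m"]) (auto simp: V_mx)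

lemma spread_adj: "t < 3 * n \<Longrightarrow> adj (spread n h t q) = spread n h t (adj q)"
  unfolding spread_def adj_sum by (rule sum.cong) (auto simp: V_adj mult.assoc)

lemma spread_mult: assumes "t < 3 * n" "u < 3 * n"
  shows "spread n h t q * spread n h u q' = (\<Sum>s<3*n. V s t * q * V t u * q' * V u s)"
proof -
  have "spread n h t q * spread n h u q' = (\<Sum>s<3*n. V s t * q * (V t s * spread n h u q'))"
    by (subst (1) spread_def) (simp add: sum_distrib_right mult.assoc)
  then show ?thesis using assms by (simp add: V_spread mult.assoc)
qed

text \<open>The projection \<open>V t t\<close> commutes with block projections, so spreading from
  row \<open>t\<close> is multiplicative on them.\<close>

lemma spread_block_proj_mult: "t < 3 * n \<Longrightarrow> spread n h t (block_proj m i) * spread n h t (block_proj m j) = (if i = j then spread n h t (block_proj m i) else 0)"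
proof -
  assume t: "t < 3 * n"
  have "V s t * block_proj m i * V t t * block_proj m j * V t s = V s t * (block_proj m i * block_proj m j) * V t s" if "s < 3 * n" for s
  proof -
    have "V s t * block_proj m i * V t t * block_proj m j * V t s = V s t * block_proj m i * (block_proj m j * V t t) * V t s"
      using V_diag[of t t j] t by (simp add: mult.assoc)
    then show ?thesis using t that V_mult[of t t t s] by (simp add: mult.assoc)
  qed
  then show ?thesis unfolding spread_mult[OF t t] using m0 by (simp add: block_proj_mult) (simp add: spread_def)
qed

text \<open>This is where triangularity enters: if the block of \<open>t\<close> does not come after
  that of \<open>u\<close>, then \<open>V t u\<close> is triangular and leaves the range of each
  flag projection invariant. So the nests decrease as the row moves down.\<close>

lemma spread_flag_le: 
  assumes "t < 3 * n" "u < 3 * n" "t div n \<le> u div n"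
  shows "spread n h t (flag_proj m i) * spread n h u (flag_proj m i) = spread n h u (flag_proj m i)"
proof -
  have "V t u \<in> tri m" using assms by (intro h_tri E_tri n0)
  then have tb: "flag_proj m i * (V t u * flag_proj m i) = V t u * flag_proj m i" by (rule tri_flag_proj[OF m0])
  have "V s t * flag_proj m i * V t u * flag_proj m i * V u s = V s u * flag_proj m i * V u s" if "s < 3 * n" for s
  proof -
    have "V s t * flag_proj m i * V t u * flag_proj m i * V u s = V s t * (flag_proj m i * (V t u * flag_proj m i)) * V u s"
      by (simp only: mult.assoc)
    also have "\<dots> = (V s t * V t u) * flag_proj m i * V u s" unfolding tb by (simp only: mult.assoc)
    finally show ?thesis using assms that by (simp add: V_mult)
  qed
  then show ?thesis unfolding spread_mult[OF assms(1,2)] by (simp add: spread_def)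
qed

lemma spread_flag_le': 
  assumes "t < 3 * n" "u < 3 * n" "t div n \<le> u div n"
  shows "spread n h u (flag_proj m i) * spread n h t (flag_proj m i) = spread n h u (flag_proj m i)"
  using arg_cong[OF spread_flag_le[OF assms, of i], of adj] assms m0 by (simp add: spread_adj)

lemma spread_flag: "spread n h t (flag_proj m i) = (\<Sum>j<i. spread n h t (block_proj m j))"
  unfolding flag_proj_def by (rule spread_sum)

lemma spread_flag_lattice:
  assumes "t < 3 * n" "i \<le> j"
  shows "spread n h t (flag_proj m i) * spread n h t (flag_proj m j) = spread n h t (flag_proj m i)"
        "spread n h t (flag_proj m j) * spread n h t (flag_proj m i) = spread n h t (flag_proj m i)"
proof -
  have "spread n h t (flag_proj m i) * spread n h t (flag_proj m j) = (\<Sum>a<i. \<Sum>b<j. if a = b then spread n h t (block_proj m a) else 0)"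
    unfolding spread_flag sum_product using assms by (simp add: spread_block_proj_mult)
  also have "\<dots> = (\<Sum>a<i. spread n h t (block_proj m a))" using assms by (intro sum.cong) auto
  finally show 1: "spread n h t (flag_proj m i) * spread n h t (flag_proj m j) = spread n h t (flag_proj m i)"
    by (simp add: spread_flag)
  show "spread n h t (flag_proj m j) * spread n h t (flag_proj m i) = spread n h t (flag_proj m i)"
    using arg_cong[OF 1, of adj] assms m0 by (simp add: spread_adj)
qed

text \<open>The unit \<open>V u t\<close> relating the two rows is block diagonal and carries one
  expression into the other. So a map has one nest for each block row, and \<open>i * n\<close> can
  represent block row \<open>i\<close>.\<close>

lemma spread_block: 
  assumes "t < 3 * n" "u < 3 * n" "t div n = u div n"
  shows "spread n h t (block_proj m i) = spread n h u (block_proj m i)"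
  unfolding spread_def
proof (rule sum.cong)
  fix s assume s: "s \<in> {..<3*n}"
  have "V s t * block_proj m i * V t s = V s u * (V u t * block_proj m i) * V t s"
    using s assms V_mult[of s u u t] by (simp add: mult.assoc[symmetric])
  also have "\<dots> = V s u * block_proj m i * (V u t * V t s)"
    using V_diag[of u t i] assms by (simp add: mult.assoc)
  finally show "V s t * block_proj m i * V t s = V s u * block_proj m i * V u s" using s assms V_mult by simp
qed auto

lemma V_cut: "t < 3 * n \<Longrightarrow> V t t * spread n h t (block_proj m i) = V t t * block_proj m i"
  using V_spread(1)[of t t t "block_proj m i"] V_diag[of t t i] V_mult[of t t t t] by (simp add: mult.assoc)

text \<open>On the range of one \<open>V t t\<close> a block projection agrees with its spread, by
  \<open>V_cut\<close>; this is summed over the rows of block \<open>i\<close>, whose spreads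
  coincide.\<close>

lemma block_proj_cut:
  assumes "i < 3"
  shows "h (block_proj n i) * spread n h (i * n) (block_proj m j) = h (block_proj n i) * block_proj m j"
proof -
  have e: "block_proj n i = (\<Sum>t \<in> {t. t < 3*n \<and> t div n = i}. E t t)"
  proof (rule fmat_eqI)
    fix a b
    have "entry (\<Sum>t \<in> {t. t < 3*n \<and> t div n = i}. E t t) a b = (\<Sum>t \<in> {t. t < 3*n \<and> t div n = i}. if t = a then (if a = b then 1 else 0) else 0)"
      unfolding entry_sum by (rule sum.cong) auto
    moreover have "finite {t. t < 3*n \<and> t div n = i}" by simp
    ultimately show "entry (block_proj n i) a b = entry (\<Sum>t \<in> {t. t < 3*n \<and> t div n = i}. E t t) a b"
      using n0 assms by (simp add: entry_block_proj sum.delta) (auto simp: div_lt)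
  qed
  have h: "h (block_proj n i) = (\<Sum>t \<in> {t. t < 3*n \<and> t div n = i}. V t t)"
    unfolding e by (rule h_sum) auto
  have b: "i * n < 3 * n" "i * n div n = i" using assms n0 by auto
  have "V t t * spread n h (i*n) (block_proj m j) = V t t * block_proj m j" if "t < 3*n" "t div n = i" for t
    using V_cut[OF that(1), of j] spread_block[of t "i*n" j] that b by simp
  then show ?thesis unfolding h sum_distrib_right by (intro sum.cong) auto
qed

end

lemma tri_hom_comp:
  assumes "tri_hom n m h" "tri_hom m l g" shows "tri_hom n l (\<lambda>x. g (h x))"
proof -
  interpret h: tri_hom n m h by fact
  interpret g: tri_hom m l g by fact
  show ?thesis
    by unfold_locales (simp_all add: h.n0 g.m0 h.h_mx g.h_mx h.h_add g.h_add h.h_mult g.h_mult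
      h.h_scl g.h_scl h.h_adj g.h_adj h.h_tri g.h_tri)
qed

text \<open>The image of the middle unit is written as the sum of the
  \<open>g (block_proj m j)\<close>. Next to the \<open>j\<close>-th of them
  \<open>block_proj l k\<close> may be exchanged for its spread from row \<open>j * m\<close>, which
  commutes with the range of \<open>g\<close> and can be moved to the end. The outcome resembles a
  matrix product, with first factors in the range of \<open>g\<close> and second factors in its
  commutant.\<close>

lemma spread_comp:
  assumes "tri_hom n m h" "tri_hom m l g" "t < 3 * n"
  shows "spread n (\<lambda>x. g (h x)) t (block_proj l k) = (\<Sum>j<3. g (spread n h t (block_proj m j)) * spread m g (j * m) (block_proj l k))"
proof -
  interpret h: tri_hom n m h by fact
  interpret g: tri_hom m l g by fact
  define S where "S j = spread m g (j * m) (block_proj l k)" for j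
  have jm: "j * m < 3 * m" if "j < 3" for j using that h.m0 by auto
  have cut: "g (block_proj m j) * S j = g (block_proj m j) * block_proj l k" if "j < 3" for j
    unfolding S_def by (rule g.block_proj_cut) fact
  have com: "g x * S j = S j * g x" if "x \<in> M3 m" "j < 3" for x j
    unfolding S_def by (rule g.spread_commute) (use that jm in auto)
  have bm: "block_proj m j \<in> M3 m" if "j < 3" for j using block_proj_mx h.m0 that by auto
  have "(\<Sum>j<3. g (spread n h t (block_proj m j)) * S j) = (\<Sum>j<3. \<Sum>s<3*n. g (h (E s t)) * g (block_proj m j) * g (h (E t s)) * S j)"
  proof (rule sum.cong[OF refl])
    fix j assume "j \<in> {..<3::nat}"
    then have j: "j < 3" by simp
    have "g (spread n h t (block_proj m j)) = (\<Sum>s<3*n. g (h (E s t) * block_proj m j * h (E t s)))"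
      unfolding spread_def by (rule g.h_sum) (auto intro!: mx_mult[OF mx_mult] h.V_mx bm assms j)
    also have "\<dots> = (\<Sum>s<3*n. g (h (E s t)) * g (block_proj m j) * g (h (E t s)))"
      by (rule sum.cong) (auto simp: g.h_mult h.V_mx bm j assms mx_mult[OF h.V_mx bm])
    finally show "g (spread n h t (block_proj m j)) * S j = (\<Sum>s<3*n. g (h (E s t)) * g (block_proj m j) * g (h (E t s)) * S j)"
      by (simp add: sum_distrib_right)
  qed
  also have "\<dots> = (\<Sum>s<3*n. \<Sum>j<3. g (h (E s t)) * g (block_proj m j) * g (h (E t s)) * S j)"
    by (rule sum.swap)
  also have "\<dots> = (\<Sum>s<3*n. \<Sum>j<3. g (h (E s t)) * g (block_proj m j) * block_proj l k * g (h (E t s)))"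
  proof (intro sum.cong refl)
    fix s j assume "s \<in> {..<3*n}" "j \<in> {..<3::nat}"
    then have s: "s < 3*n" and j: "j < 3" by auto
    have "g (h (E s t)) * g (block_proj m j) * g (h (E t s)) * S j = g (h (E s t)) * (g (block_proj m j) * S j) * g (h (E t s))"
      using com[OF h.V_mx j] s assms by (simp add: mult.assoc)
    then show "g (h (E s t)) * g (block_proj m j) * g (h (E t s)) * S j = g (h (E s t)) * g (block_proj m j) * block_proj l k * g (h (E t s))"
      unfolding cut[OF j] by (simp only: mult.assoc)
  qed
  also have "\<dots> = (\<Sum>s<3*n. g (h (E s t)) * (\<Sum>j<3. g (block_proj m j)) * block_proj l k * g (h (E t s)))"
    by (simp add: sum_distrib_left sum_distrib_right)
  also have "\<dots> = (\<Sum>s<3*n. g (h (E s t)) * block_proj l k * g (h (E t s)))"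
  proof (intro sum.cong refl)
    fix s assume s: "s \<in> {..<3*n}"
    have "(\<Sum>j<3. g (block_proj m j)) = g (idm (3*m))"
      unfolding sum_block_proj[OF h.m0, symmetric] by (rule g.h_sum[symmetric]) (auto intro: bm)
    moreover have "g (h (E s t)) * g (idm (3*m)) = g (h (E s t))" 
      by (rule g.h_idm_mult) (use h.V_mx s assms in auto)
    ultimately show "g (h (E s t)) * (\<Sum>j<3. g (block_proj m j)) * block_proj l k * g (h (E t s)) = g (h (E s t)) * block_proj l k * g (h (E t s))"
      by simp
  qed
  finally show ?thesis by (simp add: spread_def S_def)
qed

section \<open>Regular composites have a regular factor\<close>

text \<open>Cutting \<open>A B - B A\<close> down by \<open>I - a\<close> on the left and \<open>a\<close> on the right (respectively \<open>I - b\<close> and \<open>b\<close>)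
  leaves a single elementary tensor, whose first factor is nonzero unless \<open>a\<close> and \<open>b\<close> commute.\<close>

lemma ring_commutator_slices:
  fixes A B I a b b' a' c0 c1 c2 d0 d1 d2 :: "'r::ring"
  assumes AB: "A = a * c0 + (b' - a) * c1 + (I - b') * c2" "B = a' * d0 + (b - a') * d1 + (I - b) * d2"
    and comm: "\<And>x y. x \<in> {a, b, b', a', I} \<Longrightarrow> y \<in> {c0, c1, c2, d0, d1, d2} \<Longrightarrow> y * x = x * y"
    and id: "I * a = a" "I * b = b" "I * a' = a'" "I * b' = b'" 
    and lat: "a * a = a" "b * b = b" "a * a' = a'" "b * a' = a'" "b' * a = a" "b' * b = b" "b' * a' = a'" "a' * a = a'" "a' * b = a'"
    and AB_comm: "A * B = B * A"
  shows "(b * a - a * b * a) * (c1 * (d1 - d2) - (d1 - d2) * c0) = 0"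
    and "(a * b - b * a * b) * ((c0 - c1) * d1 - d2 * (c0 - c1)) = 0"
proof -
  note cm = comm[of a c0] comm[of a c1] comm[of a c2] comm[of a d0] comm[of a d1] comm[of a d2]
    comm[of b c0] comm[of b c1] comm[of b c2] comm[of b d0] comm[of b d1] comm[of b d2]
    comm[of b' c0] comm[of b' c1] comm[of b' c2] comm[of b' d0] comm[of b' d1] comm[of b' d2]
    comm[of a' c0] comm[of a' c1] comm[of a' c2] comm[of a' d0] comm[of a' d1] comm[of a' d2]
    comm[of I c0] comm[of I c1] comm[of I c2] comm[of I d0] comm[of I d1] comm[of I d2]
  have ext: "x * (y * z) = w * z" if "x * y = w" for x y z w :: 'r
    using that by (simp flip: mult.assoc)
  have ext2: "x * (y * z) = y * (x * z)" if "x * y = y * x" for x y z :: 'r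
    unfolding mult.assoc[symmetric] that ..
  \<comment> \<open>These rules bring every term into the form of a factor from the range followed
    by a factor from the commutant.\<close>
  note cm2 = cm[simplified, THEN ext2] cm[simplified]
  note l2 = lat id lat[THEN ext] id[THEN ext]
  note n = left_diff_distrib right_diff_distrib distrib_left distrib_right mult.assoc
  have "a * (A * B) * a - A * B * a = a * (B * A) * a - B * (A * a)" by (simp add: AB_comm mult.assoc)
  then show "(b * a - a * b * a) * (c1 * (d1 - d2) - (d1 - d2) * c0) = 0"
    unfolding AB by (simp add: n cm2 l2) (simp add: algebra_simps)
  have "b * (A * B) * b - A * B * b = b * (B * A) * b - B * A * b" by (simp add: AB_comm mult.assoc)
  then show "(a * b - b * a * b) * ((c0 - c1) * d1 - d2 * (c0 - c1)) = 0"
    unfolding AB by (simp add: n cm2 l2) (simp add: algebra_simps)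
qed


text \<open>Since \<open>d2\<close> lies below \<open>d1\<close>, multiplying \<open>s1\<close> by
  \<open>d2\<close> from the left kills the right side and makes \<open>c1\<close> commute with
  \<open>d2\<close>. Then \<open>c0\<close> and \<open>c1\<close> agree on \<open>d1 - d2\<close>,
  and \<open>s2\<close> passes the commutation on to \<open>c0\<close>.\<close>

lemma lattice_commute:
  assumes adj: "adj c0 = c0" "adj c1 = c1" "adj c2 = c2" "adj d0 = d0" "adj d1 = d1" "adj d2 = d2"
    and lat: "c1 * d1 = c1" "d2 * d1 = d2" "d2 * d2 = d2" "c0 * d0 = c0" "c2 * d2 = c2" 
    and s1: "c1 * (d1 - d2) = (d1 - d2) * c0" and s2: "(c0 - c1) * d1 = d2 * (c0 - c1)"
  shows "c0 * d1 = d1 * c0" "c0 * d2 = d2 * c0" "c1 * d2 = d2 * c1"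
proof -
  have "d2 * (c1 * (d1 - d2)) = 0"
    unfolding s1 using lat by (simp add: left_diff_distrib right_diff_distrib flip: mult.assoc)
  then have 1: "d2 * c1 = d2 * c1 * d2"
    using lat by (simp add: right_diff_distrib mult.assoc)
  have 2: "c1 * d2 = d2 * c1 * d2"
    using arg_cong[OF 1, of adj] unfolding adj_mult adj mult.assoc .
  from 2 1[symmetric] show 12: "c1 * d2 = d2 * c1" by (rule trans)
  have s1': "(d1 - d2) * c1 = c0 * (d1 - d2)"
    using arg_cong[OF s1, of adj] adj by simp
  have c1d1: "d1 * c1 = c1" using arg_cong[OF lat(1), of adj] adj by simp
  have "c1 * (d1 - d2) = (d1 - d2) * c1"
    using 12 c1d1 lat by (simp add: right_diff_distrib left_diff_distrib)
  then have y: "c0 * (d1 - d2) = (d1 - d2) * c0" "c0 * (d1 - d2) = c1 * (d1 - d2)" using s1 s1' by auto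
  have "(c0 - c1) * (d1 - d2) = 0" using y(2) by (simp add: left_diff_distrib)
  then have "(c0 - c1) * d1 = (c0 - c1) * d2" by (simp only: right_diff_distrib right_minus_eq)
  then have "(c0 - c1) * d2 = d2 * (c0 - c1)" using s2 by simp
  then show "c0 * d2 = d2 * c0" using 12 by (simp add: right_diff_distrib left_diff_distrib)
  then show "c0 * d1 = d1 * c0" using y(1) by (simp add: right_diff_distrib left_diff_distrib)
qed

context tri_hom begin

lemma block_proj_flag: "block_proj m 0 = flag_proj m 1" "block_proj m 1 = flag_proj m 2 - flag_proj m 1" "block_proj m 2 = idm (3 * m) - flag_proj m 2"
proof -
  have "flag_proj m 3 = flag_proj m 2 + block_proj m 2"
    by (simp add: flag_proj_def numeral_3_eq_3 numeral_2_eq_2 add_ac)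
  then show "block_proj m 2 = idm (3 * m) - flag_proj m 2" using flag_proj_3[OF m0] by simp
qed (simp_all add: flag_proj_def numeral_2_eq_2)

lemma spread_diff: "spread n h t (x - y) = spread n h t x - spread n h t y"
  by (simp add: spread_def right_diff_distrib left_diff_distrib sum_subtractf)

lemma commuting_flags:
  assumes "commuting n m h" "t < 3 * n" "u < 3 * n" "i \<le> 3" "j \<le> 3"
  shows "spread n h t (flag_proj m i) * spread n h u (flag_proj m j) = spread n h u (flag_proj m j) * spread n h t (flag_proj m i)"
proof -
  have "spread n h t (flag_proj m i) * spread n h u (flag_proj m j) = (\<Sum>a<i. \<Sum>b<j. spread n h t (block_proj m a) * spread n h u (block_proj m b))"
    by (simp add: spread_flag sum_product)
  also have "\<dots> = (\<Sum>a<i. \<Sum>b<j. spread n h u (block_proj m b) * spread n h t (block_proj m a))"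
    using assms by (intro sum.cong refl) (auto simp: commuting_def)
  also have "\<dots> = (\<Sum>b<j. \<Sum>a<i. spread n h u (block_proj m b) * spread n h t (block_proj m a))" by (rule sum.swap)
  finally show ?thesis by (simp add: spread_flag sum_product)
qed

text \<open>The nests given by the rows are decreasing, so all other pairs of their members are comparable.\<close>

lemma commutingI:
  assumes "\<And>t u. t < 3 * n \<Longrightarrow> u < 3 * n \<Longrightarrow> t div n < u div n \<Longrightarrow>
     spread n h t (flag_proj m 1) * spread n h u (flag_proj m 2) = spread n h u (flag_proj m 2) * spread n h t (flag_proj m 1)"
  shows "commuting n m h"
proof -
  have c: "spread n h t (flag_proj m i) * spread n h u (flag_proj m j) = spread n h u (flag_proj m j) * spread n h t (flag_proj m i)"
    if le: "t div n \<le> u div n" and tu: "t < 3*n" "u < 3*n" and ij: "i \<in> {1,2}" "j \<in> {1,2}" for t u i j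
  proof (cases "i < j")
    case True
    then have ij: "i = 1" "j = 2" using ij by auto
    show ?thesis
    proof (cases "t div n < u div n")
      case False
      then have "spread n h t (flag_proj m i) = spread n h u (flag_proj m i)"
        using le tu by (simp add: spread_flag spread_block[of t u])
      then show ?thesis using spread_flag_lattice[of u i j] tu True by simp
    qed (use assms[of t u] ij tu in auto)
  next
    case False
    \<comment> \<open>For \<open>j \<le> i\<close>, member \<open>j\<close> of the nest of
      \<open>u\<close> lies below member \<open>j\<close> of the nest of \<open>t\<close>, hence
      below its member \<open>i\<close>.\<close>
    have "spread n h t (flag_proj m i) * spread n h u (flag_proj m j) = spread n h t (flag_proj m i) * (spread n h t (flag_proj m j) * spread n h u (flag_proj m j))"
      using spread_flag_le[OF tu le] by simp
    also have "\<dots> = spread n h u (flag_proj m j)"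
      unfolding mult.assoc[symmetric] using spread_flag_lattice(2)[of t j i] False tu spread_flag_le[OF tu le] by simp
    finally have 1: "spread n h t (flag_proj m i) * spread n h u (flag_proj m j) = spread n h u (flag_proj m j)" .
    have "spread n h u (flag_proj m j) * spread n h t (flag_proj m i) = spread n h u (flag_proj m j)"
      using arg_cong[OF 1, of adj] tu m0 by (simp add: spread_adj)
    then show ?thesis using 1 by simp
  qed
  have c2: "spread n h t (flag_proj m i) * spread n h u (flag_proj m j) = spread n h u (flag_proj m j) * spread n h t (flag_proj m i)"
    if "t < 3*n" "u < 3*n" "i \<in> {1,2}" "j \<in> {1,2}" for t u i j
    using c[of t u i j] c[of u t j i] that by (cases "t div n \<le> u div n") auto
  define I where "I = h (idm (3 * n))"
  have I: "spread n h t x * I = I * spread n h t x" if "t < 3*n" for t x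
    using idm_spread spread_idm that by (simp add: I_def)
  show ?thesis unfolding commuting_def
  proof (intro allI impI)
    fix t u :: nat and i j :: nat assume tu: "t < 3*n" "u < 3*n" and ij: "i < 3" "j < 3"
    have d: "spread n h v (block_proj m 0) = spread n h v (flag_proj m 1)" "spread n h v (block_proj m 1) = spread n h v (flag_proj m 2) - spread n h v (flag_proj m 1)"
      "spread n h v (block_proj m 2) = I - spread n h v (flag_proj m 2)" if "v < 3*n" for v
      unfolding block_proj_flag spread_diff spread_one[OF that] I_def by simp_all
    have ij: "i = 0 \<or> i = 1 \<or> i = 2" "j = 0 \<or> j = 1 \<or> j = 2" using ij by auto
    show "spread n h t (block_proj m i) * spread n h u (block_proj m j) = spread n h u (block_proj m j) * spread n h t (block_proj m i)"
      using ij tu by (elim disjE; hypsubst) (simp_all only: d right_diff_distrib left_diff_distrib I c2[OF tu] insertI1 insertI2 singletonI algebra_simps)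
  qed
qed

text \<open>Simplicity of the matrix algebra: matrix units turn \<open>x\<close> into a nonzero
  multiple of any diagonal unit, while \<open>S\<close> commutes with the range and stays outside.
  So the first factor of an elementary tensor can be cancelled.\<close>

lemma slice:
  assumes "x \<in> M3 n" "x \<noteq> 0" "h (idm (3 * n)) * S = S" "h x * S = 0"
    and "\<And>y. y \<in> M3 n \<Longrightarrow> h y * S = S * h y"
  shows "S = 0"
proof -
  obtain s t where st: "entry x s t \<noteq> 0" using assms(2) fmat_eqI[of x 0] by auto
  then have st': "s < 3 * n" "t < 3 * n" using assms(1) by (auto simp: mx_def)
  have "h (E u u) * S = 0" if u: "u < 3 * n" for u
  proof -
    have "0 = h (E u s) * (h x * S) * h (E t u)" using assms(4) by simp
    also have "\<dots> = h (E u s) * h x * h (E t u) * S"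
      using assms(5)[OF EM[of t u]] u st' by (simp add: mult.assoc)
    also have "h (E u s) * h x * h (E t u) = h (E u s * x * E t u)"
      using mx_mult[OF EM[of u s] assms(1)] EM[of u s] EM[of t u]
      using h_mult[of "E u s" x] h_mult[of "E u s * x" "E t u"] assms(1) u st' by auto
    also have "\<dots> * S = scl (entry x s t) (h (E u u) * S)"
      using u by (simp add: E_sandwich h_scl EM scl_mult_left)
    finally have "scl (1 / entry x s t) (scl (entry x s t) (h (E u u) * S)) = 0" by (simp add: scl_simps)
    then show ?thesis using st by (simp add: scl_simps)
  qed
  then have "h (idm (3 * n)) * S = 0" by (simp add: h_idm sum_distrib_right)
  then show ?thesis using assms(3) by simp
qed

end

text \<open>If \<open>h\<close> fails, some pair of rows gives noncommuting \<open>a\<close> and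
  \<open>b\<close>. Both slices of the commutator of the composite then have a nonzero first factor,
  so the second factors vanish; these are the equations from which \<open>lattice_commute\<close>
  makes the nests of \<open>g\<close> commute.\<close>

lemma commuting_dichotomy:
  assumes h: "tri_hom n m h" and g: "tri_hom m l g" and cr: "commuting n l (\<lambda>x. g (h x))"
  shows "commuting n m h \<or> commuting m l g"
proof (rule ccontr)
  assume contra: "\<not> (commuting n m h \<or> commuting m l g)"
  interpret h: tri_hom n m h by fact
  interpret g: tri_hom m l g by fact
  interpret gh: tri_hom n l "\<lambda>x. g (h x)" by (rule tri_hom_comp) fact+
  obtain t u where tu: "t < 3*n" "u < 3*n" "t div n < u div n"
    and nc: "spread n h t (flag_proj m 1) * spread n h u (flag_proj m 2) \<noteq> spread n h u (flag_proj m 2) * spread n h t (flag_proj m 1)"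
    using contra h.commutingI by blast
  then have tu_le: "t div n \<le> u div n" by simp
  \<comment> \<open>\<open>a\<close> and \<open>b'\<close> form the nest of the upper row
    \<open>t\<close>, and \<open>a'\<close> and \<open>b\<close> the nest of the lower row
    \<open>u\<close>; all pairs except \<open>a\<close> and \<open>b\<close> are comparable.\<close>
  define a b b' a' I where ab: "a = spread n h t (flag_proj m 1)" "b = spread n h u (flag_proj m 2)" "b' = spread n h t (flag_proj m 2)"
    "a' = spread n h u (flag_proj m 1)" "I = h (idm (3*n))"
  define c d where "c i = spread m g (i * m) (flag_proj l 1)" and "d i = spread m g (i * m) (flag_proj l 2)" for i
  have im: "i * m < 3 * m" "i * m div m = i" if "i < 3" for i using that h.m0 by auto
  have abM: "a \<in> M3 m" "b \<in> M3 m" "b' \<in> M3 m" "a' \<in> M3 m" "I \<in> M3 m"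
    unfolding ab using tu h.m0 by (auto intro!: h.spread_mx flag_proj_mx h.h_mx idm_mx)
  \<comment> \<open>The block projections of the middle algebra are rewritten as differences of
    successive flags, the last flag becoming \<open>I\<close>.\<close>
  have comp: "spread n (\<lambda>x. g (h x)) v (flag_proj l k) = 
     g (spread n h v (flag_proj m 1)) * spread m g (0 * m) (flag_proj l k) + (g (spread n h v (flag_proj m 2)) - g (spread n h v (flag_proj m 1))) * spread m g (1 * m) (flag_proj l k)
     + (g I - g (spread n h v (flag_proj m 2))) * spread m g (2 * m) (flag_proj l k)" if v: "v < 3*n" for v k
  proof -
    have "spread n (\<lambda>x. g (h x)) v (flag_proj l k) = (\<Sum>i<k. \<Sum>j<3. g (spread n h v (block_proj m j)) * spread m g (j * m) (block_proj l i))"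
      unfolding gh.spread_flag by (rule sum.cong) (simp_all add: spread_comp[OF h g v])
    also have "\<dots> = (\<Sum>j<3. g (spread n h v (block_proj m j)) * spread m g (j * m) (flag_proj l k))"
      by (subst sum.swap) (simp add: g.spread_flag sum_distrib_left)
    also have "\<dots> = g (spread n h v (block_proj m 0)) * spread m g (0 * m) (flag_proj l k) + g (spread n h v (block_proj m 1)) * spread m g (1 * m) (flag_proj l k)
     + g (spread n h v (block_proj m 2)) * spread m g (2 * m) (flag_proj l k)" by (simp add: numeral_eq_Suc)
    finally show ?thesis
      using v h.m0 unfolding h.block_proj_flag h.spread_diff h.spread_one[OF v] ab(5)
      by (simp add: g.h_diff h.spread_mx flag_proj_mx h.h_mx idm_mx)
  qed
  have com: "spread n (\<lambda>x. g (h x)) t (flag_proj l 1) * spread n (\<lambda>x. g (h x)) u (flag_proj l 2)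
     = spread n (\<lambda>x. g (h x)) u (flag_proj l 2) * spread n (\<lambda>x. g (h x)) t (flag_proj l 1)"
    by (rule gh.commuting_flags) (use cr tu in auto)
  have cdc: "c i * g x = g x * c i" "d i * g x = g x * d i" if "x \<in> M3 m" "i < 3" for x i
    unfolding c_def d_def using g.spread_commute[OF im(1)[OF that(2)] that(1)] by simp_all
  have "g x \<in> {g a, g b, g b', g a', g I} \<Longrightarrow> y \<in> {c 0, c 1, c 2, d 0, d 1, d 2} \<Longrightarrow> y * g x = g x * y" for x y
    using cdc abM by auto
  then have cm: "x \<in> {g a, g b, g b', g a', g I} \<Longrightarrow> y \<in> {c 0, c 1, c 2, d 0, d 1, d 2} \<Longrightarrow> y * x = x * y" for x y
    by blast
  have lat: "I * a = a" "I * b = b" "I * a' = a'" "I * b' = b'" 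
    "a * a = a" "b * b = b" "a * a' = a'" "b * a' = a'" "b' * a = a" "b' * b = b" "b' * a' = a'" "a' * a = a'" "a' * b = a'"
  proof -
    show "I * a = a" "I * b = b" "I * a' = a'" "I * b' = b'" unfolding ab by (rule h.idm_spread, fact)+
    show 1: "a * a = a" "b * b = b" "b * a' = a'" "b' * a = a" "a' * b = a'" 
      unfolding ab by (simp_all add: h.spread_flag_lattice tu)
    show 2: "a * a' = a'" "b' * b = b" "a' * a = a'"
      unfolding ab using h.spread_flag_le[OF tu(1,2) tu_le] h.spread_flag_le'[OF tu(1,2) tu_le] by simp_all
    have "b' * a' = b' * b * a'" unfolding mult.assoc 1 ..
    then show "b' * a' = a'" using 1 2 by simp
  qed
  have gl: "g x * g y = g z" if "x * y = z" "x \<in> M3 m" "y \<in> M3 m" for x y z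
    using that g.h_mult by metis
  have glat: "g I * g a = g a" "g I * g b = g b" "g I * g a' = g a'" "g I * g b' = g b'" 
    "g a * g a = g a" "g b * g b = g b" "g a * g a' = g a'" "g b * g a' = g a'" "g b' * g a = g a" "g b' * g b = g b" 
    "g b' * g a' = g a'" "g a' * g a = g a'" "g a' * g b = g a'"
    by (rule gl; fact lat abM)+
  have A: "spread n (\<lambda>x. g (h x)) t (flag_proj l 1) = g a * c 0 + (g b' - g a) * c 1 + (g I - g b') * c 2"
    unfolding comp[OF tu(1)] ab c_def ..
  have B: "spread n (\<lambda>x. g (h x)) u (flag_proj l 2) = g a' * d 0 + (g b - g a') * d 1 + (g I - g b) * d 2"
    unfolding comp[OF tu(2)] ab d_def ..
  note slices = ring_commutator_slices[OF A B cm glat com]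
  have adjs: "adj a = a" "adj b = b" unfolding ab using tu h.m0 by (simp_all add: h.spread_adj)
  \<comment> \<open>For self-adjoint elements the vanishing of either difference would mean that
    \<open>a\<close> and \<open>b\<close> commute: compare it with its adjoint.\<close>
  have T: "b * a - a * b * a \<noteq> 0" "a * b - b * a * b \<noteq> 0"
  proof -
    have "x * y = y * x" if "adj x = x" "adj y = y" "y * x - x * y * x = 0" for x y
    proof -
      have 1: "y * x = x * y * x" using that by simp
      have "x * y = x * y * x" using arg_cong[OF 1, of adj] unfolding adj_mult that(1,2) mult.assoc .
      from this 1[symmetric] show ?thesis by (rule trans)
    qed
    from this[of a b] this[of b a] show "b * a - a * b * a \<noteq> 0" "a * b - b * a * b \<noteq> 0"
      using nc adjs unfolding ab[symmetric] by auto
  qed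
  have J: "g (idm (3*m)) * c i = c i" "g (idm (3*m)) * d i = d i" if "i < 3" for i
    unfolding c_def d_def using im[OF that] by (simp_all add: g.idm_spread)
  have s1: "c 1 * (d 1 - d 2) - (d 1 - d 2) * c 0 = 0"
  proof (rule g.slice[OF _ T(1)])
    show "b * a - a * b * a \<in> M3 m" using abM by auto
    show "g (idm (3*m)) * (c 1 * (d 1 - d 2) - (d 1 - d 2) * c 0) = c 1 * (d 1 - d 2) - (d 1 - d 2) * c 0"
      using J by (simp add: right_diff_distrib left_diff_distrib flip: mult.assoc)
    show "g (b * a - a * b * a) * (c 1 * (d 1 - d 2) - (d 1 - d 2) * c 0) = 0"
      using slices(1) abM by (simp add: g.h_diff g.h_mult mx_mult[of _ "3*m" "3*m"])
    show "g y * (c 1 * (d 1 - d 2) - (d 1 - d 2) * c 0) = (c 1 * (d 1 - d 2) - (d 1 - d 2) * c 0) * g y" if "y \<in> M3 m" for y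
    proof -
      have k: "z * (g y * w) = g y * (z * w)" if "z * g y = g y * z" for z w
        unfolding mult.assoc[symmetric] that ..
      show ?thesis using cdc[OF that] by (simp add: right_diff_distrib left_diff_distrib mult.assoc k)
    qed
  qed
  have s2: "(c 0 - c 1) * d 1 - d 2 * (c 0 - c 1) = 0"
  proof (rule g.slice[OF _ T(2)])
    show "a * b - b * a * b \<in> M3 m" using abM by auto
    show "g (idm (3*m)) * ((c 0 - c 1) * d 1 - d 2 * (c 0 - c 1)) = (c 0 - c 1) * d 1 - d 2 * (c 0 - c 1)"
      using J by (simp add: right_diff_distrib left_diff_distrib flip: mult.assoc)
    show "g (a * b - b * a * b) * ((c 0 - c 1) * d 1 - d 2 * (c 0 - c 1)) = 0"
      using slices(2) abM by (simp add: g.h_diff g.h_mult mx_mult[of _ "3*m" "3*m"])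
    show "g y * ((c 0 - c 1) * d 1 - d 2 * (c 0 - c 1)) = ((c 0 - c 1) * d 1 - d 2 * (c 0 - c 1)) * g y" if "y \<in> M3 m" for y
    proof -
      have k: "z * (g y * w) = g y * (z * w)" if "z * g y = g y * z" for z w
        unfolding mult.assoc[symmetric] that ..
      show ?thesis using cdc[OF that] by (simp add: right_diff_distrib left_diff_distrib mult.assoc k)
    qed
  qed
  have cdadj: "adj (c i) = c i" "adj (d i) = d i" if "i < 3" for i
    unfolding c_def d_def using im[OF that] g.m0 by (simp_all add: g.spread_adj)
  have cd: "c i * d i = c i" "d i * d i = d i" if "i < 3" for i
    unfolding c_def d_def using im[OF that] by (simp_all add: g.spread_flag_lattice)
  have "d 2 * d 1 = d 2"
    unfolding d_def by (rule g.spread_flag_le') (use im h.m0 in auto)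
  then have comm: "c 0 * d 1 = d 1 * c 0" "c 0 * d 2 = d 2 * c 0" "c 1 * d 2 = d 2 * c 1"
    using lattice_commute[of "c 0" "c 1" "c 2" "d 0" "d 1" "d 2"] s1 s2 cdadj cd by simp_all
  have "commuting m l g"
  proof (rule g.commutingI)
    fix p q assume pq: "p < 3*m" "q < 3*m" "p div m < q div m"
    have e: "spread m g p (flag_proj l 1) = c (p div m)" "spread m g q (flag_proj l 2) = d (q div m)"
      unfolding c_def d_def g.spread_flag using pq im h.m0 
      by (auto intro!: sum.cong g.spread_block simp: div_lt)
    have "p div m < 3" "q div m < 3" using pq h.m0 by (simp_all add: div_lt)
    \<comment> \<open>With three block rows there are three such pairs, and
      \<open>lattice_commute\<close> provides one relation for each.\<close>
    then have "(p div m = 0 \<and> q div m = 1) \<or> (p div m = 0 \<and> q div m = 2) \<or> (p div m = 1 \<and> q div m = 2)"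
      using pq(3) by linarith
    then show "spread m g p (flag_proj l 1) * spread m g q (flag_proj l 2) = spread m g q (flag_proj l 2) * spread m g p (flag_proj l 1)"
      unfolding e using comm by auto
  qed
  then show False using contra by simp
qed

section \<open>Composites of two and three maps\<close>

lemma sum_products_commute:
  fixes P :: "'i \<Rightarrow> 'r::ring"
  assumes "\<And>i j. i \<in> A \<Longrightarrow> j \<in> B \<Longrightarrow> P i * P' j = P' j * P i"
    and "\<And>i j. i \<in> A \<Longrightarrow> j \<in> B \<Longrightarrow> Y i * Y' j = Y' j * Y i"
    and "\<And>i j. i \<in> A \<Longrightarrow> j \<in> B \<Longrightarrow> P i * Y' j = Y' j * P i"
    and "\<And>i j. i \<in> A \<Longrightarrow> j \<in> B \<Longrightarrow> P' j * Y i = Y i * P' j"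
  shows "(\<Sum>i\<in>A. P i * Y i) * (\<Sum>j\<in>B. P' j * Y' j) = (\<Sum>j\<in>B. P' j * Y' j) * (\<Sum>i\<in>A. P i * Y i)"
proof -
  have e: "P i * Y i * (P' j * Y' j) = P' j * Y' j * (P i * Y i)" if "i \<in> A" "j \<in> B" for i j
  proof -
    have "P i * Y i * (P' j * Y' j) = P i * (Y i * P' j) * Y' j" by (simp only: mult.assoc)
    also have "\<dots> = P i * P' j * (Y i * Y' j)" unfolding assms(4)[OF that, symmetric] by (simp only: mult.assoc)
    also have "\<dots> = P' j * (P i * Y' j) * Y i" unfolding assms(1,2)[OF that] by (simp only: mult.assoc)
    also have "\<dots> = P' j * Y' j * (P i * Y i)" unfolding assms(3)[OF that] by (simp only: mult.assoc)
    finally show ?thesis .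
  qed
  have "(\<Sum>i\<in>A. P i * Y i) * (\<Sum>j\<in>B. P' j * Y' j) = (\<Sum>i\<in>A. \<Sum>j\<in>B. P i * Y i * (P' j * Y' j))"
    by (rule sum_product)
  also have "\<dots> = (\<Sum>i\<in>A. \<Sum>j\<in>B. P' j * Y' j * (P i * Y i))" by (intro sum.cong refl e)
  also have "\<dots> = (\<Sum>j\<in>B. \<Sum>i\<in>A. P' j * Y' j * (P i * Y i))" by (rule sum.swap)
  finally show ?thesis by (simp only: sum_product)
qed

lemma sum_swap4:
  "(\<Sum>j\<in>A. \<Sum>j'\<in>B. \<Sum>i\<in>C. \<Sum>i'\<in>D. f i i' j j') = (\<Sum>i\<in>C. \<Sum>i'\<in>D. \<Sum>j\<in>A. \<Sum>j'\<in>B. f i i' j j')"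
proof -
  have "(\<Sum>j\<in>A. \<Sum>j'\<in>B. \<Sum>i\<in>C. \<Sum>i'\<in>D. f i i' j j') = (\<Sum>j\<in>A. \<Sum>i\<in>C. \<Sum>j'\<in>B. \<Sum>i'\<in>D. f i i' j j')"
    by (rule sum.cong[OF refl], rule sum.swap)
  also have "\<dots> = (\<Sum>i\<in>C. \<Sum>j\<in>A. \<Sum>j'\<in>B. \<Sum>i'\<in>D. f i i' j j')"
    by (rule sum.swap)
  also have "\<dots> = (\<Sum>i\<in>C. \<Sum>j\<in>A. \<Sum>i'\<in>D. \<Sum>j'\<in>B. f i i' j j')"
    by (rule sum.cong[OF refl], rule sum.cong[OF refl], rule sum.swap)
  also have "\<dots> = (\<Sum>i\<in>C. \<Sum>i'\<in>D. \<Sum>j\<in>A. \<Sum>j'\<in>B. f i i' j j')"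
    by (rule sum.cong[OF refl], rule sum.swap)
  finally show ?thesis .
qed

text \<open>By \<open>spread_comp\<close> the spreads are sums of products of images of spreads of
  \<open>h\<close> with spreads of the composite of \<open>g\<close> and \<open>k\<close>. Each
  family commutes by assumption, and they commute with each other because one lies in a range and
  the other in its commutant.\<close>

lemma commuting_comp_left:
  assumes h: "tri_hom n m h" and g: "tri_hom m l g" and k: "tri_hom l p k"
    and ch: "commuting n m h" and cgk: "commuting m p (\<lambda>x. k (g x))"
  shows "commuting n p (\<lambda>x. k (g (h x)))"
proof -
  interpret h: tri_hom n m h by fact
  have gk: "tri_hom m p (\<lambda>x. k (g x))" by (rule tri_hom_comp) fact+
  then interpret gk: tri_hom m p "\<lambda>x. k (g x)" .
  have im: "i * m < 3 * m" if "i < 3" for i using that h.m0 by auto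
  have hM: "spread n h t (block_proj m i) \<in> M3 m" if "t < 3*n" "i < 3" for t i
    using that h.m0 by (simp add: h.spread_mx block_proj_mx)
  show ?thesis unfolding commuting_def
  proof (intro allI impI)
    fix t u i j :: nat assume tu: "t < 3*n" "u < 3*n" and ij: "i < 3" "j < 3"
    show "spread n (\<lambda>x. k (g (h x))) t (block_proj p i) * spread n (\<lambda>x. k (g (h x))) u (block_proj p j)
       = spread n (\<lambda>x. k (g (h x))) u (block_proj p j) * spread n (\<lambda>x. k (g (h x))) t (block_proj p i)"
      unfolding spread_comp[OF h gk tu(1)] spread_comp[OF h gk tu(2)]
    proof (rule sum_products_commute)
      fix a b assume "a \<in> {..<3::nat}" "b \<in> {..<3::nat}"
      then have ab: "a < 3" "b < 3" by auto
      show "k (g (spread n h t (block_proj m a))) * k (g (spread n h u (block_proj m b))) = k (g (spread n h u (block_proj m b))) * k (g (spread n h t (block_proj m a)))"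
        using ch tu ab gk.h_mult[OF hM hM, symmetric] by (auto simp: commuting_def)
      show "spread m (\<lambda>x. k (g x)) (a * m) (block_proj p i) * spread m (\<lambda>x. k (g x)) (b * m) (block_proj p j) 
         = spread m (\<lambda>x. k (g x)) (b * m) (block_proj p j) * spread m (\<lambda>x. k (g x)) (a * m) (block_proj p i)"
        using cgk im ab ij by (auto simp: commuting_def)
      show "k (g (spread n h t (block_proj m a))) * spread m (\<lambda>x. k (g x)) (b * m) (block_proj p j) = spread m (\<lambda>x. k (g x)) (b * m) (block_proj p j) * k (g (spread n h t (block_proj m a)))"
        by (rule gk.spread_commute) (use im ab tu hM in auto)
      show "k (g (spread n h u (block_proj m b))) * spread m (\<lambda>x. k (g x)) (a * m) (block_proj p i) = spread m (\<lambda>x. k (g x)) (a * m) (block_proj p i) * k (g (spread n h u (block_proj m b)))"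
        by (rule gk.spread_commute) (use im ab tu hM in auto)
    qed
  qed
qed

lemma tri_hom_id: "n > 0 \<Longrightarrow> tri_hom n n (\<lambda>x. x)"
  by unfold_locales auto

lemma commuting_comp:
  assumes "tri_hom n m h" "tri_hom m l g" "commuting n m h" "commuting m l g"
  shows "commuting n l (\<lambda>x. g (h x))"
proof -
  \<comment> \<open>A composite of two maps is treated as one of three with the identity in the
    middle.\<close>
  have "tri_hom m m (\<lambda>x. x)" using assms(1) by (intro tri_hom_id) (simp add: tri_hom_def)
  from commuting_comp_left[OF assms(1) this assms(2-4)] show ?thesis .
qed

text \<open>The factors \<open>A\<close> coming from \<open>h\<close> need not commute among
  themselves, nor the factors \<open>S\<close> coming from \<open>k\<close>. The factors
  \<open>R\<close> from \<open>g\<close> do. So a product of two spreads can be regrouped until both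
  \<open>S\<close> sit inside a product of two \<open>Y\<close>, where they are exchanged, and
  regrouped again until both \<open>A\<close> sit inside a product of two \<open>X\<close>.\<close>

lemma commuting_comp_middle:
  assumes h: "tri_hom n m h" and g: "tri_hom m l g" and k: "tri_hom l p k"
    and cg: "commuting m l g" and chg: "commuting n l (\<lambda>x. g (h x))" and cgk: "commuting m p (\<lambda>x. k (g x))"
  shows "commuting n p (\<lambda>x. k (g (h x)))"
proof -
  interpret h: tri_hom n m h by fact
  interpret g: tri_hom m l g by fact
  interpret k: tri_hom l p k by fact
  have gk: "tri_hom m p (\<lambda>x. k (g x))" and hg: "tri_hom n l (\<lambda>x. g (h x))" by (rule tri_hom_comp; fact)+
  then interpret gk: tri_hom m p "\<lambda>x. k (g x)" by blast
  have im: "i * m < 3 * m" if "i < 3" for i using that h.m0 by auto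
  have il: "i * l < 3 * l" if "i < 3" for i using that k.n0 by auto
  have hM: "spread n h t (block_proj m i) \<in> M3 m" if "t < 3*n" "i < 3" for t i
    using that h.m0 by (simp add: h.spread_mx block_proj_mx)
  have gM: "spread m g t (block_proj l i) \<in> M3 l" if "t < 3*m" "i < 3" for t i
    using that k.n0 by (simp add: g.spread_mx block_proj_mx)
  have hgM: "spread n (\<lambda>x. g (h x)) t (block_proj l i) \<in> M3 l" if "t < 3*n" "i < 3" for t i
    using that k.n0 tri_hom.spread_mx[OF hg] by (simp add: block_proj_mx)
  \<comment> \<open>\<open>X\<close> and \<open>Y\<close> belong to the two composites of adjacent
    maps, \<open>X\<close> being pushed forward by \<open>k\<close>; \<open>A\<close>,
    \<open>R\<close> and \<open>S\<close> are the factors into which \<open>spread_comp\<close>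
    splits them.\<close>
  define A where "A t i = k (g (spread n h t (block_proj m i)))" for t i
  define R where "R i j = k (spread m g (i * m) (block_proj l j))" for i j
  define S where "S j r = spread l k (j * l) (block_proj p r)" for j r
  define X where "X t j = k (spread n (\<lambda>x. g (h x)) t (block_proj l j))" for t j
  define Y where "Y i r = spread m (\<lambda>x. k (g x)) (i * m) (block_proj p r)" for i r
  have AR: "A t i * R i' j = R i' j * A t i" if "t < 3*n" "i < 3" "i' < 3" "j < 3" for t i i' j
    unfolding A_def R_def using that g.spread_commute[of "i' * m" "spread n h t (block_proj m i)"] im hM gM g.h_mx
    by (simp add: k.h_mult[symmetric])
  have kS: "k x * S j r = S j r * k x" if "x \<in> M3 l" "j < 3" for x j r
    unfolding S_def by (rule k.spread_commute) (use that il in auto)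
  have RS: "R i j * S j' r = S j' r * R i j" if "i < 3" "j < 3" "j' < 3" for i j j' r
    unfolding R_def by (rule kS) (use that gM im in auto)
  have RR: "R i j * R i' j' = R i' j' * R i j" if "i < 3" "j < 3" "i' < 3" "j' < 3" for i j i' j'
    unfolding R_def using cg that im gM by (simp add: k.h_mult[symmetric] commuting_def)
  have XX: "X t j * X u j' = X u j' * X t j" if "t < 3*n" "u < 3*n" "j < 3" "j' < 3" for t u j j'
    unfolding X_def using chg that hgM by (simp add: k.h_mult[symmetric] commuting_def)
  have YY: "Y i r * Y i' q = Y i' q * Y i r" if "i < 3" "i' < 3" "r < 3" "q < 3" for i i' r q
    unfolding Y_def using cgk that im by (simp add: commuting_def)
  have Xe: "X t j = (\<Sum>i<3. A t i * R i j)" if "t < 3*n" "j < 3" for t j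
  proof -
    have "X t j = k (\<Sum>i<3. g (spread n h t (block_proj m i)) * spread m g (i * m) (block_proj l j))"
      unfolding X_def spread_comp[OF h g that(1)] ..
    also have "\<dots> = (\<Sum>i<3. k (g (spread n h t (block_proj m i)) * spread m g (i * m) (block_proj l j)))"
      by (rule k.h_sum) (auto intro!: mx_mult[of _ "3*l" "3*l"] g.h_mx hM gM im that)
    also have "\<dots> = (\<Sum>i<3. A t i * R i j)"
      unfolding A_def R_def by (rule sum.cong) (auto intro!: k.h_mult g.h_mx hM gM im that)
    finally show ?thesis .
  qed
  have Ye: "Y i r = (\<Sum>j<3. R i j * S j r)" if "i < 3" for i r
    unfolding Y_def R_def S_def by (rule spread_comp[OF g k im[OF that]])
  have Z: "spread n (\<lambda>x. k (g (h x))) t (block_proj p r) = (\<Sum>j<3. X t j * S j r)" if "t < 3*n" for t r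
    unfolding X_def S_def by (rule spread_comp[OF hg k that])
  have XS: "X t j * S j' r = S j' r * X t j" if "t < 3*n" "j < 3" "j' < 3" for t j j' r
    unfolding X_def by (rule kS) (use that hgM in auto)
  \<comment> \<open>The weight \<open>W\<close> stays arbitrary because the identity is used twice,
    before and after the exchange of the \<open>S\<close> factors.\<close>
  have expand: "(\<Sum>j<3. \<Sum>j'<3. X t j * X u j' * W j j')
      = (\<Sum>i<3. \<Sum>i'<3. A t i * A u i' * (\<Sum>j<3. \<Sum>j'<3. R i j * R i' j' * W j j'))" 
    if tu: "t < 3*n" "u < 3*n" for t u W
  proof -
    have "(\<Sum>j<3. \<Sum>j'<3. X t j * X u j' * W j j') = (\<Sum>j<3. \<Sum>j'<3. \<Sum>i<3. \<Sum>i'<3. A t i * A u i' * (R i j * R i' j' * W j j'))"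
    proof (intro sum.cong refl)
      fix j j' assume "j \<in> {..<3::nat}" "j' \<in> {..<3::nat}"
      then have j: "j < 3" "j' < 3" by auto
      have "X t j * X u j' * W j j' = (\<Sum>i<3. \<Sum>i'<3. A t i * R i j * (A u i' * R i' j') * W j j')"
        unfolding Xe[OF tu(1) j(1)] Xe[OF tu(2) j(2)] sum_product unfolding sum_distrib_right ..
      also have "\<dots> = (\<Sum>i<3. \<Sum>i'<3. A t i * A u i' * (R i j * R i' j' * W j j'))"
      proof (intro sum.cong refl)
        fix i i' assume i: "i \<in> {..<3::nat}" "i' \<in> {..<3::nat}"
        have "A t i * R i j * (A u i' * R i' j') * W j j' = A t i * (R i j * A u i') * R i' j' * W j j'" by (simp only: mult.assoc)
        also have "R i j * A u i' = A u i' * R i j" using AR[of u i' i j] i j tu by simp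
        finally show "A t i * R i j * (A u i' * R i' j') * W j j' = A t i * A u i' * (R i j * R i' j' * W j j')" by (simp only: mult.assoc)
      qed
      finally show "X t j * X u j' * W j j' = (\<Sum>i<3. \<Sum>i'<3. A t i * A u i' * (R i j * R i' j' * W j j'))" .
    qed
    also have "\<dots> = (\<Sum>i<3. \<Sum>i'<3. \<Sum>j<3. \<Sum>j'<3. A t i * A u i' * (R i j * R i' j' * W j j'))"
      by (rule sum_swap4)
    finally show ?thesis by (simp add: sum_distrib_left)
  qed
  show ?thesis unfolding commuting_def
  proof (intro allI impI)
    fix t u r q :: nat assume tu: "t < 3*n" "u < 3*n" and rq: "r < 3" "q < 3"
    have "(\<Sum>j<3. X t j * S j r) * (\<Sum>j'<3. X u j' * S j' q) = (\<Sum>j<3. \<Sum>j'<3. X t j * X u j' * (S j r * S j' q))"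
      unfolding sum_product
    proof (intro sum.cong refl)
      fix j j' assume j: "j \<in> {..<3::nat}" "j' \<in> {..<3::nat}"
      have "X t j * S j r * (X u j' * S j' q) = X t j * (S j r * X u j') * S j' q" by (simp only: mult.assoc)
      also have "S j r * X u j' = X u j' * S j r" using XS[of u j' j r] j tu by simp
      finally show "X t j * S j r * (X u j' * S j' q) = X t j * X u j' * (S j r * S j' q)" by (simp only: mult.assoc)
    qed
    also have "\<dots> = (\<Sum>i<3. \<Sum>i'<3. A t i * A u i' * (\<Sum>j<3. \<Sum>j'<3. R i j * R i' j' * (S j r * S j' q)))"
      by (rule expand[OF tu])
    also have "\<dots> = (\<Sum>i<3. \<Sum>i'<3. A t i * A u i' * (\<Sum>j<3. \<Sum>j'<3. R i j * R i' j' * (S j' q * S j r)))"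
    proof (intro sum.cong refl)
      fix i i' assume "i \<in> {..<3::nat}" "i' \<in> {..<3::nat}"
      then have i: "i < 3" "i' < 3" by auto
      have "(\<Sum>j<3. \<Sum>j'<3. R i j * R i' j' * (S j r * S j' q)) = (\<Sum>j<3. \<Sum>j'<3. R i j * S j r * (R i' j' * S j' q))"
      proof (intro sum.cong refl)
        fix j j' assume j: "j \<in> {..<3::nat}" "j' \<in> {..<3::nat}"
        have "R i j * S j r * (R i' j' * S j' q) = R i j * (S j r * R i' j') * S j' q" by (simp only: mult.assoc)
        also have "S j r * R i' j' = R i' j' * S j r" using RS[of i' j' j r] j i by simp
        finally show "R i j * R i' j' * (S j r * S j' q) = R i j * S j r * (R i' j' * S j' q)" by (simp only: mult.assoc)
      qed
      also have "\<dots> = Y i r * Y i' q" using i by (simp add: Ye sum_product)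
      also have "\<dots> = Y i' q * Y i r" using YY i rq by simp
      also have "\<dots> = (\<Sum>j'<3. \<Sum>j<3. R i' j' * S j' q * (R i j * S j r))" using i by (simp add: Ye sum_product)
      also have "\<dots> = (\<Sum>j<3. \<Sum>j'<3. R i' j' * S j' q * (R i j * S j r))" by (rule sum.swap)
      also have "\<dots> = (\<Sum>j<3. \<Sum>j'<3. R i j * R i' j' * (S j' q * S j r))"
      proof (intro sum.cong refl)
        fix j j' assume j: "j \<in> {..<3::nat}" "j' \<in> {..<3::nat}"
        have "R i' j' * S j' q * (R i j * S j r) = R i' j' * (S j' q * R i j) * S j r" by (simp only: mult.assoc)
        also have "S j' q * R i j = R i j * S j' q" using RS[of i j j' q] j i by simp
        also have "R i' j' * (R i j * S j' q) * S j r = (R i' j' * R i j) * (S j' q * S j r)" by (simp only: mult.assoc)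
        also have "R i' j' * R i j = R i j * R i' j'" using RR i j by simp
        finally show "R i' j' * S j' q * (R i j * S j r) = R i j * R i' j' * (S j' q * S j r)" .
      qed
      finally show "A t i * A u i' * (\<Sum>j<3. \<Sum>j'<3. R i j * R i' j' * (S j r * S j' q))
          = A t i * A u i' * (\<Sum>j<3. \<Sum>j'<3. R i j * R i' j' * (S j' q * S j r))" by (rule arg_cong)
    qed
    also have "\<dots> = (\<Sum>j<3. \<Sum>j'<3. X t j * X u j' * (S j' q * S j r))"
      by (rule expand[OF tu, symmetric])
    also have "\<dots> = (\<Sum>j<3. \<Sum>j'<3. X u j' * S j' q * (X t j * S j r))"
    proof (intro sum.cong refl)
      fix j j' assume j: "j \<in> {..<3::nat}" "j' \<in> {..<3::nat}"
      have "X u j' * S j' q * (X t j * S j r) = X u j' * (S j' q * X t j) * S j r" by (simp only: mult.assoc)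
      also have "S j' q * X t j = X t j * S j' q" using XS[of t j j' q] j tu by simp
      also have "X u j' * (X t j * S j' q) * S j r = X u j' * X t j * (S j' q * S j r)" by (simp only: mult.assoc)
      also have "X u j' * X t j = X t j * X u j'" using XX tu j by simp
      finally show "X t j * X u j' * (S j' q * S j r) = X u j' * S j' q * (X t j * S j r)" ..
    qed
    also have "\<dots> = (\<Sum>j'<3. X u j' * S j' q) * (\<Sum>j<3. X t j * S j r)"
      unfolding sum_product by (rule sum.swap)
    finally show "spread n (\<lambda>x. k (g (h x))) t (block_proj p r) * spread n (\<lambda>x. k (g (h x))) u (block_proj p q)
       = spread n (\<lambda>x. k (g (h x))) u (block_proj p q) * spread n (\<lambda>x. k (g (h x))) t (block_proj p r)"
      unfolding Z[OF tu(1)] Z[OF tu(2)] .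
  qed
qed

theorem commuting_triple:
  assumes "tri_hom n m h" "tri_hom m l g" "tri_hom l p k"
    and "commuting n l (\<lambda>x. g (h x))" "commuting m p (\<lambda>x. k (g x))"
  shows "commuting n p (\<lambda>x. k (g (h x)))"
  using commuting_dichotomy[OF assms(1,2,4)] commuting_comp_left[OF assms(1-3) _ assms(5)] commuting_comp_middle[OF assms(1-3) _ assms(4,5)]
  by blast

section \<open>Orthogonal sums and maps of multiplicity one\<close>

lemma orthogonal_homs_spread:
  assumes h: "tri_hom n m h" and g: "tri_hom n m g"
    and orth: "\<And>x y. x \<in> M3 n \<Longrightarrow> y \<in> M3 n \<Longrightarrow> h x * g y = 0"
    and t: "t < 3 * n"
  shows "s < 3 * n \<Longrightarrow> u < 3 * n \<Longrightarrow> v < 3 * n \<Longrightarrow> h (E s t) * block_proj m i * g (E u v) = 0"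
    and "u < 3 * n \<Longrightarrow> spread n h t (block_proj m i) * spread n g u q = 0"
    and "spread n h t (block_proj m i) * g (idm (3 * n)) = 0"
proof -
  interpret h: tri_hom n m h by fact
  interpret g: tri_hom n m g by fact
  show 1: "h (E s t) * block_proj m i * g (E u v) = 0" if "s < 3 * n" "u < 3 * n" "v < 3 * n" for s u v
  proof -
    have "h (E s t) * block_proj m i * g (E u v) = h (E s t) * (h (E t t) * block_proj m i) * g (E u v)"
      using h.V_mult[of s t t t] t that by (simp flip: mult.assoc)
    also have "\<dots> = h (E s t) * block_proj m i * (h (E t t) * g (E u v))"
      using h.V_diag[of t t i] t by (simp add: mult.assoc)
    finally show ?thesis using orth[of "E t t" "E u v"] h.EM t that by simp
  qed
  show "spread n h t (block_proj m i) * spread n g u q = 0" if "u < 3 * n" for u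
    unfolding spread_def sum_product
  proof (intro sum.neutral ballI)
    fix s v assume sv: "s \<in> {..<3*n}" "v \<in> {..<3*n}"
    have "h (E t s) * g (E v u) = 0" using orth sv that t by auto
    then have "h (E s t) * block_proj m i * (h (E t s) * g (E v u)) * q * g (E u v) = 0" by simp
    then show "h (E s t) * block_proj m i * h (E t s) * (g (E v u) * q * g (E u v)) = 0" by (simp only: mult.assoc)
  qed
  have "spread n h t (block_proj m i) * h (idm (3*n)) * g (idm (3 * n)) = 0"
    using orth[of "idm (3*n)" "idm (3*n)"] by (simp add: mult.assoc idm_mx)
  then show "spread n h t (block_proj m i) * g (idm (3 * n)) = 0" by (simp add: h.spread_idm t)
qed

text \<open>Orthogonality lets spreads and their products add up without mixed terms. Conversely,
  multiplication by the image of the unit under one summand recovers the product for that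
  summand.\<close>

lemma commuting_sum:
  assumes J: "finite J" and h: "\<And>j. j \<in> J \<Longrightarrow> tri_hom n m (h j)"
    and orth: "\<And>i j x y. i \<in> J \<Longrightarrow> j \<in> J \<Longrightarrow> i \<noteq> j \<Longrightarrow> x \<in> M3 n \<Longrightarrow> y \<in> M3 n \<Longrightarrow> h i x * h j y = 0"
    and g: "\<And>x. x \<in> M3 n \<Longrightarrow> g x = (\<Sum>j\<in>J. h j x)"
  shows "commuting n m g \<longleftrightarrow> (\<forall>j\<in>J. commuting n m (h j))"
proof -
  have spread: "spread n g t (block_proj m i) = (\<Sum>j\<in>J. spread n (h j) t (block_proj m i))" if t: "t < 3*n" for t i
  proof -
    have "g (E s t) * block_proj m i * g (E t s) = (\<Sum>j\<in>J. h j (E s t) * block_proj m i * h j (E t s))" if "s < 3*n" for s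
    proof -
      have "g (E s t) * block_proj m i * g (E t s) = (\<Sum>j\<in>J. \<Sum>j'\<in>J. h j (E s t) * block_proj m i * h j' (E t s))"
        unfolding g[OF mx_closed(6)[OF that t]] g[OF mx_closed(6)[OF t that]] sum_distrib_right
        by (simp only: sum_distrib_left)
      also have "\<dots> = (\<Sum>j\<in>J. \<Sum>j'\<in>J. if j = j' then h j (E s t) * block_proj m i * h j (E t s) else 0)"
      proof (intro sum.cong refl)
        fix j j' assume "j \<in> J" "j' \<in> J"
        then show "h j (E s t) * block_proj m i * h j' (E t s) = (if j = j' then h j (E s t) * block_proj m i * h j (E t s) else 0)"
          using orthogonal_homs_spread(1)[of n m "h j" "h j'", OF h h orth t that t that] by auto
      qed
      finally show ?thesis using J by simp
    qed
    then have "spread n g t (block_proj m i) = (\<Sum>s<3*n. \<Sum>j\<in>J. h j (E s t) * block_proj m i * h j (E t s))"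
      by (simp add: spread_def)
    also have "\<dots> = (\<Sum>j\<in>J. spread n (h j) t (block_proj m i))" unfolding spread_def by (rule sum.swap)
    finally show ?thesis .
  qed
  have prod: "spread n g t (block_proj m i) * spread n g u (block_proj m i') = (\<Sum>j\<in>J. spread n (h j) t (block_proj m i) * spread n (h j) u (block_proj m i'))"
    if t: "t < 3*n" "u < 3*n" for t u i i'
  proof -
    have "spread n g t (block_proj m i) * spread n g u (block_proj m i') = (\<Sum>j\<in>J. \<Sum>j'\<in>J. spread n (h j) t (block_proj m i) * spread n (h j') u (block_proj m i'))"
      using t by (simp add: spread sum_product)
    also have "\<dots> = (\<Sum>j\<in>J. \<Sum>j'\<in>J. if j = j' then spread n (h j) t (block_proj m i) * spread n (h j) u (block_proj m i') else 0)"
    proof (intro sum.cong refl)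
      fix j j' assume "j \<in> J" "j' \<in> J"
      then show "spread n (h j) t (block_proj m i) * spread n (h j') u (block_proj m i') = (if j = j' then spread n (h j) t (block_proj m i) * spread n (h j) u (block_proj m i') else 0)"
        using orthogonal_homs_spread(2)[of n m "h j" "h j'", OF h h orth t] by auto
    qed
    finally show ?thesis using J by simp
  qed
  have cut: "spread n g t (block_proj m i) * spread n g u (block_proj m i') * h j (idm (3*n)) = spread n (h j) t (block_proj m i) * spread n (h j) u (block_proj m i')"
    if j: "j \<in> J" and t: "t < 3*n" "u < 3*n" for t u i i' j
  proof -
    have "spread n g t (block_proj m i) * spread n g u (block_proj m i') * h j (idm (3*n))
       = (\<Sum>j'\<in>J. if j' = j then spread n (h j) t (block_proj m i) * spread n (h j) u (block_proj m i') else 0)"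
      unfolding prod[OF t] sum_distrib_right
    proof (rule sum.cong[OF refl])
      fix j' assume j': "j' \<in> J"
      show "spread n (h j') t (block_proj m i) * spread n (h j') u (block_proj m i') * h j (idm (3*n)) = (if j' = j then spread n (h j) t (block_proj m i) * spread n (h j) u (block_proj m i') else 0)"
        using orthogonal_homs_spread(3)[OF h[OF j'] h[OF j] orth[OF j' j] t(2)] tri_hom.spread_idm[OF h[OF j] t(2)]
        by (auto simp: mult.assoc)
    qed
    then show ?thesis using J j by simp
  qed
  show ?thesis
  proof
    assume c: "commuting n m g"
    show "\<forall>j\<in>J. commuting n m (h j)"
      unfolding commuting_def
    proof (intro ballI allI impI)
      fix j and t u i i' :: nat assume "j \<in> J" "t < 3*n" "u < 3*n" "i < 3" "i' < 3"
      then show "spread n (h j) t (block_proj m i) * spread n (h j) u (block_proj m i') = spread n (h j) u (block_proj m i') * spread n (h j) t (block_proj m i)"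
        using c by (simp add: cut[symmetric] commuting_def)
    qed
  next
    assume "\<forall>j\<in>J. commuting n m (h j)"
    then show "commuting n m g" unfolding commuting_def by (auto simp: prod intro!: sum.cong)
  qed
qed

text \<open>By \<open>E_sandwich\<close> the middle of each term is a single diagonal entry, so all
  spreads are multiples of the same element.\<close>

lemma sandwich_commuting:
  assumes "W \<in> mx (3 * m) (3 * n)" "\<And>x. x \<in> M3 n \<Longrightarrow> h x = W * x * adj W"
  shows "commuting n m h"
proof -
  define k where "k t i = entry (adj W * block_proj m i * W) t t" for t i
  have spread: "spread n h t (block_proj m i) = scl (k t i) (W * idm (3 * n) * adj W)" if t: "t < 3 * n" for t i
  proof -
    have "h (E s t) * block_proj m i * h (E t s) = scl (k t i) (W * E s s * adj W)" if s: "s < 3 * n" for s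
    proof -
      have "h (E s t) * block_proj m i * h (E t s) = W * (E s t * (adj W * block_proj m i * W) * E t s) * adj W"
        using assms(2)[OF mx_closed(6)] s t by (simp only: mult.assoc)
      then show ?thesis by (simp only: E_sandwich k_def scl_mult_left scl_mult_right)
    qed
    then have "spread n h t (block_proj m i) = (\<Sum>s<3*n. scl (k t i) (W * E s s * adj W))" by (simp add: spread_def)
    then show ?thesis by (simp add: idm_def sum_distrib_left sum_distrib_right scl_sum)
  qed
  show ?thesis unfolding commuting_def
    by (auto simp: spread scl_mult_left scl_mult_right scl_simps mult.commute)
qed

text \<open>The range of \<open>V 0 0\<close> serves as the multiplicity space. It has a basis of
  common eigenvectors of all spreads, and a basis vector \<open>x\<close> yields the isometry
  \<open>W x\<close> whose column \<open>s\<close> is \<open>V s 0 * x\<close>. Being an eigenvector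
  means that each of these columns lies in a single block of the target, and this makes the summand
  triangular.\<close>

lemma commuting_decompose:
  assumes "tri_hom n m h" "commuting n m h"
  shows "\<exists>Ws. (\<forall>W\<in>set Ws. W \<in> mx (3 * m) (3 * n) \<and> adj W * W = idm (3 * n) \<and> (\<forall>a\<in>tri n. W * a * adj W \<in> tri m)) \<and>
    (\<forall>i<length Ws. \<forall>j<length Ws. i \<noteq> j \<longrightarrow> adj (Ws ! i) * Ws ! j = 0) \<and>
    (\<forall>a\<in>M3 n. h a = (\<Sum>i<length Ws. Ws ! i * a * adj (Ws ! i)))"
proof -
  interpret tri_hom n m h by fact
  define P where "P = V 0 0"
  have P: "proj P" "P \<in> M3 m" using n0 by (auto simp: P_def proj_def V_adj V_mult V_mx)
  define ps where "ps = [spread n h t (block_proj m i). t \<leftarrow> [0..<3*n], i \<leftarrow> [0..<3]]"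
  have ps: "set ps = (\<Union>t<3*n. (\<lambda>i. spread n h t (block_proj m i)) ` {..<3})" by (auto simp: ps_def)
  have p1: "proj p \<and> p \<in> M3 m \<and> p * P = P * p" if pin: "p \<in> set ps" for p
  proof -
    obtain t where "t < 3*n" "p \<in> (\<lambda>i. spread n h t (block_proj m i)) ` {..<3}" using pin unfolding ps by blast
    then obtain i where ti: "p = spread n h t (block_proj m i)" "t < 3*n" "i < 3" by blast
    have "proj p" using ti m0 by (simp add: proj_def spread_adj spread_block_proj_mult)
    moreover have "p \<in> M3 m" using ti m0 by (simp add: spread_mx block_proj_mx)
    moreover have "p * P = P * p" unfolding ti P_def by (rule spread_commute[symmetric]) (use ti n0 in auto)
    ultimately show ?thesis by simp
  qed
  have p2: "p * q = q * p" if "p \<in> set ps" "q \<in> set ps" for p q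
    using that assms(2) unfolding ps commuting_def by auto
  have ex: "\<exists>xs. P = (\<Sum>i<length xs. xs ! i * adj (xs ! i)) \<and>
    (\<forall>x\<in>set xs. x \<in> mx (3*m) 1 \<and> P * x = x \<and> (\<forall>p\<in>set ps. p * x = x \<or> p * x = 0)) \<and>
    (\<forall>i<length xs. \<forall>j<length xs. adj (xs ! i) * xs ! j = (if i = j then E 0 0 else 0))"
    by (rule adapted_basis[OF P p1 p2])
  obtain xs where xs: "P = (\<Sum>i<length xs. xs ! i * adj (xs ! i))"
    "\<forall>x\<in>set xs. x \<in> mx (3*m) 1 \<and> P * x = x \<and> (\<forall>p\<in>set ps. p * x = x \<or> p * x = 0)"
    "\<forall>i<length xs. \<forall>j<length xs. adj (xs ! i) * xs ! j = (if i = j then E 0 0 else 0)"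
    using ex by (elim exE conjE) (rule that)
  define W where "W x = (\<Sum>s<3*n. V s 0 * x * E 0 s)" for x
  have z: "0 < 3 * n" using n0 by simp
  have VV: "V s t * (V u v * y) = (if t = u then V s v * y else 0)" if "s < 3*n" "t < 3*n" "u < 3*n" "v < 3*n" for s t u v y
    using V_mult[OF that] by (simp flip: mult.assoc)
  have EE: "E s t * (E u v * y) = (if t = u then E s v * y else 0)" for s t u v y
    by (simp add: E_mult flip: mult.assoc)
  have aW: "adj (W x) = (\<Sum>s<3*n. E s 0 * adj x * V 0 s)" for x
    unfolding W_def adj_sum by (rule sum.cong) (use z in \<open>auto simp: V_adj mult.assoc\<close>)
  have xE: "x * E 0 0 = x" if "x \<in> set xs" for x
    using mult_idm[of x "3*m" 1] xs(2) that by (simp add: idm_def)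
  have WE: "W x * E u v * adj (W x) = V u 0 * x * adj x * V 0 v" if "u < 3*n" "v < 3*n" "x \<in> set xs" for u v x
  proof -
    have "W x * E u v = (\<Sum>s<3*n. if s = u then V u 0 * x * E 0 v else 0)"
      unfolding W_def sum_distrib_right by (rule sum.cong) (auto simp: mult.assoc E_mult)
    then have 1: "W x * E u v = V u 0 * x * E 0 v" using that by simp
    have "V u 0 * x * E 0 v * adj (W x) = (\<Sum>s<3*n. if s = v then V u 0 * x * E 0 0 * adj x * V 0 v else 0)"
      unfolding aW sum_distrib_left by (rule sum.cong) (auto simp: mult.assoc EE)
    then have "V u 0 * x * E 0 v * adj (W x) = V u 0 * (x * E 0 0) * adj x * V 0 v" using that by (simp add: mult.assoc)
    then show ?thesis using 1 xE that by simp
  qed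
  have Wa: "W x * a * adj (W x) = (\<Sum>u<3*n. \<Sum>v<3*n. scl (entry a u v) (V u 0 * x * adj x * V 0 v))"
    if "a \<in> M3 n" "x \<in> set xs" for a x
  proof -
    have "W x * a * adj (W x) = W x * (\<Sum>u<3*n. \<Sum>v<3*n. scl (entry a u v) (E u v)) * adj (W x)"
      using mx_expand[OF that(1)] by simp
    also have "\<dots> = (\<Sum>u<3*n. \<Sum>v<3*n. scl (entry a u v) (W x * E u v * adj (W x)))"
      by (simp add: sum_distrib_left sum_distrib_right scl_mult_left scl_mult_right)
    also have "\<dots> = (\<Sum>u<3*n. \<Sum>v<3*n. scl (entry a u v) (V u 0 * x * adj x * V 0 v))"
      by (intro sum.cong refl) (use that WE in auto)
    finally show ?thesis .
  qed
  have WW: "adj (W x) * W y = (\<Sum>s<3*n. E s 0 * (adj x * y) * E 0 s)" if "x \<in> set xs" "y \<in> set xs" for x y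
  proof -
    have "adj (W x) * W y = (\<Sum>s<3*n. \<Sum>t<3*n. E s 0 * adj x * V 0 s * (V t 0 * y * E 0 t))"
      unfolding aW by (simp only: W_def sum_product)
    also have "\<dots> = (\<Sum>s<3*n. \<Sum>t<3*n. if s = t then E s 0 * adj x * (P * y) * E 0 t else 0)"
      by (intro sum.cong refl) (use z in \<open>auto simp: mult.assoc VV P_def\<close>)
    also have "\<dots> = (\<Sum>s<3*n. E s 0 * (adj x * y) * E 0 s)"
      using xs(2) that by (simp add: mult.assoc)
    finally show ?thesis .
  qed
  have Wmx: "W x \<in> mx (3*m) (3*n)" if "x \<in> set xs" for x
    unfolding W_def using xs(2) that z
    by (intro mx_sum mx_mult[of _ "3*m" 1] mx_mult[of _ "3*m" "3*m"]) (auto intro: V_mx)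
  have iso: "adj (W x) * W x = idm (3*n)" if x: "x \<in> set xs" for x
  proof -
    obtain i where "x = xs ! i" "i < length xs" using x by (metis in_set_conv_nth)
    then have "adj x * x = E 0 0" using xs(3) by simp
    then show ?thesis using WW[OF x x] by (simp add: E_mult idm_def)
  qed
  have tri: "W x * a * adj (W x) \<in> tri m" if a: "a \<in> tri n" and x: "x \<in> set xs" for a x
  proof (rule tri_I[OF m0])
    have aM: "a \<in> M3 n" using a by (simp add: tri_def)
    show "W x * a * adj (W x) \<in> M3 m"
      using Wmx[OF x] aM by (intro mx_mult[of _ _ "3*n"] mx_closed)
    fix i j :: nat assume ij: "j < i" "i < 3"
    \<comment> \<open>If \<open>block_proj m j\<close> fixes column \<open>v\<close>, then
      triangularity of \<open>V u v\<close> keeps column \<open>u\<close> out of the later block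
      \<open>i\<close>; if it annihilates column \<open>v\<close>, the right factor
      vanishes.\<close>
    have z0: "block_proj m i * (V u 0 * x * adj x * V 0 v) * block_proj m j = 0" if uv: "u < 3*n" "v < 3*n" "u div n \<le> v div n" for u v
    proof -
      have "V v 0 * spread n h v (block_proj m j) = block_proj m j * V v 0"
        using V_spread(1)[of v 0 v "block_proj m j"] V_diag[of v v j] V_mult[of v v v 0] uv z by (simp add: mult.assoc)
      then have e: "block_proj m j * (V v 0 * x) = V v 0 * (spread n h v (block_proj m j) * x)"
        by (simp flip: mult.assoc)
      have "spread n h v (block_proj m j) * x = x \<or> spread n h v (block_proj m j) * x = 0"
        using xs(2) x uv ij unfolding ps by auto
      then consider "block_proj m j * (V v 0 * x) = V v 0 * x" | "block_proj m j * (V v 0 * x) = 0" using e by auto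
      then show ?thesis
      proof cases
        case 1
        have "V u v \<in> tri m" using uv by (intro h_tri E_tri n0)
        then have "block_proj m i * V u v * block_proj m j = 0"
          using m0 ij by (intro fmat_eqI) (auto simp: entry_block_proj_mult tri_def)
        then have "block_proj m i * V u v * block_proj m j * (V v 0 * x) = 0" by simp
        then have "block_proj m i * (V u 0 * x) = 0"
          using VV[of u v v 0 x] uv z by (simp add: mult.assoc 1)
        then have "block_proj m i * (V u 0 * x) * (adj x * V 0 v * block_proj m j) = 0" by simp
        then show ?thesis by (simp only: mult.assoc)
      next
        case 2
        have "adj x * V 0 v * block_proj m j = 0" using arg_cong[OF 2, of adj] uv z m0 by (simp add: V_adj)
        then have "block_proj m i * (V u 0 * x) * (adj x * V 0 v * block_proj m j) = 0" by simp
        then show ?thesis by (simp only: mult.assoc)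
      qed
    qed
    have "block_proj m i * (W x * a * adj (W x)) * block_proj m j
        = (\<Sum>u<3*n. \<Sum>v<3*n. scl (entry a u v) (block_proj m i * (V u 0 * x * adj x * V 0 v) * block_proj m j))"
      unfolding Wa[OF aM x] by (simp add: sum_distrib_left sum_distrib_right scl_mult_left scl_mult_right)
    also have "\<dots> = 0"
    proof (intro sum.neutral ballI)
      fix u v assume "u \<in> {..<3*n}" "v \<in> {..<3*n}"
      then show "scl (entry a u v) (block_proj m i * (V u 0 * x * adj x * V 0 v) * block_proj m j) = 0"
        using z0[of u v] a by (cases "u div n \<le> v div n") (auto simp: scl_simps tri_def)
    qed
    finally show "block_proj m i * (W x * a * adj (W x)) * block_proj m j = 0" .
  qed
  have total: "h a = (\<Sum>i<length xs. W (xs ! i) * a * adj (W (xs ! i)))" if a: "a \<in> M3 n" for a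
  proof -
    have "(\<Sum>i<length xs. W (xs ! i) * a * adj (W (xs ! i)))
      = (\<Sum>i<length xs. \<Sum>u<3*n. \<Sum>v<3*n. scl (entry a u v) (V u 0 * (xs ! i * adj (xs ! i)) * V 0 v))"
      by (intro sum.cong refl) (subst Wa[OF a], auto simp: mult.assoc)
    also have "\<dots> = (\<Sum>u<3*n. \<Sum>i<length xs. \<Sum>v<3*n. scl (entry a u v) (V u 0 * (xs ! i * adj (xs ! i)) * V 0 v))"
      by (rule sum.swap)
    also have "\<dots> = (\<Sum>u<3*n. \<Sum>v<3*n. \<Sum>i<length xs. scl (entry a u v) (V u 0 * (xs ! i * adj (xs ! i)) * V 0 v))"
      by (rule sum.cong[OF refl], rule sum.swap)
    also have "\<dots> = (\<Sum>u<3*n. \<Sum>v<3*n. scl (entry a u v) (V u 0 * P * V 0 v))"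
      unfolding xs(1) by (simp only: sum_distrib_left sum_distrib_right scl_sum)
    also have "\<dots> = (\<Sum>u<3*n. \<Sum>v<3*n. scl (entry a u v) (V u v))"
      by (intro sum.cong refl) (use z in \<open>simp add: P_def V_mult\<close>)
    finally show ?thesis using h_expand[OF a] by simp
  qed
  show ?thesis
  proof (intro exI[of _ "map W xs"] conjI ballI allI impI)
    fix i j assume ij: "i < length (map W xs)" "j < length (map W xs)" "i \<noteq> j"
    then have "adj (xs ! i) * xs ! j = 0" using xs(3) by simp
    then show "adj (map W xs ! i) * map W xs ! j = 0" using WW[of "xs ! i" "xs ! j"] ij by simp
  qed (use Wmx iso tri total in auto)
qed

text \<open>The missing columns are an orthonormal basis of the range of \<open>1 - W W*\<close>.\<close>

lemma isometry_extends_to_unitary: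
  assumes W: "W \<in> mx N K" "adj W * W = idm K"
  shows "K \<le> N \<and> (\<exists>u\<in>mx N N. adj u * u = idm N \<and> u * adj u = idm N \<and> u * idm K = W)"
proof -
  define P where "P = idm N - W * adj W"
  have WW: "W * adj W \<in> mx N N" using W by (intro mx_mult[of _ N K]) auto
  have Wi: "W * idm K = W" by (rule mult_idm) fact
  have idem: "W * adj W * (W * adj W) = W * adj W"
  proof -
    have "W * adj W * (W * adj W) = W * (adj W * W) * adj W" by (simp only: mult.assoc)
    then show ?thesis using W(2) Wi by simp
  qed
  have PM: "P \<in> mx N N" unfolding P_def using WW by auto
  have P: "proj P" unfolding proj_def P_def
    using idem WW idm_mult[OF WW] mult_idm[OF WW] idm_mult[OF idm_mx, of N]
    by (simp add: left_diff_distrib right_diff_distrib)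
  have "\<exists>xs. P = (\<Sum>i<length xs. xs ! i * adj (xs ! i)) \<and>
    (\<forall>x\<in>set xs. x \<in> mx N 1 \<and> P * x = x \<and> (\<forall>p\<in>set []. p * x = x \<or> p * x = 0)) \<and>
    (\<forall>i<length xs. \<forall>j<length xs. adj (xs ! i) * xs ! j = (if i = j then E 0 0 else 0))"
    by (rule adapted_basis[OF P PM]) auto
  then obtain xs where xs: "P = (\<Sum>i<length xs. xs ! i * adj (xs ! i))"
    "\<forall>x\<in>set xs. x \<in> mx N 1 \<and> P * x = x \<and> (\<forall>p\<in>set []. p * x = x \<or> p * x = 0)"
    "\<forall>i<length xs. \<forall>j<length xs. adj (xs ! i) * xs ! j = (if i = j then E 0 0 else 0)"
    by (elim exE conjE) (rule that)
  have x0: "x * E 0 0 = x" if "x \<in> set xs" for x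
    using mult_idm[of x N 1] xs(2) that by (simp add: idm_def)
  define L where "L = length xs"
  have trs: "tr (sum f A) = (\<Sum>i\<in>A. tr (f i))" for f and A :: "nat set"
    by (induction A rule: infinite_finite_induct) (auto simp: tr_add, auto simp: tr_def)
  have "tr P = of_nat N - of_nat K"
    unfolding P_def tr_minus tr_idm tr_commute[of W] W(2) ..
  moreover have "tr P = of_nat L"
  proof -
    have "tr P = tr (\<Sum>i<length xs. xs ! i * adj (xs ! i))" using xs(1) by (rule arg_cong)
    also have "\<dots> = (\<Sum>i<length xs. tr (xs ! i * adj (xs ! i)))" by (rule trs)
    also have "\<dots> = (\<Sum>i<length xs. tr (adj (xs ! i) * xs ! i))" by (intro sum.cong refl tr_commute)
    also have "\<dots> = of_nat L" using xs(3) by (simp add: L_def)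
    finally show ?thesis .
  qed
  \<comment> \<open>The two values of the trace count the missing columns.\<close>
  ultimately have "of_nat (L + K) = (of_nat N :: complex)" by simp
  then have N: "N = K + L" by (simp only: of_nat_eq_iff)
  define X where "X = (\<Sum>i<L. xs ! i * E 0 (K + i))"
  have aX: "adj X = (\<Sum>i<L. E (K + i) 0 * adj (xs ! i))" by (simp add: X_def)
  have X: "X \<in> mx N N" unfolding X_def using xs(2) N
    by (intro mx_sum mx_mult[of _ N 1]) (auto simp: L_def)
  have XX: "X * adj X = P"
  proof -
    have "X * adj X = (\<Sum>i<L. \<Sum>j<L. xs ! i * E 0 (K + i) * (E (K + j) 0 * adj (xs ! j)))"
      unfolding aX by (simp only: X_def sum_product)
    also have "\<dots> = (\<Sum>i<L. \<Sum>j<L. if i = j then xs ! i * E 0 0 * adj (xs ! i) else 0)"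
    proof (intro sum.cong refl)
      fix i j show "xs ! i * E 0 (K + i) * (E (K + j) 0 * adj (xs ! j)) = (if i = j then xs ! i * E 0 0 * adj (xs ! i) else 0)"
        using arg_cong[OF E_mult[of 0 "K+i" "K+j" 0], of "\<lambda>z. xs ! i * z * adj (xs ! j)"] by (auto simp: mult.assoc)
    qed
    also have "\<dots> = (\<Sum>i<L. xs ! i * adj (xs ! i))" using x0 by (simp add: L_def)
    finally show ?thesis using xs(1) by (simp add: L_def)
  qed
  have aPW: "adj W * P = 0" unfolding P_def
  proof -
    have "adj W * (W * adj W) = (adj W * W) * adj W" by (simp only: mult.assoc)
    also have "\<dots> = adj W" using W idm_mult[of "adj W" K N] by auto
    finally show "adj W * (idm N - W * adj W) = 0" using W(1) by (simp add: right_diff_distrib mult_idm[of "adj W" K N] mx_closed)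
  qed
  have WX: "adj W * X = 0"
  proof -
    have "adj W * (xs ! i) = 0" if "i < L" for i
    proof -
      have "adj W * (xs ! i) = adj W * (P * xs ! i)" using xs(2) that by (simp add: L_def)
      then show ?thesis using aPW by (simp flip: mult.assoc)
    qed
    then show ?thesis unfolding X_def sum_distrib_left by (simp flip: mult.assoc)
  qed
  have XW: "adj X * W = 0" using arg_cong[OF WX, of adj] by simp
  have aXX: "adj X * X = (\<Sum>i<L. E (K + i) (K + i))"
  proof -
    have "adj X * X = (\<Sum>i<L. \<Sum>j<L. E (K + i) 0 * adj (xs ! i) * (xs ! j * E 0 (K + j)))"
      unfolding aX by (simp only: X_def sum_product)
    also have "\<dots> = (\<Sum>i<L. \<Sum>j<L. if i = j then E (K + i) (K + i) else 0)"
    proof (intro sum.cong refl)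
      fix i j assume "i \<in> {..<L}" "j \<in> {..<L}"
      then have "adj (xs ! i) * xs ! j = (if i = j then E 0 0 else 0)" using xs(3) by (simp add: L_def)
      then have "E (K + i) 0 * (adj (xs ! i) * xs ! j) * E 0 (K + j) = (if i = j then E (K + i) (K + i) else 0)"
        by (simp add: E_mult)
      then show "E (K + i) 0 * adj (xs ! i) * (xs ! j * E 0 (K + j)) = (if i = j then E (K + i) (K + i) else 0)"
        by (simp only: mult.assoc)
    qed
    finally show ?thesis by simp
  qed
  have XK: "X * idm K = 0"
    by (rule fmat_eqI) (auto simp: X_def entry_diag_mult(2)[of "idm K" "\<lambda>i. i < K"] entry_mult_E)
  have "idm K * adj W = adj W" using W(1) by (intro idm_mult) auto
  then have XaW: "X * adj W = 0"
    using arg_cong[OF XK, of "\<lambda>z. z * adj W"] by (simp add: mult.assoc)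
  have WaX: "W * adj X = 0" using arg_cong[OF XaW, of adj] unfolding adj_mult adj_simps .
  have "idm K + (\<Sum>i<l. E (K + i) (K + i)) = idm (K + l)" for l
    by (induction l) (simp_all add: idm_def add.assoc[symmetric])
  then have "idm K + adj X * X = idm N" unfolding N aXX .
  moreover note XK
  ultimately show ?thesis
    using N W(1) X WX XW Wi mx_mono[OF W(1), of N N]
    by (intro conjI bexI[of _ "W + X"]) (auto simp: distrib_left distrib_right P_def W(2) XX XaW WaX)
qed

section \<open>Finite-dimensional operator algebras and their limits\<close>

definition range_proj :: "'a opalg \<Rightarrow> 'a \<Rightarrow> 'a" where
  "range_proj A e = cmult A e (cadj A e)"

definition corner :: "'a opalg \<Rightarrow> 'a \<Rightarrow> 'a \<Rightarrow> 'a" where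
  "corner A e x = cmult A (cmult A (range_proj A e) x) (cadj A e)"

definition closed_span :: "'a opalg \<Rightarrow> 'a set \<Rightarrow> bool" where
  "closed_span A D \<longleftrightarrow> czero A \<in> D \<and> (\<forall>y\<in>D. \<forall>z\<in>D. cadd A y z \<in> D) \<and> (\<forall>c. \<forall>y\<in>D. cscale A c y \<in> D)"

text \<open>In a finite-dimensional C*-algebra with matrix units \<open>e\<close>, the corner of \<open>x\<close> at \<open>e\<close> is the coefficient of
  \<open>x\<close> at \<open>e\<close> times the range projection of \<open>e\<close>; so the last two conditions say that \<open>alg A\<close> contains the units
  occurring in its elements, and that \<open>x\<close> is a combination of the units occurring in it.\<close>

definition unit_system :: "'a opalg \<Rightarrow> 'a set \<Rightarrow> bool" where
  "unit_system A U \<longleftrightarrow> finite U \<and> U \<subseteq> car A \<and>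
     (\<forall>e\<in>U. cmult A (range_proj A e) (range_proj A e) = range_proj A e \<and> cmult A (range_proj A e) e = e) \<and>
     (\<forall>e\<in>U. \<forall>x\<in>car A. \<exists>c. corner A e x = cscale A c (range_proj A e)) \<and>
     (\<forall>e\<in>U. \<forall>x\<in>alg A. corner A e x \<noteq> czero A \<longrightarrow> e \<in> alg A) \<and>
     (\<forall>x\<in>car A. \<forall>D. closed_span A D \<longrightarrow> (\<forall>e\<in>U. corner A e x \<noteq> czero A \<longrightarrow> e \<in> D) \<longrightarrow> x \<in> D)"

text \<open>The laws are relativised to \<open>car A\<close>, as the operations are arbitrary
  outside it. The condition \<open>alg_generates\<close> lets \<open>Cstar A\<close> be identified
  with \<open>car A\<close>, so the intersection in its definition can be forgotten.\<close>

locale fd_cstar =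
  fixes A :: "'a opalg"
  assumes add_cl: "\<lbrakk>x \<in> car A; y \<in> car A\<rbrakk> \<Longrightarrow> cadd A x y \<in> car A"
    and mult_cl: "\<lbrakk>x \<in> car A; y \<in> car A\<rbrakk> \<Longrightarrow> cmult A x y \<in> car A"
    and scale_cl: "x \<in> car A \<Longrightarrow> cscale A c x \<in> car A"
    and adj_cl: "x \<in> car A \<Longrightarrow> cadj A x \<in> car A"
    and zero_cl: "czero A \<in> car A"
    and add_assoc: "\<lbrakk>x \<in> car A; y \<in> car A; z \<in> car A\<rbrakk> \<Longrightarrow> cadd A (cadd A x y) z = cadd A x (cadd A y z)"
    and add_comm: "\<lbrakk>x \<in> car A; y \<in> car A\<rbrakk> \<Longrightarrow> cadd A x y = cadd A y x"
    and add_zero: "x \<in> car A \<Longrightarrow> cadd A x (czero A) = x"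
    and add_neg: "x \<in> car A \<Longrightarrow> cadd A x (cscale A (-1) x) = czero A"
    and scale_scale: "x \<in> car A \<Longrightarrow> cscale A c (cscale A d x) = cscale A (c * d) x"
    and scale_one: "x \<in> car A \<Longrightarrow> cscale A 1 x = x"
    and scale_0: "x \<in> car A \<Longrightarrow> cscale A 0 x = czero A"
    and scale_add: "\<lbrakk>x \<in> car A; y \<in> car A\<rbrakk> \<Longrightarrow> cscale A c (cadd A x y) = cadd A (cscale A c x) (cscale A c y)"
    and mult_assoc: "\<lbrakk>x \<in> car A; y \<in> car A; z \<in> car A\<rbrakk> \<Longrightarrow> cmult A (cmult A x y) z = cmult A x (cmult A y z)"
    and distr: "\<lbrakk>x \<in> car A; y \<in> car A; z \<in> car A\<rbrakk> \<Longrightarrow> cmult A (cadd A x y) z = cadd A (cmult A x z) (cmult A y z)"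
    and distl: "\<lbrakk>x \<in> car A; y \<in> car A; z \<in> car A\<rbrakk> \<Longrightarrow> cmult A z (cadd A x y) = cadd A (cmult A z x) (cmult A z y)"
    and scale_mult: "\<lbrakk>x \<in> car A; y \<in> car A\<rbrakk> \<Longrightarrow> cmult A (cscale A c x) y = cscale A c (cmult A x y)"
    and mult_scale: "\<lbrakk>x \<in> car A; y \<in> car A\<rbrakk> \<Longrightarrow> cmult A x (cscale A c y) = cscale A c (cmult A x y)"
    and adj_add: "\<lbrakk>x \<in> car A; y \<in> car A\<rbrakk> \<Longrightarrow> cadj A (cadd A x y) = cadd A (cadj A x) (cadj A y)"
    and adj_mult: "\<lbrakk>x \<in> car A; y \<in> car A\<rbrakk> \<Longrightarrow> cadj A (cmult A x y) = cmult A (cadj A y) (cadj A x)"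
    and adj_scale: "x \<in> car A \<Longrightarrow> cadj A (cscale A c x) = cscale A (cnj c) (cadj A x)"
    and adj_adj: "x \<in> car A \<Longrightarrow> cadj A (cadj A x) = x"
    and norm_nonneg: "x \<in> car A \<Longrightarrow> cnorm A x \<ge> 0"
    and norm_zeroD: "\<lbrakk>x \<in> car A; cnorm A x = 0\<rbrakk> \<Longrightarrow> x = czero A"
    and norm_add: "\<lbrakk>x \<in> car A; y \<in> car A\<rbrakk> \<Longrightarrow> cnorm A (cadd A x y) \<le> cnorm A x + cnorm A y"
    and norm_scale: "x \<in> car A \<Longrightarrow> cnorm A (cscale A c x) = cmod c * cnorm A x"
    and norm_mult: "\<lbrakk>x \<in> car A; y \<in> car A\<rbrakk> \<Longrightarrow> cnorm A (cmult A x y) \<le> cnorm A x * cnorm A y"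
    and norm_adj: "x \<in> car A \<Longrightarrow> cnorm A (cadj A x) = cnorm A x"
    and norm_cstar: "x \<in> car A \<Longrightarrow> (cnorm A x)\<^sup>2 \<le> cnorm A (cmult A (cadj A x) x)"
    and alg_car: "alg A \<subseteq> car A"
    and alg_zero: "czero A \<in> alg A"
    and alg_add: "\<lbrakk>x \<in> alg A; y \<in> alg A\<rbrakk> \<Longrightarrow> cadd A x y \<in> alg A"
    and alg_scale: "x \<in> alg A \<Longrightarrow> cscale A c x \<in> alg A"
    and alg_generates: "x \<in> car A \<Longrightarrow> \<exists>a\<in>alg A. \<exists>b\<in>alg A. x = cadd A a (cadj A b)"
    and units: "\<exists>U. unit_system A U"
begin

definition "mat_units = (SOME U. unit_system A U)"

lemma mat_units_system: "unit_system A mat_units"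
  unfolding mat_units_def using units by (rule someI_ex)

abbreviation "unit_range e \<equiv> range_proj A e"
abbreviation "unit_corner e x \<equiv> corner A e x"

lemma mat_units: "finite mat_units" "mat_units \<subseteq> car A"
  "e \<in> mat_units \<Longrightarrow> cmult A (unit_range e) (unit_range e) = unit_range e"
  "e \<in> mat_units \<Longrightarrow> cmult A (unit_range e) e = e"
  "e \<in> mat_units \<Longrightarrow> x \<in> car A \<Longrightarrow> \<exists>c. unit_corner e x = cscale A c (unit_range e)"
  "e \<in> mat_units \<Longrightarrow> x \<in> alg A \<Longrightarrow> unit_corner e x \<noteq> czero A \<Longrightarrow> e \<in> alg A"
  using mat_units_system unfolding unit_system_def by (elim conjE; blast)+

lemma unit_span:
  assumes "x \<in> car A" "czero A \<in> D" "\<And>y z. y \<in> D \<Longrightarrow> z \<in> D \<Longrightarrow> cadd A y z \<in> D"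
    "\<And>c y. y \<in> D \<Longrightarrow> cscale A c y \<in> D" "\<And>e. e \<in> mat_units \<Longrightarrow> unit_corner e x \<noteq> czero A \<Longrightarrow> e \<in> D"
  shows "x \<in> D"
proof -
  have "closed_span A D" using assms(2-4) by (simp add: closed_span_def)
  moreover have "\<forall>x\<in>car A. \<forall>D. closed_span A D \<longrightarrow> (\<forall>e\<in>mat_units. unit_corner e x \<noteq> czero A \<longrightarrow> e \<in> D) \<longrightarrow> x \<in> D"
    using mat_units_system unfolding unit_system_def by (elim conjE)
  ultimately show ?thesis using assms(1,5) by simp
qed

lemma unit_car: "e \<in> mat_units \<Longrightarrow> e \<in> car A" using mat_units by auto
lemma unit_range_car: "e \<in> mat_units \<Longrightarrow> unit_range e \<in> car A" by (simp add: range_proj_def unit_car mult_cl adj_cl)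
lemma unit_range_adj: "e \<in> mat_units \<Longrightarrow> cadj A (unit_range e) = unit_range e"
  by (simp add: range_proj_def unit_car adj_mult adj_adj adj_cl)

lemma scale_zero: "cscale A c (czero A) = czero A"
  using scale_scale[OF zero_cl, of c 0] scale_0[OF zero_cl] by simp

lemma norm_zero: "cnorm A (czero A) = 0"
  using norm_scale[OF zero_cl, of 0] scale_0[OF zero_cl] by simp

lemma zero_mult: "x \<in> car A \<Longrightarrow> cmult A (czero A) x = czero A"
  using scale_mult[OF zero_cl, of x 0] mult_cl[OF zero_cl, of x] by (simp add: scale_0 zero_cl)

lemma mult_zero: "x \<in> car A \<Longrightarrow> cmult A x (czero A) = czero A"
  using mult_scale[OF _ zero_cl, of x 0] mult_cl[OF _ zero_cl, of x] by (simp add: scale_0 zero_cl)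

lemma adj_zero: "cadj A (czero A) = czero A"
  using adj_scale[OF zero_cl, of 0] by (simp add: scale_0 zero_cl adj_cl)

lemma add_zero_left: "x \<in> car A \<Longrightarrow> cadd A (czero A) x = x"
  using add_zero add_comm zero_cl by metis

lemma add4: 
  assumes "a \<in> car A" "b \<in> car A" "c \<in> car A" "d \<in> car A"
  shows "cadd A (cadd A a b) (cadd A c d) = cadd A (cadd A a c) (cadd A b d)"
proof -
  have "cadd A b (cadd A c d) = cadd A c (cadd A b d)"
    using assms by (simp add: add_assoc[symmetric] add_comm[of b c])
  then show ?thesis using assms by (simp add: add_assoc add_cl)
qed

lemma eq_of_dist: assumes "x \<in> car A" "y \<in> car A" "cdist A x y = 0" shows "x = y"
proof -
  have "cadd A x (cscale A (-1) y) = czero A"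
    using assms by (intro norm_zeroD) (auto simp: cdist_def add_cl scale_cl)
  then have "cadd A (cadd A x (cscale A (-1) y)) y = y" using assms add_zero_left by simp
  moreover have "cadd A (cadd A x (cscale A (-1) y)) y = cadd A x (cadd A y (cscale A (-1) y))"
    using assms by (simp add: add_assoc scale_cl add_comm[of y])
  ultimately show ?thesis using assms by (simp add: add_neg add_zero)
qed

lemma dist_refl: "x \<in> car A \<Longrightarrow> cdist A x x = 0"
  by (simp add: cdist_def add_neg norm_zero)

lemma dist_nonneg: "x \<in> car A \<Longrightarrow> y \<in> car A \<Longrightarrow> cdist A x y \<ge> 0"
  by (simp add: cdist_def norm_nonneg add_cl scale_cl)

lemma dist_scale: assumes "x \<in> car A" "y \<in> car A" shows "cdist A (cscale A c x) (cscale A c y) = cmod c * cdist A x y"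
proof -
  have "cadd A (cscale A c x) (cscale A (-1) (cscale A c y)) = cscale A c (cadd A x (cscale A (-1) y))"
    using assms by (simp add: scale_add scale_scale scale_cl mult.commute)
  then show ?thesis using assms by (simp add: cdist_def norm_scale add_cl scale_cl)
qed

lemma dist_sym: assumes "x \<in> car A" "y \<in> car A" shows "cdist A x y = cdist A y x"
proof -
  have "cscale A (-1) (cadd A y (cscale A (-1) x)) = cadd A x (cscale A (-1) y)"
    using assms by (simp add: scale_add scale_scale scale_one scale_cl add_comm)
  then have "cdist A x y = cnorm A (cscale A (-1) (cadd A y (cscale A (-1) x)))"
    by (simp add: cdist_def)
  then show ?thesis using assms by (simp add: norm_scale cdist_def add_cl scale_cl)
qed

lemma dist_add: assumes "x \<in> car A" "y \<in> car A" "x' \<in> car A" "y' \<in> car A" 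
  shows "cdist A (cadd A x y) (cadd A x' y') \<le> cdist A x x' + cdist A y y'"
proof -
  have "cadd A (cadd A x y) (cscale A (-1) (cadd A x' y')) = cadd A (cadd A x (cscale A (-1) x')) (cadd A y (cscale A (-1) y'))"
    using assms by (simp add: scale_add add4 scale_cl)
  then show ?thesis using assms by (simp add: cdist_def norm_add add_cl scale_cl)
qed

lemma dist_tri: assumes "x \<in> car A" "y \<in> car A" "z \<in> car A"
  shows "cdist A x z \<le> cdist A x y + cdist A y z"
proof -
  have "cadd A (cadd A x (cscale A (-1) y)) (cadd A y (cscale A (-1) z)) = cadd A (cadd A x (cscale A (-1) z)) (cadd A (cscale A (-1) y) y)"
    using assms by (subst (1) add_comm[of y]) (simp_all add: add4 scale_cl)
  also have "\<dots> = cadd A x (cscale A (-1) z)"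
    using assms add_comm[of y "cscale A (-1) y", symmetric] by (simp add: add_neg scale_cl add_zero add_cl)
  finally show ?thesis using assms norm_add[of "cadd A x (cscale A (-1) y)" "cadd A y (cscale A (-1) z)"]
    by (simp add: cdist_def add_cl scale_cl)
qed

lemma dist_adj: assumes "x \<in> car A" "y \<in> car A" shows "cdist A (cadj A x) (cadj A y) = cdist A x y"
proof -
  have "cadd A (cadj A x) (cscale A (-1) (cadj A y)) = cadj A (cadd A x (cscale A (-1) y))"
    using assms by (simp add: adj_add adj_scale scale_cl)
  then show ?thesis using assms by (simp add: cdist_def norm_adj add_cl scale_cl)
qed

lemma dist_mult: assumes "x \<in> car A" "y \<in> car A" "x' \<in> car A" "y' \<in> car A" 
  shows "cdist A (cmult A x y) (cmult A x' y') \<le> cnorm A x * cdist A y y' + cdist A x x' * cnorm A y'"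
proof -
  have "cdist A (cmult A x y) (cmult A x y') = cnorm A (cmult A x (cadd A y (cscale A (-1) y')))"
    using assms by (simp add: cdist_def distl mult_scale scale_cl)
  then have 1: "cdist A (cmult A x y) (cmult A x y') \<le> cnorm A x * cdist A y y'"
    using assms norm_mult by (simp add: cdist_def add_cl scale_cl)
  have "cdist A (cmult A x y') (cmult A x' y') = cnorm A (cmult A (cadd A x (cscale A (-1) x')) y')"
    using assms by (simp add: cdist_def distr scale_mult scale_cl)
  then have 2: "cdist A (cmult A x y') (cmult A x' y') \<le> cdist A x x' * cnorm A y'"
    using assms norm_mult by (simp add: cdist_def add_cl scale_cl)
  show ?thesis using 1 2 dist_tri[of "cmult A x y" "cmult A x y'" "cmult A x' y'"] assms by (simp add: mult_cl)
qed

lemma cstar_subalgebra_car: "cstar_subalgebra A (car A)"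
  unfolding cstar_subalgebra_def by (auto simp: zero_cl add_cl mult_cl scale_cl adj_cl)

lemma Cstar_car: "Cstar A = car A"
proof
  show "Cstar A \<subseteq> car A" unfolding Cstar_def using cstar_subalgebra_car alg_car by auto
  show "car A \<subseteq> Cstar A" unfolding Cstar_def
  proof (intro subsetI InterI)
    fix x D assume x: "x \<in> car A" and D: "D \<in> {D. cstar_subalgebra A D \<and> alg A \<subseteq> D}"
    obtain a b where "a \<in> alg A" "b \<in> alg A" "x = cadd A a (cadj A b)" using alg_generates[OF x] by auto
    then show "x \<in> D" using D unfolding cstar_subalgebra_def by blast
  qed
qed

lemma proj_norm_le: assumes "p \<in> car A" "cmult A p p = p" "cadj A p = p" shows "cnorm A p \<le> 1"
proof (rule ccontr)
  assume n: "\<not> cnorm A p \<le> 1"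
  have "(cnorm A p)\<^sup>2 \<le> cnorm A p * 1" using norm_cstar[OF assms(1)] assms(2,3) by simp
  then have "cnorm A p * cnorm A p \<le> cnorm A p * 1" by (simp add: power2_eq_square)
  then show False using n by (simp add: mult_le_cancel_left)
qed

lemma proj_norm_ge: assumes "p \<in> car A" "cmult A p p = p" "p \<noteq> czero A" shows "cnorm A p \<ge> 1"
proof -
  have "cnorm A p > 0" using assms norm_zeroD norm_nonneg by fastforce
  moreover have "cnorm A p * 1 \<le> cnorm A p * cnorm A p" using norm_mult[of p p] assms by simp
  ultimately show ?thesis by (simp add: mult_le_cancel_left)
qed

end

section \<open>Homomorphisms of finite-dimensional algebras\<close>

definition alg_hom :: "'a opalg \<Rightarrow> 'b opalg \<Rightarrow> ('a \<Rightarrow> 'b) \<Rightarrow> bool" where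
  "alg_hom A B h \<longleftrightarrow> star_hom A B h \<and> (\<forall>a\<in>alg A. h a \<in> alg B)"

locale fd_hom = A: fd_cstar A + B: fd_cstar B for A :: "'a opalg" and B :: "'b opalg" +
  fixes h :: "'a \<Rightarrow> 'b"
  assumes hom: "star_hom A B h"
begin

lemma h_car: "x \<in> car A \<Longrightarrow> h x \<in> car B"
  and h_add: "x \<in> car A \<Longrightarrow> y \<in> car A \<Longrightarrow> h (cadd A x y) = cadd B (h x) (h y)"
  and h_mult: "x \<in> car A \<Longrightarrow> y \<in> car A \<Longrightarrow> h (cmult A x y) = cmult B (h x) (h y)"
  and h_scale: "x \<in> car A \<Longrightarrow> h (cscale A c x) = cscale B c (h x)"
  and h_adj: "x \<in> car A \<Longrightarrow> h (cadj A x) = cadj B (h x)"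
  using hom unfolding star_hom_def A.Cstar_car B.Cstar_car by auto

lemma h_zero: "h (czero A) = czero B"
  using h_scale[OF A.zero_cl, of 0] by (simp add: A.scale_0 B.scale_0 A.zero_cl h_car)

lemma h_unit_range: "e \<in> A.mat_units \<Longrightarrow> cnorm B (h (A.unit_range e)) \<le> 1"
  by (rule B.proj_norm_le) (simp_all add: h_car A.unit_range_car h_mult[symmetric] A.mat_units(3) h_adj[symmetric] A.unit_range_adj)

text \<open>The C*-inequality for the adjoint bounds the square of the norm by the norm of the
  projection \<open>h (unit_range e)\<close>.\<close>

lemma h_unit: assumes e: "e \<in> A.mat_units" shows "cnorm B (h e) \<le> 1"
proof -
  have "(cnorm B (cadj B (h e)))\<^sup>2 \<le> cnorm B (cmult B (h e) (cadj B (h e)))"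
    using B.norm_cstar[of "cadj B (h e)"] e by (simp add: B.adj_cl B.adj_adj h_car A.unit_car)
  also have "cmult B (h e) (cadj B (h e)) = h (A.unit_range e)"
    using e by (simp add: range_proj_def h_mult h_adj A.unit_car A.adj_cl)
  finally have "(cnorm B (h e))\<^sup>2 \<le> 1" using h_unit_range[OF e] e by (simp add: B.norm_adj h_car A.unit_car)
  then show ?thesis using power2_le_imp_le[of "cnorm B (h e)" 1] by simp
qed

end

context fd_cstar begin

text \<open>Images of matrix units have norm at most one, so a combination of them has a bound that
  does not depend on the target or the map. This replaces contractivity of homomorphisms and keeps
  threads bounded.\<close>

lemma homs_bounded: assumes "x \<in> car A"
  shows "\<exists>C. \<forall>(B::'b opalg) h. fd_cstar B \<longrightarrow> star_hom A B h \<longrightarrow> cnorm B (h x) \<le> C"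
proof -
  define D where "D = {x \<in> car A. \<exists>C. \<forall>(B::'b opalg) h. fd_cstar B \<longrightarrow> star_hom A B h \<longrightarrow> cnorm B (h x) \<le> C}"
  have "x \<in> D"
  proof (rule unit_span[OF assms])
    have "fd_hom A B h" if "fd_cstar B" "star_hom A B h" for B :: "'b opalg" and h
      using that by (simp add: fd_hom_def fd_hom_axioms_def fd_cstar_axioms)
    note fh = this
    have "cnorm B (h (czero A)) \<le> 0" if "fd_cstar B" "star_hom A B h" for B :: "'b opalg" and h
      using fd_hom.h_zero[OF fh[OF that]] fd_cstar.norm_zero[OF that(1)] by simp
    then show "czero A \<in> D" unfolding D_def using zero_cl by blast
    show "e \<in> D" if "e \<in> mat_units" for e
      unfolding D_def using fd_hom.h_unit[OF fh] unit_car that by (auto intro!: exI[of _ 1])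
    show "cscale A c y \<in> D" if yD: "y \<in> D" for c y
    proof -
      obtain C where C: "\<And>(B::'b opalg) h. fd_cstar B \<Longrightarrow> star_hom A B h \<Longrightarrow> cnorm B (h y) \<le> C" and y: "y \<in> car A"
        using yD unfolding D_def by auto
      have "cnorm B (h (cscale A c y)) \<le> cmod c * C" if "fd_cstar B" "star_hom A B h" for B :: "'b opalg" and h
        using C[OF that] fd_hom.h_scale[OF fh[OF that] y] fd_hom.h_car[OF fh[OF that] y] fd_cstar.norm_scale[OF that(1)]
        by (simp add: mult_left_mono)
      then show ?thesis using y scale_cl unfolding D_def by auto
    qed
    show "cadd A y z \<in> D" if yzD: "y \<in> D" "z \<in> D" for y z
    proof -
      obtain C where C: "\<And>(B::'b opalg) h. fd_cstar B \<Longrightarrow> star_hom A B h \<Longrightarrow> cnorm B (h y) \<le> C" and y: "y \<in> car A"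
        using yzD(1) unfolding D_def by auto
      obtain C' where C': "\<And>(B::'b opalg) h. fd_cstar B \<Longrightarrow> star_hom A B h \<Longrightarrow> cnorm B (h z) \<le> C'" and z: "z \<in> car A"
        using yzD(2) unfolding D_def by auto
      have "cnorm B (h (cadd A y z)) \<le> C + C'" if "fd_cstar B" "star_hom A B h" for B :: "'b opalg" and h
        using C[OF that] C'[OF that] fd_hom.h_add[OF fh[OF that] y z] fd_hom.h_car[OF fh[OF that]] y z 
          fd_cstar.norm_add[OF that(1), of "h y" "h z"]
        by simp
      then show ?thesis using y z add_cl unfolding D_def by auto
    qed
  qed
  then show ?thesis by (simp add: D_def)
qed

text \<open>The kernel is spanned by matrix units, and a matrix unit is mapped to zero or to norm one.\<close>

lemma homs_gap: assumes x: "x \<in> car A"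
  shows "\<exists>\<epsilon>>0. \<forall>(B::'b opalg) h. fd_cstar B \<longrightarrow> star_hom A B h \<longrightarrow> h x \<noteq> czero B \<longrightarrow> cnorm B (h x) \<ge> \<epsilon>"
proof -
  define V where "V = {e \<in> mat_units. unit_corner e x \<noteq> czero A}"
  have "\<forall>e\<in>V. \<exists>c. unit_corner e x = cscale A c (unit_range e)" using mat_units(5) x by (auto simp: V_def)
  then obtain c where c: "\<And>e. e \<in> V \<Longrightarrow> unit_corner e x = cscale A (c e) (unit_range e)" by metis
  have c0: "c e \<noteq> 0" if "e \<in> V" for e
    using c[OF that] that scale_0[OF unit_range_car] by (auto simp: V_def)
  have fin: "finite V" using mat_units(1) by (simp add: V_def)
  \<comment> \<open>The least modulus of a nonzero coefficient of \<open>x\<close>; the inserted 1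
    keeps the set nonempty and changes nothing about positivity.\<close>
  define \<epsilon> where "\<epsilon> = Min (insert 1 ((\<lambda>e. cmod (c e)) ` V))"
  have pos: "\<epsilon> > 0" unfolding \<epsilon>_def using fin c0 by (subst Min_gr_iff) auto
  have "cnorm B (h x) \<ge> \<epsilon>" if B: "fd_cstar B" and h: "star_hom A B h" and nz: "h x \<noteq> czero B" for B :: "'b opalg" and h
  proof -
    interpret fd_hom A B h using B h by (simp add: fd_hom_def fd_hom_axioms_def fd_cstar_axioms)
    have "\<exists>e\<in>V. h e \<noteq> czero B"
    proof (rule ccontr)
      assume z: "\<not> (\<exists>e\<in>V. h e \<noteq> czero B)"
      have "x \<in> {y \<in> car A. h y = czero B}"
        by (rule unit_span[OF x]) (use z unit_car in \<open>auto simp: zero_cl h_zero add_cl h_add scale_cl h_scale B.scale_zero B.add_zero B.zero_cl V_def\<close>)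
      then show False using nz by simp
    qed
    then obtain e where e: "e \<in> V" "h e \<noteq> czero B" by auto
    then have eU: "e \<in> mat_units" by (simp add: V_def)
    have q0: "h (unit_range e) \<noteq> czero B"
    proof
      assume "h (unit_range e) = czero B"
      then have "h (cmult A (unit_range e) e) = czero B"
        using eU by (simp add: h_mult unit_range_car unit_car B.zero_mult h_car)
      then show False using e mat_units(4)[OF eU] by simp
    qed
    have "cnorm B (h (unit_range e)) \<ge> 1"
      by (rule B.proj_norm_ge) (use eU q0 in \<open>simp_all add: h_car unit_range_car h_mult[symmetric] mat_units(3)\<close>)
    \<comment> \<open>Compressing \<open>h x\<close> to the corner of \<open>e\<close> does not
      increase the norm, and leaves the coefficient times a projection of norm at least one.\<close>
    then have "cmod (c e) \<le> cmod (c e) * cnorm B (h (unit_range e))" by (simp add: mult_le_cancel_left1)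
    also have "\<dots> = cnorm B (h (unit_corner e x))"
      using eU by (simp add: c[OF e(1)] h_scale unit_range_car B.norm_scale h_car)
    also have "\<dots> = cnorm B (cmult B (cmult B (h (unit_range e)) (h x)) (cadj B (h e)))"
      using eU x by (simp add: corner_def h_mult h_adj unit_range_car unit_car mult_cl adj_cl)
    also have "\<dots> \<le> cnorm B (cmult B (h (unit_range e)) (h x)) * cnorm B (cadj B (h e))"
      using eU x by (intro B.norm_mult) (simp_all add: h_car unit_range_car unit_car B.mult_cl B.adj_cl)
    also have "\<dots> \<le> cnorm B (cmult B (h (unit_range e)) (h x)) * 1"
      using eU x by (intro mult_left_mono) (simp_all add: B.norm_adj h_unit h_car unit_car B.norm_nonneg B.mult_cl unit_range_car)
    also have "\<dots> \<le> cnorm B (h (unit_range e)) * cnorm B (h x)"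
      using eU x by (simp add: B.norm_mult h_car unit_range_car)
    also have "\<dots> \<le> 1 * cnorm B (h x)"
      using eU x by (intro mult_right_mono) (simp_all add: h_unit_range h_car B.norm_nonneg)
    finally have "cmod (c e) \<le> cnorm B (h x)" by simp
    moreover have "\<epsilon> \<le> cmod (c e)" unfolding \<epsilon>_def using fin e by (intro Min_le) auto
    ultimately show ?thesis by simp
  qed
  then show ?thesis using pos by blast
qed

end

section \<open>Direct systems and threads\<close>

lemma star_hom_comp:
  assumes "star_hom A B f" "star_hom B C g" shows "star_hom A C (\<lambda>x. g (f x))"
  using assms unfolding star_hom_def by simp

lemma alg_hom_comp:
  assumes "alg_hom A B f" "alg_hom B C g" shows "alg_hom A C (\<lambda>x. g (f x))"
  using assms star_hom_comp unfolding alg_hom_def by blast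

lemma connecting_map_refl: "connecting_map \<phi> k k = id"
  by (simp add: connecting_map_def)

lemma connecting_map_Suc: "k \<le> l \<Longrightarrow> connecting_map \<phi> k (Suc l) = \<phi> l \<circ> connecting_map \<phi> k l"
  by (simp add: connecting_map_def Suc_diff_le)

lemma connecting_map_comp:
  assumes "k \<le> l" "l \<le> m"
  shows "connecting_map \<phi> l m (connecting_map \<phi> k l x) = connecting_map \<phi> k m x"
  using assms(2)
proof (induction m rule: dec_induct)
  case base
  then show ?case by (simp add: connecting_map_refl)
next
  case (step m)
  then show ?case using assms(1) by (simp add: connecting_map_Suc)
qed

lemma null_comparison:
  fixes f g :: "nat \<Rightarrow> real"
  assumes "\<And>k. norm (f k) \<le> g k" "g \<longlonglongrightarrow> 0" shows "f \<longlonglongrightarrow> 0"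
proof (rule tendsto_0_le[OF assms(2), of _ 1], intro always_eventually allI)
  fix k show "norm (f k) \<le> norm (g k) * 1" using assms(1)[of k] by simp
qed

text \<open>The operations of \<open>alglim\<close> are unions over all representatives;
  independence of the representatives collapses such a union to one class.\<close>

lemma UN_const2:
  assumes "\<And>x y. x \<in> X \<Longrightarrow> y \<in> Y \<Longrightarrow> f x y = S" "a \<in> X" "b \<in> Y"
  shows "(\<Union>x\<in>X. \<Union>y\<in>Y. f x y) = S"
proof -
  have "(\<Union>x\<in>X. \<Union>y\<in>Y. f x y) = (\<Union>x\<in>X. \<Union>y\<in>Y. S)"
    by (intro SUP_cong refl assms(1))
  then show ?thesis using assms(2,3) by auto
qed

text \<open>Only the elements of \<open>Cstar (alglim A \<Phi>)\<close> represented by threads are ever needed, so neither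
  completeness nor the norm of the limit plays a role.\<close>

locale fd_system =
  fixes A :: "nat \<Rightarrow> 'a opalg" and \<Phi> :: "nat \<Rightarrow> 'a \<Rightarrow> 'a"
  assumes fd: "fd_cstar (A k)" and hom: "alg_hom (A k) (A (Suc k)) (\<Phi> k)"
begin

abbreviation "cmap \<equiv> connecting_map \<Phi>"
abbreviation "L \<equiv> alglim A \<Phi>"
definition "\<iota> k x = seq_class A (thread A \<Phi> k x)"

lemma cmap_hom: "k \<le> l \<Longrightarrow> alg_hom (A k) (A l) (cmap k l)"
proof (induction l rule: dec_induct)
  case base
  then show ?case by (auto simp: connecting_map_refl alg_hom_def star_hom_def)
next
  case (step l)
  then show ?case using alg_hom_comp[OF step.IH hom] by (simp add: connecting_map_Suc comp_def)
qed

lemma cmap_fd: "k \<le> l \<Longrightarrow> fd_hom (A k) (A l) (cmap k l)"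
  using cmap_hom fd by (simp add: fd_hom_def fd_hom_axioms_def alg_hom_def)

lemma cmap_car: "k \<le> l \<Longrightarrow> x \<in> car (A k) \<Longrightarrow> cmap k l x \<in> car (A l)"
  using fd_hom.h_car[OF cmap_fd] .

lemma cmap_alg: "k \<le> l \<Longrightarrow> x \<in> alg (A k) \<Longrightarrow> cmap k l x \<in> alg (A l)"
  using cmap_hom by (auto simp: alg_hom_def)

lemma alg_car: "x \<in> alg (A k) \<Longrightarrow> x \<in> car (A k)" using fd_cstar.alg_car[OF fd] by blast

lemma thread_at: "k \<le> l \<Longrightarrow> thread A \<Phi> k x l = cmap k l x"
  by (simp add: thread_def)

lemma thread_car: "x \<in> car (A k) \<Longrightarrow> thread A \<Phi> k x l \<in> car (A l)"
  by (auto simp: thread_def fd_cstar.zero_cl[OF fd] cmap_car)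

lemma thread_bounded: assumes "x \<in> car (A k)" shows "thread A \<Phi> k x \<in> bounded_seqs A"
proof -
  obtain C where C: "\<And>(B::'a opalg) h. fd_cstar B \<Longrightarrow> star_hom (A k) B h \<Longrightarrow> cnorm B (h x) \<le> C"
    using fd_cstar.homs_bounded[OF fd assms] by blast
  have "cnorm (A l) (thread A \<Phi> k x l) \<le> max 0 C" for l
  proof (cases "l < k")
    case False
    then have "cnorm (A l) (cmap k l x) \<le> C" using cmap_hom[of k l] by (intro C fd) (simp add: alg_hom_def)
    then show ?thesis using False by (simp add: thread_def)
  qed (simp add: thread_def fd_cstar.norm_zero[OF fd])
  then show ?thesis unfolding bounded_seqs_def using thread_car[OF assms] by blast
qed

lemma bounded_car: "x \<in> bounded_seqs A \<Longrightarrow> x l \<in> car (A l)" by (simp add: bounded_seqs_def)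

lemma in_class: "x \<in> bounded_seqs A \<Longrightarrow> x \<in> seq_class A x"
  by (simp add: seq_class_def fd_cstar.dist_refl[OF fd] bounded_car)

lemma class_eqI:
  assumes x: "x \<in> bounded_seqs A" and y: "y \<in> bounded_seqs A" and d: "(\<lambda>k. cdist (A k) (x k) (y k)) \<longlonglongrightarrow> 0"
  shows "seq_class A x = seq_class A y"
proof -
  have *: "seq_class A x \<subseteq> seq_class A y"
    if x: "x \<in> bounded_seqs A" and y: "y \<in> bounded_seqs A" and d: "(\<lambda>k. cdist (A k) (x k) (y k)) \<longlonglongrightarrow> 0" for x y
  proof
    fix z assume z: "z \<in> seq_class A x"
    then have zb: "z \<in> bounded_seqs A" and zd: "(\<lambda>k. cdist (A k) (x k) (z k)) \<longlonglongrightarrow> 0" by (auto simp: seq_class_def)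
    have "(\<lambda>k. cdist (A k) (x k) (y k) + cdist (A k) (x k) (z k)) \<longlonglongrightarrow> 0"
      using tendsto_add[OF d zd] by simp
    then have "(\<lambda>k. cdist (A k) (y k) (z k)) \<longlonglongrightarrow> 0"
    proof (rule null_comparison[rotated])
      fix k
      have "cdist (A k) (y k) (z k) \<le> cdist (A k) (y k) (x k) + cdist (A k) (x k) (z k)"
        by (rule fd_cstar.dist_tri[OF fd]) (use x y zb bounded_car in auto)
      moreover have "cdist (A k) (y k) (x k) = cdist (A k) (x k) (y k)"
        by (rule fd_cstar.dist_sym[OF fd]) (use x y bounded_car in auto)
      moreover have "cdist (A k) (y k) (z k) \<ge> 0"
        by (rule fd_cstar.dist_nonneg[OF fd]) (use y zb bounded_car in auto)
      ultimately show "norm (cdist (A k) (y k) (z k)) \<le> cdist (A k) (x k) (y k) + cdist (A k) (x k) (z k)" by simp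
    qed
    then show "z \<in> seq_class A y" using zb by (simp add: seq_class_def)
  qed
  have "(\<lambda>k. cdist (A k) (y k) (x k)) = (\<lambda>k. cdist (A k) (x k) (y k))"
    by (rule ext, rule fd_cstar.dist_sym[OF fd]) (use x y bounded_car in auto)
  then show ?thesis using *[OF x y d] *[OF y x] d by auto
qed

lemma class_eq_eventually:
  assumes x: "x \<in> bounded_seqs A" and y: "y \<in> bounded_seqs A" and "\<And>l. l \<ge> k \<Longrightarrow> x l = y l"
  shows "seq_class A x = seq_class A y"
proof (rule class_eqI[OF x y])
  have "eventually (\<lambda>l. cdist (A l) (x l) (y l) = 0) sequentially"
    unfolding eventually_sequentially using assms fd_cstar.dist_refl[OF fd] bounded_car[OF y] by (intro exI[of _ k]) auto
  then show "(\<lambda>l. cdist (A l) (x l) (y l)) \<longlonglongrightarrow> 0" by (rule tendsto_eventually)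
qed

lemma bounded_add: "x \<in> bounded_seqs A \<Longrightarrow> y \<in> bounded_seqs A \<Longrightarrow> (\<lambda>k. cadd (A k) (x k) (y k)) \<in> bounded_seqs A"
proof -
  assume x: "x \<in> bounded_seqs A" and y: "y \<in> bounded_seqs A"
  then obtain C C' where "\<And>k. cnorm (A k) (x k) \<le> C" "\<And>k. cnorm (A k) (y k) \<le> C'" by (auto simp: bounded_seqs_def)
  then have "cnorm (A k) (cadd (A k) (x k) (y k)) \<le> C + C'" for k
    using fd_cstar.norm_add[OF fd bounded_car[OF x] bounded_car[OF y]] add_mono order_trans by blast
  then show ?thesis unfolding bounded_seqs_def using fd_cstar.add_cl[OF fd] x y bounded_car by blast
qed

lemma bounded_mult: "x \<in> bounded_seqs A \<Longrightarrow> y \<in> bounded_seqs A \<Longrightarrow> (\<lambda>k. cmult (A k) (x k) (y k)) \<in> bounded_seqs A"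
proof -
  assume x: "x \<in> bounded_seqs A" and y: "y \<in> bounded_seqs A"
  then obtain C C' where C: "\<And>k. cnorm (A k) (x k) \<le> C" "\<And>k. cnorm (A k) (y k) \<le> C'" by (auto simp: bounded_seqs_def)
  have "cnorm (A k) (cmult (A k) (x k) (y k)) \<le> C * C'" for k
  proof -
    have "cnorm (A k) (cmult (A k) (x k) (y k)) \<le> cnorm (A k) (x k) * cnorm (A k) (y k)"
      by (rule fd_cstar.norm_mult[OF fd]) (use x y bounded_car in auto)
    also have "\<dots> \<le> C * C'"
      using C fd_cstar.norm_nonneg[OF fd bounded_car[OF x]] fd_cstar.norm_nonneg[OF fd bounded_car[OF y]]
      by (intro mult_mono) (auto intro: order_trans)
    finally show ?thesis .
  qed
  then show ?thesis unfolding bounded_seqs_def using fd_cstar.mult_cl[OF fd] x y bounded_car by blast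
qed

lemma bounded_scale: "x \<in> bounded_seqs A \<Longrightarrow> (\<lambda>k. cscale (A k) c (x k)) \<in> bounded_seqs A"
proof -
  assume x: "x \<in> bounded_seqs A"
  then obtain C where "\<And>k. cnorm (A k) (x k) \<le> C" by (auto simp: bounded_seqs_def)
  then have "cnorm (A k) (cscale (A k) c (x k)) \<le> cmod c * C" for k
    using fd_cstar.norm_scale[OF fd bounded_car[OF x]] by (simp add: mult_left_mono)
  then show ?thesis unfolding bounded_seqs_def using fd_cstar.scale_cl[OF fd] x bounded_car by blast
qed

lemma bounded_adj: "x \<in> bounded_seqs A \<Longrightarrow> (\<lambda>k. cadj (A k) (x k)) \<in> bounded_seqs A"
proof -
  assume x: "x \<in> bounded_seqs A"
  then obtain C where "\<And>k. cnorm (A k) (x k) \<le> C" by (auto simp: bounded_seqs_def)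
  then have "cnorm (A k) (cadj (A k) (x k)) \<le> C" for k
    using fd_cstar.norm_adj[OF fd bounded_car[OF x]] by simp
  then show ?thesis unfolding bounded_seqs_def using fd_cstar.adj_cl[OF fd] x bounded_car by blast
qed

lemma class_add:
  assumes x: "x \<in> bounded_seqs A" and y: "y \<in> bounded_seqs A"
  shows "cadd L (seq_class A x) (seq_class A y) = seq_class A (\<lambda>k. cadd (A k) (x k) (y k))"
proof -
  have "seq_class A (\<lambda>k. cadd (A k) (x' k) (y' k)) = seq_class A (\<lambda>k. cadd (A k) (x k) (y k))"
    if "x' \<in> seq_class A x" "y' \<in> seq_class A y" for x' y'
  proof (rule class_eqI[symmetric])
    have b: "x' \<in> bounded_seqs A" "y' \<in> bounded_seqs A" using that by (auto simp: seq_class_def)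
    show "(\<lambda>k. cadd (A k) (x k) (y k)) \<in> bounded_seqs A" "(\<lambda>k. cadd (A k) (x' k) (y' k)) \<in> bounded_seqs A"
      using x y b bounded_add by auto
    have t: "(\<lambda>k. cdist (A k) (x k) (x' k) + cdist (A k) (y k) (y' k)) \<longlonglongrightarrow> 0"
      using tendsto_add[of _ 0 _ _ 0] that by (force simp: seq_class_def)
    show "(\<lambda>k. cdist (A k) (cadd (A k) (x k) (y k)) (cadd (A k) (x' k) (y' k))) \<longlonglongrightarrow> 0"
    proof (rule null_comparison[OF _ t])
      fix k have c: "x k \<in> car (A k)" "y k \<in> car (A k)" "x' k \<in> car (A k)" "y' k \<in> car (A k)"
        using x y b bounded_car by auto
      show "norm (cdist (A k) (cadd (A k) (x k) (y k)) (cadd (A k) (x' k) (y' k))) \<le> cdist (A k) (x k) (x' k) + cdist (A k) (y k) (y' k)"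
        using fd_cstar.dist_add[OF fd c] fd_cstar.dist_nonneg[OF fd fd_cstar.add_cl[OF fd c(1,2)] fd_cstar.add_cl[OF fd c(3,4)]] by simp
    qed
  qed
  then have "(\<Union>x'\<in>seq_class A x. \<Union>y'\<in>seq_class A y. seq_class A (\<lambda>k. cadd (A k) (x' k) (y' k))) = seq_class A (\<lambda>k. cadd (A k) (x k) (y k))"
    by (rule UN_const2) (assumption | rule in_class[OF x] in_class[OF y])+
  then show ?thesis by (simp add: alglim_def)
qed

lemma class_mult:
  assumes x: "x \<in> bounded_seqs A" and y: "y \<in> bounded_seqs A"
  shows "cmult L (seq_class A x) (seq_class A y) = seq_class A (\<lambda>k. cmult (A k) (x k) (y k))"
proof -
  have "seq_class A (\<lambda>k. cmult (A k) (x' k) (y' k)) = seq_class A (\<lambda>k. cmult (A k) (x k) (y k))"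
    if "x' \<in> seq_class A x" "y' \<in> seq_class A y" for x' y'
  proof (rule class_eqI[symmetric])
    have b: "x' \<in> bounded_seqs A" "y' \<in> bounded_seqs A" using that by (auto simp: seq_class_def)
    show "(\<lambda>k. cmult (A k) (x k) (y k)) \<in> bounded_seqs A" "(\<lambda>k. cmult (A k) (x' k) (y' k)) \<in> bounded_seqs A"
      using x y b bounded_mult by auto
    obtain C C' where C: "\<And>k. cnorm (A k) (x k) \<le> C" "\<And>k. cnorm (A k) (y' k) \<le> C'" using x b(2) by (auto simp: bounded_seqs_def)
    have dx: "(\<lambda>k. cdist (A k) (x k) (x' k)) \<longlonglongrightarrow> 0" and dy: "(\<lambda>k. cdist (A k) (y k) (y' k)) \<longlonglongrightarrow> 0"
      using that by (auto simp: seq_class_def)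
    have t: "(\<lambda>k. C * cdist (A k) (y k) (y' k) + cdist (A k) (x k) (x' k) * C') \<longlonglongrightarrow> 0"
      using tendsto_add[OF tendsto_mult_left[OF dy, of C] tendsto_mult_right[OF dx, of C']] by simp
    show "(\<lambda>k. cdist (A k) (cmult (A k) (x k) (y k)) (cmult (A k) (x' k) (y' k))) \<longlonglongrightarrow> 0"
    proof (rule null_comparison[OF _ t])
      fix k have c: "x k \<in> car (A k)" "y k \<in> car (A k)" "x' k \<in> car (A k)" "y' k \<in> car (A k)"
        using x y b bounded_car by auto
      have "cnorm (A k) (x k) * cdist (A k) (y k) (y' k) \<le> C * cdist (A k) (y k) (y' k)"
        "cdist (A k) (x k) (x' k) * cnorm (A k) (y' k) \<le> cdist (A k) (x k) (x' k) * C'"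
        using C c by (auto intro!: mult_right_mono mult_left_mono fd_cstar.dist_nonneg[OF fd])
      then show "norm (cdist (A k) (cmult (A k) (x k) (y k)) (cmult (A k) (x' k) (y' k))) \<le> C * cdist (A k) (y k) (y' k) + cdist (A k) (x k) (x' k) * C'"
        using fd_cstar.dist_mult[OF fd c] fd_cstar.dist_nonneg[OF fd fd_cstar.mult_cl[OF fd c(1,2)] fd_cstar.mult_cl[OF fd c(3,4)]] by simp
    qed
  qed
  then have "(\<Union>x'\<in>seq_class A x. \<Union>y'\<in>seq_class A y. seq_class A (\<lambda>k. cmult (A k) (x' k) (y' k))) = seq_class A (\<lambda>k. cmult (A k) (x k) (y k))"
    by (rule UN_const2) (assumption | rule in_class[OF x] in_class[OF y])+
  then show ?thesis by (simp add: alglim_def)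
qed

lemma class_scale:
  assumes x: "x \<in> bounded_seqs A"
  shows "cscale L c (seq_class A x) = seq_class A (\<lambda>k. cscale (A k) c (x k))"
proof -
  have "seq_class A (\<lambda>k. cscale (A k) c (x' k)) = seq_class A (\<lambda>k. cscale (A k) c (x k))"
    if "x' \<in> seq_class A x" for x'
  proof (rule class_eqI[symmetric])
    have b: "x' \<in> bounded_seqs A" using that by (auto simp: seq_class_def)
    show "(\<lambda>k. cscale (A k) c (x k)) \<in> bounded_seqs A" "(\<lambda>k. cscale (A k) c (x' k)) \<in> bounded_seqs A"
      using x b bounded_scale by auto
    have dx: "(\<lambda>k. cdist (A k) (x k) (x' k)) \<longlonglongrightarrow> 0" using that by (auto simp: seq_class_def)
    show "(\<lambda>k. cdist (A k) (cscale (A k) c (x k)) (cscale (A k) c (x' k))) \<longlonglongrightarrow> 0"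
      using tendsto_mult_left[OF dx, of "cmod c"] x b bounded_car by (simp add: fd_cstar.dist_scale[OF fd])
  qed
  \<comment> \<open>The one-point second index set lets \<open>UN_const2\<close> serve for a unary
    operation.\<close>
  then have "(\<Union>x'\<in>seq_class A x. \<Union>y'\<in>{()}. seq_class A (\<lambda>k. cscale (A k) c (x' k))) = seq_class A (\<lambda>k. cscale (A k) c (x k))"
    by (rule UN_const2) (assumption | rule in_class[OF x] singletonI)+
  then show ?thesis by (simp add: alglim_def)
qed

lemma class_adj:
  assumes x: "x \<in> bounded_seqs A"
  shows "cadj L (seq_class A x) = seq_class A (\<lambda>k. cadj (A k) (x k))"
proof -
  have "seq_class A (\<lambda>k. cadj (A k) (x' k)) = seq_class A (\<lambda>k. cadj (A k) (x k))"
    if "x' \<in> seq_class A x" for x'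
  proof (rule class_eqI[symmetric])
    have b: "x' \<in> bounded_seqs A" using that by (auto simp: seq_class_def)
    show "(\<lambda>k. cadj (A k) (x k)) \<in> bounded_seqs A" "(\<lambda>k. cadj (A k) (x' k)) \<in> bounded_seqs A"
      using x b bounded_adj by auto
    have dx: "(\<lambda>k. cdist (A k) (x k) (x' k)) \<longlonglongrightarrow> 0" using that by (auto simp: seq_class_def)
    then show "(\<lambda>k. cdist (A k) (cadj (A k) (x k)) (cadj (A k) (x' k))) \<longlonglongrightarrow> 0"
      using x b bounded_car by (simp add: fd_cstar.dist_adj[OF fd])
  qed
  then have "(\<Union>x'\<in>seq_class A x. \<Union>y'\<in>{()}. seq_class A (\<lambda>k. cadj (A k) (x' k))) = seq_class A (\<lambda>k. cadj (A k) (x k))"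
    by (rule UN_const2) (assumption | rule in_class[OF x] singletonI)+
  then show ?thesis by (simp add: alglim_def)
qed

lemma \<iota>_add: assumes "x \<in> car (A k)" "y \<in> car (A k)"
  shows "\<iota> k (cadd (A k) x y) = cadd L (\<iota> k x) (\<iota> k y)"
  unfolding \<iota>_def class_add[OF thread_bounded[OF assms(1)] thread_bounded[OF assms(2)]]
  by (rule class_eq_eventually[of _ _ k])
    (use assms in \<open>auto simp: thread_bounded bounded_add fd_cstar.add_cl[OF fd] thread_at fd_hom.h_add[OF cmap_fd]\<close>)

lemma \<iota>_mult: assumes "x \<in> car (A k)" "y \<in> car (A k)"
  shows "\<iota> k (cmult (A k) x y) = cmult L (\<iota> k x) (\<iota> k y)"
  unfolding \<iota>_def class_mult[OF thread_bounded[OF assms(1)] thread_bounded[OF assms(2)]]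
  by (rule class_eq_eventually[of _ _ k])
    (use assms in \<open>auto simp: thread_bounded bounded_mult fd_cstar.mult_cl[OF fd] thread_at fd_hom.h_mult[OF cmap_fd]\<close>)

lemma \<iota>_scale: assumes "x \<in> car (A k)"
  shows "\<iota> k (cscale (A k) c x) = cscale L c (\<iota> k x)"
  unfolding \<iota>_def class_scale[OF thread_bounded[OF assms(1)]]
  by (rule class_eq_eventually[of _ _ k])
    (use assms in \<open>auto simp: thread_bounded bounded_scale fd_cstar.scale_cl[OF fd] thread_at fd_hom.h_scale[OF cmap_fd]\<close>)

lemma \<iota>_adj: assumes "x \<in> car (A k)"
  shows "\<iota> k (cadj (A k) x) = cadj L (\<iota> k x)"
  unfolding \<iota>_def class_adj[OF thread_bounded[OF assms(1)]]
  by (rule class_eq_eventually[of _ _ k])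
    (use assms in \<open>auto simp: thread_bounded bounded_adj fd_cstar.adj_cl[OF fd] thread_at fd_hom.h_adj[OF cmap_fd]\<close>)

lemma alg_L: "alg L = {\<iota> k a | k a. a \<in> alg (A k)}"
  by (simp add: alglim_def \<iota>_def)

lemma \<iota>_alg: "x \<in> alg (A k) \<Longrightarrow> \<iota> k x \<in> alg L"
  unfolding alg_L by blast

lemma \<iota>_Cstar: assumes "x \<in> car (A k)" shows "\<iota> k x \<in> Cstar L"
proof -
  obtain a b where ab: "a \<in> alg (A k)" "b \<in> alg (A k)" "x = cadd (A k) a (cadj (A k) b)"
    using fd_cstar.alg_generates[OF fd assms] by blast
  then have "\<iota> k x = cadd L (\<iota> k a) (cadj L (\<iota> k b))"
    by (simp add: \<iota>_add \<iota>_adj alg_car fd_cstar.adj_cl[OF fd])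
  moreover have "cadd L (\<iota> k a) (cadj L (\<iota> k b)) \<in> D" if D: "cstar_subalgebra L D" "alg L \<subseteq> D" for D
  proof -
    have "\<iota> k a \<in> D" "cadj L (\<iota> k b) \<in> D"
      using D \<iota>_alg[OF ab(1)] \<iota>_alg[OF ab(2)] unfolding cstar_subalgebra_def by blast+
    then show ?thesis using D unfolding cstar_subalgebra_def by blast
  qed
  ultimately show ?thesis by (simp add: Cstar_def)
qed

lemma \<iota>_cmap: "k \<le> l \<Longrightarrow> x \<in> car (A k) \<Longrightarrow> \<iota> l (cmap k l x) = \<iota> k x"
  unfolding \<iota>_def
  by (rule class_eq_eventually[of _ _ l]) (auto simp: thread_bounded cmap_car thread_at connecting_map_comp)

text \<open>The differences of the two threads tend to zero, while by \<open>homs_gap\<close> their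
  norms avoid the values strictly between 0 and the gap. So the difference vanishes exactly from
  some level on.\<close>

lemma \<iota>_eqD: assumes xy: "x \<in> car (A k)" "y \<in> car (A k)" and eq: "\<iota> k x = \<iota> k y"
  shows "\<exists>l\<ge>k. cmap k l x = cmap k l y"
proof -
  define z where "z = cadd (A k) x (cscale (A k) (-1) y)"
  have z: "z \<in> car (A k)" using xy by (simp add: z_def fd_cstar.add_cl[OF fd] fd_cstar.scale_cl[OF fd])
  obtain \<epsilon> where \<epsilon>: "\<epsilon> > 0" "\<And>(B::'a opalg) h. fd_cstar B \<Longrightarrow> star_hom (A k) B h \<Longrightarrow> h z \<noteq> czero B \<Longrightarrow> cnorm B (h z) \<ge> \<epsilon>"
    using fd_cstar.homs_gap[OF fd z] by blast
  have "thread A \<Phi> k y \<in> seq_class A (thread A \<Phi> k x)"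
    using eq in_class[OF thread_bounded[OF xy(2)]] by (simp add: \<iota>_def)
  then have "(\<lambda>l. cdist (A l) (thread A \<Phi> k x l) (thread A \<Phi> k y l)) \<longlonglongrightarrow> 0" by (simp add: seq_class_def)
  then have "eventually (\<lambda>l. cdist (A l) (thread A \<Phi> k x l) (thread A \<Phi> k y l) < \<epsilon>) sequentially"
    using \<epsilon>(1) by (rule order_tendstoD)
  then obtain N where N: "\<And>l. l \<ge> N \<Longrightarrow> cdist (A l) (thread A \<Phi> k x l) (thread A \<Phi> k y l) < \<epsilon>"
    unfolding eventually_sequentially by blast
  define l where "l = max N k"
  have lk: "k \<le> l" by (simp add: l_def)
  have d: "cdist (A l) (cmap k l x) (cmap k l y) = cnorm (A l) (cmap k l z)"
    using xy by (simp add: cdist_def z_def fd_hom.h_add[OF cmap_fd[OF lk]] fd_hom.h_scale[OF cmap_fd[OF lk]] fd_cstar.scale_cl[OF fd])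
  have "cdist (A l) (cmap k l x) (cmap k l y) < \<epsilon>" using N[of l] by (simp add: l_def thread_def)
  then have "cmap k l z = czero (A l)"
    using \<epsilon>(2)[OF fd, of l "cmap k l"] cmap_hom[OF lk] d by (fastforce simp: alg_hom_def)
  then have "cdist (A l) (cmap k l x) (cmap k l y) = 0" using d fd_cstar.norm_zero[OF fd] by simp
  then have "cmap k l x = cmap k l y"
    by (intro fd_cstar.eq_of_dist[OF fd]) (use xy lk cmap_car in auto)
  then show ?thesis using lk by blast
qed

text \<open>The elements of level \<open>k\<close> that vanish in the limit are spanned by finitely
  many matrix units, so one level is late enough for all of them at once.\<close>

lemma separating_level:
  "\<exists>l\<ge>k. \<forall>l'\<ge>l. \<forall>x\<in>car (A k). \<forall>y\<in>car (A k). \<iota> k x = \<iota> k y \<longrightarrow> cmap k l' x = cmap k l' y"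
proof -
  interpret Ak: fd_cstar "A k" by (rule fd)
  have "\<forall>e\<in>{e \<in> Ak.mat_units. \<iota> k e = \<iota> k (czero (A k))}. \<exists>l\<ge>k. cmap k l e = cmap k l (czero (A k))"
    using \<iota>_eqD[OF Ak.unit_car Ak.zero_cl] by auto
  then obtain l where l: "\<And>e. e \<in> Ak.mat_units \<Longrightarrow> \<iota> k e = \<iota> k (czero (A k)) \<Longrightarrow> l e \<ge> k \<and> cmap k (l e) e = cmap k (l e) (czero (A k))"
    by (metis (mono_tags, lifting) mem_Collect_eq)
  define N where "N = Max (insert k (l ` {e \<in> Ak.mat_units. \<iota> k e = \<iota> k (czero (A k))}))"
  have fin: "finite (insert k (l ` {e \<in> Ak.mat_units. \<iota> k e = \<iota> k (czero (A k))}))" using Ak.mat_units(1) by simp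
  have Nk: "N \<ge> k" unfolding N_def using fin by (intro Max_ge) auto
  have "cmap k l' x = cmap k l' y" if l': "l' \<ge> N" and xy: "x \<in> car (A k)" "y \<in> car (A k)" and eq: "\<iota> k x = \<iota> k y" for l' x y
  proof -
    have kl': "k \<le> l'" using Nk l' by simp
    interpret c: fd_hom "A k" "A l'" "cmap k l'" by (rule cmap_fd[OF kl'])
    have units: "cmap k l' e = czero (A l')" if e: "e \<in> Ak.mat_units" "\<iota> k e = \<iota> k (czero (A k))" for e
    proof -
      have "l e \<le> N" unfolding N_def using fin e by (intro Max_ge) auto
      then have le: "l e \<le> l'" "k \<le> l e" using l' l[OF e] by auto
      have "cmap k l' e = cmap (l e) l' (cmap k (l e) e)" using le by (simp add: connecting_map_comp)
      also have "\<dots> = cmap k l' (czero (A k))" using l[OF e] le by (simp add: connecting_map_comp)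
      finally show ?thesis by (simp add: c.h_zero)
    qed
    define z where "z = cadd (A k) x (cscale (A k) (-1) y)"
    have z: "z \<in> car (A k)" using xy by (simp add: z_def Ak.add_cl Ak.scale_cl)
    have \<iota>z: "\<iota> k z = \<iota> k (czero (A k))"
      using xy eq by (simp add: z_def \<iota>_add \<iota>_scale Ak.scale_cl Ak.add_neg[symmetric, OF xy(2)])
    have "z \<in> {w \<in> car (A k). cmap k l' w = czero (A l')}"
    proof (rule Ak.unit_span[OF z])
      show "czero (A k) \<in> {w \<in> car (A k). cmap k l' w = czero (A l')}" by (simp add: Ak.zero_cl c.h_zero)
      show "cadd (A k) u v \<in> {w \<in> car (A k). cmap k l' w = czero (A l')}"
        if "u \<in> {w \<in> car (A k). cmap k l' w = czero (A l')}" "v \<in> {w \<in> car (A k). cmap k l' w = czero (A l')}" for u v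
        using that by (simp add: Ak.add_cl c.h_add c.B.add_zero c.B.zero_cl)
      show "cscale (A k) a u \<in> {w \<in> car (A k). cmap k l' w = czero (A l')}"
        if "u \<in> {w \<in> car (A k). cmap k l' w = czero (A l')}" for a u
        using that by (simp add: Ak.scale_cl c.h_scale c.B.scale_zero)
      fix e assume e: "e \<in> Ak.mat_units" "corner (A k) e z \<noteq> czero (A k)"
      obtain a where a: "corner (A k) e z = cscale (A k) a (range_proj (A k) e)" using Ak.mat_units(5)[OF e(1) z] by blast
      have q: "range_proj (A k) e \<in> car (A k)" by (rule Ak.unit_range_car[OF e(1)])
      have a0: "a \<noteq> 0" using a e(2) q by (auto simp: Ak.scale_0)
      note cl = Ak.unit_car[OF e(1)] q Ak.adj_cl Ak.mult_cl Ak.scale_cl Ak.zero_cl z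
      \<comment> \<open>The corner of \<open>z\<close> is a nonzero multiple of the range projection
        of \<open>e\<close>; so this projection vanishes in the limit, and with it
        \<open>e\<close>.\<close>
      have "\<iota> k (corner (A k) e z) = \<iota> k (corner (A k) e (czero (A k)))"
        unfolding corner_def using cl \<iota>z by (simp add: \<iota>_mult)
      also have "corner (A k) e (czero (A k)) = czero (A k)"
        unfolding corner_def using cl by (simp add: Ak.mult_zero Ak.zero_mult)
      finally have "\<iota> k (cscale (A k) (1/a) (cscale (A k) a (range_proj (A k) e))) = \<iota> k (cscale (A k) (1/a) (czero (A k)))"
        using cl by (simp add: \<iota>_scale a)
      then have "\<iota> k (range_proj (A k) e) = \<iota> k (czero (A k))"
        using cl a0 by (simp add: Ak.scale_scale Ak.scale_one Ak.scale_zero)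
      then have "\<iota> k (cmult (A k) (range_proj (A k) e) e) = \<iota> k (cmult (A k) (czero (A k)) e)"
        using cl by (simp add: \<iota>_mult)
      then have "\<iota> k e = \<iota> k (czero (A k))" using Ak.mat_units(4)[OF e(1)] cl by (simp add: Ak.zero_mult)
      then show "e \<in> {w \<in> car (A k). cmap k l' w = czero (A l')}" using units e cl by simp
    qed
    then have "cadd (A l') (cmap k l' x) (cscale (A l') (-1) (cmap k l' y)) = czero (A l')"
      using xy by (simp add: z_def c.h_add c.h_scale Ak.scale_cl)
    then show ?thesis
      by (intro c.B.eq_of_dist) (use xy in \<open>simp_all add: c.h_car cdist_def c.B.norm_zero\<close>)
  qed
  then show ?thesis using Nk by blast
qed

end

section \<open>Intertwining of isomorphic limits\<close>

locale limit_hom = A: fd_system A \<Phi> + B: fd_system B \<Psi>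
  for A :: "nat \<Rightarrow> 'a opalg" and \<Phi> and B :: "nat \<Rightarrow> 'a opalg" and \<Psi> +
  fixes \<Theta>
  assumes \<Theta>: "star_hom A.L B.L \<Theta>" and \<Theta>_alg: "x \<in> alg A.L \<Longrightarrow> \<Theta> x \<in> alg B.L"
begin

lemma \<Theta>_add: "x \<in> car (A k) \<Longrightarrow> y \<in> car (A k) \<Longrightarrow>
    \<Theta> (A.\<iota> k (cadd (A k) x y)) = cadd B.L (\<Theta> (A.\<iota> k x)) (\<Theta> (A.\<iota> k y))"
  using \<Theta> A.\<iota>_Cstar unfolding star_hom_def by (simp add: A.\<iota>_add)

lemma \<Theta>_mult: "x \<in> car (A k) \<Longrightarrow> y \<in> car (A k) \<Longrightarrow>
    \<Theta> (A.\<iota> k (cmult (A k) x y)) = cmult B.L (\<Theta> (A.\<iota> k x)) (\<Theta> (A.\<iota> k y))"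
  using \<Theta> A.\<iota>_Cstar unfolding star_hom_def by (simp add: A.\<iota>_mult)

lemma \<Theta>_scale: "x \<in> car (A k) \<Longrightarrow> \<Theta> (A.\<iota> k (cscale (A k) c x)) = cscale B.L c (\<Theta> (A.\<iota> k x))"
  using \<Theta> A.\<iota>_Cstar unfolding star_hom_def by (simp add: A.\<iota>_scale)

lemma \<Theta>_adj: "x \<in> car (A k) \<Longrightarrow> \<Theta> (A.\<iota> k (cadj (A k) x)) = cadj B.L (\<Theta> (A.\<iota> k x))"
  using \<Theta> A.\<iota>_Cstar unfolding star_hom_def by (simp add: A.\<iota>_adj)

definition "lifts m k x y \<longleftrightarrow> B.\<iota> m y = \<Theta> (A.\<iota> k x)"

lemma alg_lifts_from: 
  assumes "x \<in> alg (A k)" shows "\<exists>m. \<forall>m'\<ge>m. \<exists>y\<in>alg (B m'). lifts m' k x y"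
proof -
  have "\<Theta> (A.\<iota> k x) \<in> alg B.L" by (rule \<Theta>_alg[OF A.\<iota>_alg[OF assms]])
  then obtain m y where y: "y \<in> alg (B m)" "\<Theta> (A.\<iota> k x) = B.\<iota> m y" unfolding B.alg_L by blast
  have "\<exists>y\<in>alg (B m'). lifts m' k x y" if "m' \<ge> m" for m'
    using B.cmap_alg[OF that y(1)] B.\<iota>_cmap[OF that B.alg_car[OF y(1)]] y(2)
    by (auto simp: lifts_def intro!: bexI[of _ "B.cmap m m' y"])
  then show ?thesis by blast
qed

text \<open>\<open>star_hom\<close> has no clause for zero. Its image is computed as 0 times a lift
  that exists at some later level, and is then brought back to level \<open>m\<close>.\<close>

lemma zero_lifts: "lifts m k (czero (A k)) (czero (B m))"
proof -
  interpret Ak: fd_cstar "A k" by (rule A.fd)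
  obtain m' where m': "m' \<ge> m" "\<exists>y\<in>alg (B m'). lifts m' k (czero (A k)) y"
    using alg_lifts_from[OF Ak.alg_zero] by (meson nle_le)
  then obtain y where y: "y \<in> car (B m')" "lifts m' k (czero (A k)) y" using B.alg_car by blast
  have "\<Theta> (A.\<iota> k (czero (A k))) = cscale B.L 0 (\<Theta> (A.\<iota> k (czero (A k))))"
    using \<Theta>_scale[OF Ak.zero_cl, of 0] by (simp add: Ak.scale_0 Ak.zero_cl)
  also have "\<dots> = B.\<iota> m' (cscale (B m') 0 y)" using y by (simp add: lifts_def B.\<iota>_scale)
  also have "cscale (B m') 0 y = czero (B m')" using y(1) by (rule fd_cstar.scale_0[OF B.fd])
  also have "\<dots> = B.cmap m m' (czero (B m))" by (rule fd_hom.h_zero[OF B.cmap_fd[OF m'(1)], symmetric])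
  also have "B.\<iota> m' \<dots> = B.\<iota> m (czero (B m))" by (rule B.\<iota>_cmap[OF m'(1) fd_cstar.zero_cl[OF B.fd]])
  finally show ?thesis by (simp add: lifts_def)
qed

text \<open>The matrix units occurring in elements of \<open>alg (A k)\<close> lie in it, so only
  these finitely many units have to be lifted; lifts persist at later levels, which allows a common
  one.\<close>

lemma alg_lifts: "\<exists>m\<ge>M. \<forall>x\<in>alg (A k). \<exists>y\<in>alg (B m). lifts m k x y"
proof -
  interpret Ak: fd_cstar "A k" by (rule A.fd)
  have "\<forall>e\<in>Ak.mat_units \<inter> alg (A k). \<exists>m. \<forall>m'\<ge>m. \<exists>y\<in>alg (B m'). lifts m' k e y"
    using alg_lifts_from by blast
  then obtain f where f: "\<And>e m'. e \<in> Ak.mat_units \<inter> alg (A k) \<Longrightarrow> m' \<ge> f e \<Longrightarrow> \<exists>y\<in>alg (B m'). lifts m' k e y"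
    by metis
  define N where "N = Max (insert M (f ` (Ak.mat_units \<inter> alg (A k))))"
  have fin: "finite (insert M (f ` (Ak.mat_units \<inter> alg (A k))))" using Ak.mat_units(1) by simp
  have NM: "N \<ge> M" unfolding N_def using fin by (intro Max_ge) auto
  interpret BN: fd_cstar "B N" by (rule B.fd)
  define D where "D = {x \<in> alg (A k). \<exists>y\<in>alg (B N). lifts N k x y}"
  have "x \<in> D" if x: "x \<in> alg (A k)" for x
  proof (rule Ak.unit_span)
    show "x \<in> car (A k)" by (rule A.alg_car[OF x])
    show "czero (A k) \<in> D" unfolding D_def using zero_lifts Ak.alg_zero BN.alg_zero by blast
    show "cadd (A k) y z \<in> D" if yz: "y \<in> D" "z \<in> D" for y z
    proof -
      obtain y' z' where "y' \<in> alg (B N)" "z' \<in> alg (B N)" "lifts N k y y'" "lifts N k z z'" "y \<in> alg (A k)" "z \<in> alg (A k)"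
        using yz unfolding D_def by blast
      then have "lifts N k (cadd (A k) y z) (cadd (B N) y' z')" "cadd (B N) y' z' \<in> alg (B N)" "cadd (A k) y z \<in> alg (A k)"
        by (simp_all add: lifts_def \<Theta>_add A.alg_car B.alg_car B.\<iota>_add BN.alg_add Ak.alg_add)
      then show ?thesis unfolding D_def by blast
    qed
    show "cscale (A k) c y \<in> D" if yD: "y \<in> D" for c y
    proof -
      obtain y' where "y' \<in> alg (B N)" "lifts N k y y'" "y \<in> alg (A k)"
        using yD unfolding D_def by blast
      then have "lifts N k (cscale (A k) c y) (cscale (B N) c y')" "cscale (B N) c y' \<in> alg (B N)" "cscale (A k) c y \<in> alg (A k)"
        by (simp_all add: lifts_def \<Theta>_scale A.alg_car B.alg_car B.\<iota>_scale BN.alg_scale Ak.alg_scale)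
      then show ?thesis unfolding D_def by blast
    qed
    fix e assume e: "e \<in> Ak.mat_units" "corner (A k) e x \<noteq> czero (A k)"
    have ea: "e \<in> alg (A k)" by (rule Ak.mat_units(6)[OF e(1) x e(2)])
    have "f e \<le> N" unfolding N_def using fin e(1) ea by (intro Max_ge) auto
    then have "\<exists>y\<in>alg (B N). lifts N k e y" using f e(1) ea by blast
    then show "e \<in> D" using ea by (simp add: D_def)
  qed
  then show ?thesis using NM unfolding D_def by blast
qed

text \<open>Lifts chosen one element at a time satisfy the laws of a homomorphism only in the limit.
  A connecting map to a separating level of the target turns equality in the limit into equality,
  and the laws become exact.\<close>

lemma hom_lift: "\<exists>m\<ge>M. \<exists>\<alpha>. alg_hom (A k) (B m) \<alpha> \<and> (\<forall>x\<in>car (A k). lifts m k x (\<alpha> x))"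
proof -
  interpret Ak: fd_cstar "A k" by (rule A.fd)
  obtain N where N: "N \<ge> M" "\<And>x. x \<in> alg (A k) \<Longrightarrow> \<exists>y\<in>alg (B N). lifts N k x y" using alg_lifts by blast
  interpret BN: fd_cstar "B N" by (rule B.fd)
  \<comment> \<open>Elements of the algebra get lifts in the algebra, since the final map has to
    respect the subalgebras.\<close>
  have "\<exists>y\<in>car (B N). lifts N k x y \<and> (x \<in> alg (A k) \<longrightarrow> y \<in> alg (B N))" if x: "x \<in> car (A k)" for x
  proof (cases "x \<in> alg (A k)")
    case True
    then show ?thesis using N(2)[OF True] B.alg_car by blast
  next
    case False
    obtain a b where ab: "a \<in> alg (A k)" "b \<in> alg (A k)" "x = cadd (A k) a (cadj (A k) b)"
      using Ak.alg_generates[OF x] by blast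
    obtain a' b' where "a' \<in> alg (B N)" "b' \<in> alg (B N)" "lifts N k a a'" "lifts N k b b'"
      using N(2)[OF ab(1)] N(2)[OF ab(2)] by blast
    then have "lifts N k x (cadd (B N) a' (cadj (B N) b'))" "cadd (B N) a' (cadj (B N) b') \<in> car (B N)"
      using ab by (simp_all add: lifts_def B.\<iota>_add B.\<iota>_adj B.alg_car BN.adj_cl BN.add_cl \<Theta>_add \<Theta>_adj A.alg_car Ak.adj_cl)
    then show ?thesis using False by blast
  qed
  then obtain g where g: "\<And>x. x \<in> car (A k) \<Longrightarrow> g x \<in> car (B N)" "\<And>x. x \<in> car (A k) \<Longrightarrow> lifts N k x (g x)"
    "\<And>x. x \<in> alg (A k) \<Longrightarrow> g x \<in> alg (B N)" using A.alg_car by metis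
  obtain l where l: "l \<ge> N" and sep: "\<And>x y. x \<in> car (B N) \<Longrightarrow> y \<in> car (B N) \<Longrightarrow> B.\<iota> N x = B.\<iota> N y \<Longrightarrow> B.cmap N l x = B.cmap N l y"
    using B.separating_level[of N] by blast
  interpret c: fd_hom "B N" "B l" "B.cmap N l" by (rule B.cmap_fd[OF l])
  have sep': "B.cmap N l (g x) = B.cmap N l y" if "x \<in> car (A k)" "y \<in> car (B N)" "lifts N k x y" for x y
    by (rule sep) (use that g in \<open>auto simp: lifts_def\<close>)
  define \<alpha> where "\<alpha> x = B.cmap N l (g x)" for x
  have "alg_hom (A k) (B l) \<alpha>"
    unfolding alg_hom_def star_hom_def Ak.Cstar_car c.B.Cstar_car
  proof (intro conjI ballI allI)
    fix x y assume xy: "x \<in> car (A k)" "y \<in> car (A k)"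
    show "\<alpha> (cadd (A k) x y) = cadd (B l) (\<alpha> x) (\<alpha> y)"
      unfolding \<alpha>_def using g xy
      by (subst sep'[of _ "cadd (B N) (g x) (g y)"]) (simp_all add: Ak.add_cl BN.add_cl lifts_def B.\<iota>_add \<Theta>_add c.h_add)
    show "\<alpha> (cmult (A k) x y) = cmult (B l) (\<alpha> x) (\<alpha> y)"
      unfolding \<alpha>_def using g xy
      by (subst sep'[of _ "cmult (B N) (g x) (g y)"]) (simp_all add: Ak.mult_cl BN.mult_cl lifts_def B.\<iota>_mult \<Theta>_mult c.h_mult)
  next
    fix c x assume x: "x \<in> car (A k)"
    show "\<alpha> (cscale (A k) c x) = cscale (B l) c (\<alpha> x)"
      unfolding \<alpha>_def using g x
      by (subst sep'[of _ "cscale (B N) c (g x)"]) (simp_all add: Ak.scale_cl BN.scale_cl lifts_def B.\<iota>_scale \<Theta>_scale c.h_scale)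
  next
    fix x assume x: "x \<in> car (A k)"
    show "\<alpha> (cadj (A k) x) = cadj (B l) (\<alpha> x)"
      unfolding \<alpha>_def using g x
      by (subst sep'[of _ "cadj (B N) (g x)"]) (simp_all add: Ak.adj_cl BN.adj_cl lifts_def B.\<iota>_adj \<Theta>_adj c.h_adj)
    show "\<alpha> x \<in> car (B l)" unfolding \<alpha>_def using g x by (simp add: c.h_car)
  next
    fix a assume "a \<in> alg (A k)"
    then show "\<alpha> a \<in> alg (B l)" unfolding \<alpha>_def using g(3) l by (simp add: B.cmap_alg)
  qed
  moreover have "lifts l k x (\<alpha> x)" if "x \<in> car (A k)" for x
    using g(2)[OF that] B.\<iota>_cmap[OF l g(1)[OF that]] by (simp add: lifts_def \<alpha>_def)
  ultimately show ?thesis using l N(1) le_trans by blast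
qed

end

locale limit_iso = limit_hom A \<Phi> B \<Psi> \<Theta> + inv: limit_hom B \<Psi> A \<Phi> \<Theta>'
  for A :: "nat \<Rightarrow> 'a opalg" and \<Phi> and B :: "nat \<Rightarrow> 'a opalg" and \<Psi> \<Theta> \<Theta>' +
  assumes inverse: "z \<in> Cstar A.L \<Longrightarrow> \<Theta>' (\<Theta> z) = z"
begin

text \<open>A lift of the inverse, composed with \<open>\<alpha>\<close>, agrees with the connecting
  map only in the limit; moving on to a separating level makes the triangle commute.\<close>

lemma half_step:
  assumes \<alpha>: "alg_hom (A n) (B m) \<alpha>" "\<And>x. x \<in> car (A n) \<Longrightarrow> lifts m n x (\<alpha> x)"
  shows "\<exists>n'>n. \<exists>\<beta>. alg_hom (B m) (A n') \<beta> \<and> (\<forall>y\<in>car (B m). inv.lifts n' m y (\<beta> y)) \<and>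
     (\<forall>x\<in>car (A n). \<beta> (\<alpha> x) = A.cmap n n' x)"
proof -
  \<comment> \<open>The bound \<open>Suc n\<close> makes the levels increase strictly.\<close>
  obtain n0 \<beta>0 where n0: "n0 \<ge> Suc n" and \<beta>0: "alg_hom (B m) (A n0) \<beta>0" "\<And>y. y \<in> car (B m) \<Longrightarrow> inv.lifts n0 m y (\<beta>0 y)"
    using inv.hom_lift[of "Suc n" m] by blast
  obtain n' where n': "n' \<ge> n0" and sep: "\<And>x y. x \<in> car (A n0) \<Longrightarrow> y \<in> car (A n0) \<Longrightarrow> A.\<iota> n0 x = A.\<iota> n0 y \<Longrightarrow> A.cmap n0 n' x = A.cmap n0 n' y"
    using A.separating_level[of n0] by blast
  have fa: "fd_hom (A n) (B m) \<alpha>" and fb: "fd_hom (B m) (A n0) \<beta>0"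
    using \<alpha>(1) \<beta>0(1) A.fd B.fd by (simp_all add: fd_hom_def fd_hom_axioms_def alg_hom_def)
  define \<beta> where "\<beta> y = A.cmap n0 n' (\<beta>0 y)" for y
  have "alg_hom (B m) (A n') \<beta>"
    unfolding \<beta>_def by (rule alg_hom_comp[OF \<beta>0(1) A.cmap_hom[OF n']])
  moreover have "inv.lifts n' m y (\<beta> y)" if "y \<in> car (B m)" for y
    using \<beta>0(2)[OF that] A.\<iota>_cmap[OF n' fd_hom.h_car[OF fb that]] by (simp add: inv.lifts_def \<beta>_def)
  moreover have "\<beta> (\<alpha> x) = A.cmap n n' x" if x: "x \<in> car (A n)" for x
  proof -
    have ax: "\<alpha> x \<in> car (B m)" by (rule fd_hom.h_car[OF fa x])
    have "A.\<iota> n0 (\<beta>0 (\<alpha> x)) = \<Theta>' (\<Theta> (A.\<iota> n x))"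
      using \<beta>0(2)[OF ax] \<alpha>(2)[OF x] by (simp add: lifts_def inv.lifts_def)
    also have "\<dots> = A.\<iota> n x" by (rule inverse[OF A.\<iota>_Cstar[OF x]])
    also have "\<dots> = A.\<iota> n0 (A.cmap n n0 x)" using n0 x by (simp add: A.\<iota>_cmap)
    finally have "A.cmap n0 n' (\<beta>0 (\<alpha> x)) = A.cmap n0 n' (A.cmap n n0 x)"
      using n0 x by (intro sep fd_hom.h_car[OF fb] ax A.cmap_car) auto
    then show ?thesis using n0 n' by (simp add: \<beta>_def connecting_map_comp)
  qed
  ultimately show ?thesis using n0 n' by (intro exI[of _ n'] conjI exI[of _ \<beta>]) auto
qed

end

text \<open>Each half of a step hands on the property of lifting the isomorphism, which the next
  half requires. The state of the recursion is a pair of levels with a map between them; the maps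
  going back are recovered afterwards from the relation between successive states.\<close>

lemma zigzag:
  assumes "limit_iso A \<Phi> B \<Psi> \<Theta> \<Theta>'" "limit_iso B \<Psi> A \<Phi> \<Theta>' \<Theta>"
  shows "\<exists>n m \<alpha> \<beta>. strict_mono n \<and> strict_mono m \<and>
     (\<forall>k. alg_hom (A (n k)) (B (m k)) (\<alpha> k)) \<and> (\<forall>k. alg_hom (B (m k)) (A (n (Suc k))) (\<beta> k)) \<and>
     (\<forall>k. \<forall>x\<in>alg (A (n k)). \<beta> k (\<alpha> k x) = connecting_map \<Phi> (n k) (n (Suc k)) x) \<and>
     (\<forall>k. \<forall>y\<in>alg (B (m k)). \<alpha> (Suc k) (\<beta> k y) = connecting_map \<Psi> (m k) (m (Suc k)) y)"
proof -
  interpret I: limit_iso A \<Phi> B \<Psi> \<Theta> \<Theta>' by fact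
  interpret J: limit_iso B \<Psi> A \<Phi> \<Theta>' \<Theta> by fact
  define P where "P s \<longleftrightarrow> (case s of (n, m, \<alpha>) \<Rightarrow> alg_hom (A n) (B m) \<alpha> \<and> (\<forall>x\<in>car (A n). I.lifts m n x (\<alpha> x)))" for s
  define R where "R s s' \<longleftrightarrow> (case s of (n, m, \<alpha>) \<Rightarrow> case s' of (n', m', \<alpha>') \<Rightarrow> n < n' \<and> m < m' \<and>
    (\<exists>\<beta>. alg_hom (B m) (A n') \<beta> \<and> (\<forall>x\<in>car (A n). \<beta> (\<alpha> x) = I.A.cmap n n' x) \<and> (\<forall>y\<in>car (B m). \<alpha>' (\<beta> y) = I.B.cmap m m' y)))" for s s'
  have step: "\<exists>s'. P s' \<and> R s s'" if s: "P s" for s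
  proof -
    obtain n m \<alpha> where s_eq: "s = (n, m, \<alpha>)" by (cases s)
    then have a: "alg_hom (A n) (B m) \<alpha>" "\<And>x. x \<in> car (A n) \<Longrightarrow> I.lifts m n x (\<alpha> x)" using s by (auto simp: P_def)
    obtain n' \<beta> where n': "n < n'" and b: "alg_hom (B m) (A n') \<beta>" "\<And>y. y \<in> car (B m) \<Longrightarrow> I.inv.lifts n' m y (\<beta> y)"
      "\<And>x. x \<in> car (A n) \<Longrightarrow> \<beta> (\<alpha> x) = I.A.cmap n n' x" using I.half_step[OF a] by blast
    obtain m' \<alpha>' where m': "m < m'" and a': "alg_hom (A n') (B m') \<alpha>'" "\<And>y. y \<in> car (A n') \<Longrightarrow> I.lifts m' n' y (\<alpha>' y)"
      "\<And>x. x \<in> car (B m) \<Longrightarrow> \<alpha>' (\<beta> x) = I.B.cmap m m' x" using J.half_step[OF b(1,2)] by blast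
    have "P (n', m', \<alpha>')" using a' by (simp add: P_def)
    moreover have "R s (n', m', \<alpha>')" using n' m' b a' unfolding R_def s_eq by auto
    ultimately show ?thesis by blast
  qed
  obtain m0 \<alpha>0 where "alg_hom (A 0) (B m0) \<alpha>0" "\<forall>x\<in>car (A 0). I.lifts m0 0 x (\<alpha>0 x)" using I.hom_lift by blast
  then have "P (0, m0, \<alpha>0)" by (simp add: P_def)
  then have "\<exists>f. \<forall>k. P (f k) \<and> R (f k) (f (Suc k))"
    using dependent_nat_choice[of "\<lambda>_. P" "\<lambda>_. R"] step by metis
  then obtain f where f: "\<And>k. P (f k)" "\<And>k. R (f k) (f (Suc k))" by blast
  define n m \<alpha> where "n k = fst (f k)" and "m k = fst (snd (f k))" and "\<alpha> k = snd (snd (f k))" for k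
  have fe: "f k = (n k, m k, \<alpha> k)" for k by (simp add: n_def m_def \<alpha>_def)
  have "\<forall>k. \<exists>\<beta>. alg_hom (B (m k)) (A (n (Suc k))) \<beta> \<and> (\<forall>x\<in>car (A (n k)). \<beta> (\<alpha> k x) = I.A.cmap (n k) (n (Suc k)) x) \<and>
     (\<forall>y\<in>car (B (m k)). \<alpha> (Suc k) (\<beta> y) = I.B.cmap (m k) (m (Suc k)) y)"
    using f(2) by (simp add: R_def fe)
  then obtain \<beta> where \<beta>: "\<And>k. alg_hom (B (m k)) (A (n (Suc k))) (\<beta> k)"
     "\<And>k x. x \<in> car (A (n k)) \<Longrightarrow> \<beta> k (\<alpha> k x) = I.A.cmap (n k) (n (Suc k)) x"
     "\<And>k y. y \<in> car (B (m k)) \<Longrightarrow> \<alpha> (Suc k) (\<beta> k y) = I.B.cmap (m k) (m (Suc k)) y" by metis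
  have "strict_mono n" "strict_mono m" using f(2) by (auto simp: strict_mono_Suc_iff R_def fe)
  moreover have "alg_hom (A (n k)) (B (m k)) (\<alpha> k)" for k using f(1)[of k] by (simp add: P_def fe)
  ultimately show ?thesis using \<beta> I.A.alg_car I.B.alg_car
    by (intro exI[of _ n] exI[of _ m] exI[of _ \<alpha>] exI[of _ \<beta>] conjI allI ballI) simp_all
qed

text \<open>A given map and its *-extension are compared on the subalgebras only, so the induction
  has to carry membership in these along.\<close>

lemma connecting_map_cong:
  assumes "\<And>k x. x \<in> alg (A k) \<Longrightarrow> \<phi> k x = \<Phi> k x \<and> \<Phi> k x \<in> alg (A (Suc k))" "x \<in> alg (A k)" "k \<le> l"
  shows "connecting_map \<phi> k l x = connecting_map \<Phi> k l x \<and> connecting_map \<Phi> k l x \<in> alg (A l)"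
  using assms(3)
proof (induction l rule: dec_induct)
  case base
  then show ?case using assms(2) by (simp add: connecting_map_refl)
next
  case (step l)
  then show ?case using assms(1) by (simp add: connecting_map_Suc)
qed

lemma Cstar_closed:
  "\<lbrakk>x \<in> Cstar A; y \<in> Cstar A\<rbrakk> \<Longrightarrow> cadd A x y \<in> Cstar A" "\<lbrakk>x \<in> Cstar A; y \<in> Cstar A\<rbrakk> \<Longrightarrow> cmult A x y \<in> Cstar A"
  "x \<in> Cstar A \<Longrightarrow> cscale A c x \<in> Cstar A" "x \<in> Cstar A \<Longrightarrow> cadj A x \<in> Cstar A" "a \<in> alg A \<Longrightarrow> a \<in> Cstar A"
  unfolding Cstar_def cstar_subalgebra_def by auto

lemma star_hom_inverse:
  assumes h: "star_hom A B h" and bij: "bij_betw h (Cstar A) (Cstar B)"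
  shows "star_hom B A (inv_into (Cstar A) h)"
proof -
  let ?g = "inv_into (Cstar A) h"
  have g: "?g y \<in> Cstar A" "h (?g y) = y" if "y \<in> Cstar B" for y
    using that bij by (auto simp: bij_betw_def inv_into_into f_inv_into_f)
  have u: "?g (h x) = x" if "x \<in> Cstar A" for x
    using that bij by (auto simp: bij_betw_def)
  show ?thesis
    unfolding star_hom_def
  proof (intro conjI ballI allI)
    fix x y assume xy: "x \<in> Cstar B" "y \<in> Cstar B"
    have "h (cadd A (?g x) (?g y)) = cadd B x y" "h (cmult A (?g x) (?g y)) = cmult B x y"
      using h g xy unfolding star_hom_def by auto
    then show "?g (cadd B x y) = cadd A (?g x) (?g y)" "?g (cmult B x y) = cmult A (?g x) (?g y)"
      using u g xy Cstar_closed by metis+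
  next
    fix c x assume x: "x \<in> Cstar B"
    have "h (cscale A c (?g x)) = cscale B c x" using h g x unfolding star_hom_def by auto
    then show "?g (cscale B c x) = cscale A c (?g x)" using u g x Cstar_closed by metis
  next
    fix x assume x: "x \<in> Cstar B"
    have "h (cadj A (?g x)) = cadj B x" using h g x unfolding star_hom_def by auto
    then show "?g (cadj B x) = cadj A (?g x)" using u g x Cstar_closed by metis
    show "?g x \<in> Cstar A" by (rule g(1)[OF x])
  qed
qed

text \<open>This separates the limit argument from the matrix computations. In \<open>triple\<close>
  the maps \<open>a\<close>, \<open>b\<close> and \<open>c\<close> are arbitrary homomorphisms and
  not members of \<open>F\<close>, because the intertwining maps are not known to lie in
  \<open>F\<close>.\<close>

theorem isoclassic_criterion:
  fixes F :: "'a family"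
  assumes F: "\<And>A B \<phi>. (A, B, \<phi>) \<in> F \<Longrightarrow> fd_cstar A \<and> fd_cstar B \<and> star_extendible A B \<phi>"
    and comp: "\<And>A B C \<phi> \<psi>. (A, B, \<phi>) \<in> F \<Longrightarrow> (B, C, \<psi>) \<in> F \<Longrightarrow> (A, C, \<psi> \<circ> \<phi>) \<in> F"
    and triple: "\<And>A B C D a b c \<chi> \<psi>. \<lbrakk>alg_hom A B a; alg_hom B C b; alg_hom C D c; (A, C, \<chi>) \<in> F; (B, D, \<psi>) \<in> F;
        \<And>x. x \<in> alg A \<Longrightarrow> b (a x) = \<chi> x; \<And>x. x \<in> alg B \<Longrightarrow> c (b x) = \<psi> x\<rbrakk> \<Longrightarrow> (A, D, \<lambda>x. c (b (a x))) \<in> F"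
  shows "isoclassic F"
  unfolding isoclassic_def
proof (intro allI impI, elim conjE)
  fix A \<phi> B \<psi> assume A: "direct_system F A \<phi>" and B: "direct_system F B \<psi>"
    and iso: "star_extendibly_isomorphic (alglim A \<phi>) (alglim B \<psi>)"
  \<comment> \<open>The given maps are exchanged for *-extensions. Threads that start in the
    subalgebras stay the same, and so does the limit.\<close>
  have ext: "\<exists>\<Phi>. fd_system A \<Phi> \<and> alglim A \<phi> = alglim A \<Phi> \<and> (\<forall>k x. x \<in> alg (A k) \<longrightarrow> \<phi> k x = \<Phi> k x \<and> \<Phi> k x \<in> alg (A (Suc k)))"
    if A: "direct_system F A \<phi>" for A \<phi>
  proof -
    have "\<forall>k. \<exists>\<Phi>. star_extension (A k) (A (Suc k)) (\<phi> k) \<Phi>"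
      using A F unfolding direct_system_def star_extendible_def by blast
    then obtain \<Phi> where \<Phi>: "\<And>k. star_extension (A k) (A (Suc k)) (\<phi> k) (\<Phi> k)" by metis
    then have ag: "\<And>k x. x \<in> alg (A k) \<Longrightarrow> \<phi> k x = \<Phi> k x \<and> \<Phi> k x \<in> alg (A (Suc k))"
      unfolding star_extension_def by simp
    have "fd_cstar (A k)" for k using A F unfolding direct_system_def by blast
    moreover have "alg_hom (A k) (A (Suc k)) (\<Phi> k)" for k
      using \<Phi>[of k] unfolding star_extension_def alg_hom_def by simp
    ultimately have "fd_system A \<Phi>" by (simp add: fd_system_def)
    moreover have "thread A \<phi> k a = thread A \<Phi> k a" if "a \<in> alg (A k)" for k a
      using connecting_map_cong[of A \<phi> \<Phi>, OF ag that] by (auto simp: thread_def)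
    then have "{seq_class A (thread A \<phi> k a) |k a. a \<in> alg (A k)} = {seq_class A (thread A \<Phi> k a) |k a. a \<in> alg (A k)}"
      by (intro Collect_cong ex_cong1) auto
    then have "alglim A \<phi> = alglim A \<Phi>" unfolding alglim_def by simp
    ultimately show ?thesis using ag by blast
  qed
  obtain \<Phi> where \<Phi>: "fd_system A \<Phi>" "alglim A \<phi> = alglim A \<Phi>" "\<And>k x. x \<in> alg (A k) \<Longrightarrow> \<phi> k x = \<Phi> k x \<and> \<Phi> k x \<in> alg (A (Suc k))"
    using ext[OF A] by blast
  obtain \<Psi> where \<Psi>: "fd_system B \<Psi>" "alglim B \<psi> = alglim B \<Psi>" "\<And>k x. x \<in> alg (B k) \<Longrightarrow> \<psi> k x = \<Psi> k x \<and> \<Psi> k x \<in> alg (B (Suc k))"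
    using ext[OF B] by blast
  interpret A: fd_system A \<Phi> by (rule \<Phi>(1))
  interpret B: fd_system B \<Psi> by (rule \<Psi>(1))
  obtain \<Theta> where \<Theta>: "star_hom A.L B.L \<Theta>" "bij_betw \<Theta> (Cstar A.L) (Cstar B.L)" "\<Theta> ` alg A.L = alg B.L"
    using iso unfolding star_extendibly_isomorphic_def \<Phi>(2) \<Psi>(2) by blast
  define \<Theta>' where "\<Theta>' = inv_into (Cstar A.L) \<Theta>"
  have \<Theta>': "star_hom B.L A.L \<Theta>'" unfolding \<Theta>'_def by (rule star_hom_inverse[OF \<Theta>(1,2)])
  have i1: "\<Theta>' (\<Theta> z) = z" if "z \<in> Cstar A.L" for z using that \<Theta>(2) by (simp add: \<Theta>'_def bij_betw_def)
  have i2: "\<Theta> (\<Theta>' z) = z" if "z \<in> Cstar B.L" for z using that \<Theta>(2) by (simp add: \<Theta>'_def bij_betw_def f_inv_into_f)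
  have al: "\<Theta>' z \<in> alg A.L" if "z \<in> alg B.L" for z
    using that i1 Cstar_closed(5) unfolding \<Theta>(3)[symmetric] by fastforce
  have "limit_hom A \<Phi> B \<Psi> \<Theta>" "limit_hom B \<Psi> A \<Phi> \<Theta>'"
    using \<Theta> \<Theta>' al by (auto simp: limit_hom_def limit_hom_axioms_def A.fd_system_axioms B.fd_system_axioms)
  then have "limit_iso A \<Phi> B \<Psi> \<Theta> \<Theta>'" "limit_iso B \<Psi> A \<Phi> \<Theta>' \<Theta>"
    using i1 i2 by (simp_all add: limit_iso_def limit_iso_axioms_def)
  from zigzag[OF this] obtain n m \<alpha> \<beta> where z: "strict_mono n" "strict_mono m"
     "\<And>k. alg_hom (A (n k)) (B (m k)) (\<alpha> k)" "\<And>k. alg_hom (B (m k)) (A (n (Suc k))) (\<beta> k)"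
     "\<And>k x. x \<in> alg (A (n k)) \<Longrightarrow> \<beta> k (\<alpha> k x) = A.cmap (n k) (n (Suc k)) x"
     "\<And>k y. y \<in> alg (B (m k)) \<Longrightarrow> \<alpha> (Suc k) (\<beta> k y) = B.cmap (m k) (m (Suc k)) y" by blast
  have cF: "(A k, A l, connecting_map \<phi> k l) \<in> F" if A: "direct_system F A \<phi>" and "k < l" for A \<phi> k l
    using that(2)
  proof (induction l)
    case 0 then show ?case by simp
  next
    case (Suc l)
    have l: "(A l, A (Suc l), \<phi> l) \<in> F" using A by (simp add: direct_system_def)
    show ?case
    proof (cases "k = l")
      case True
      then show ?thesis using l by (simp add: connecting_map_Suc connecting_map_refl)
    next
      case False
      then have kl: "k < l" using Suc.prems by simp
      show ?thesis unfolding connecting_map_Suc[OF less_imp_le[OF kl]] by (rule comp[OF Suc.IH[OF kl] l])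
    qed
  qed
  have nm: "n k < n (Suc k)" "m k < m (Suc k)" for k using z(1,2) by (simp_all add: strict_mono_Suc_iff)
  have cA: "connecting_map \<phi> k l x = A.cmap k l x" if "x \<in> alg (A k)" "k \<le> l" for k l x
    using connecting_map_cong[of A \<phi> \<Phi>, OF \<Phi>(3) that] by simp
  have cB: "connecting_map \<psi> k l x = B.cmap k l x" if "x \<in> alg (B k)" "k \<le> l" for k l x
    using connecting_map_cong[of B \<psi> \<Psi>, OF \<Psi>(3) that] by simp
  have a_alg: "\<alpha> k x \<in> alg (B (m k))" if "x \<in> alg (A (n k))" for k x using z(3)[of k] that by (simp add: alg_hom_def)
  have b_alg: "\<beta> k x \<in> alg (A (n (Suc k)))" if "x \<in> alg (B (m k))" for k x using z(4)[of k] that by (simp add: alg_hom_def)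
  have tA: "(A (n k), B (m (Suc k)), \<lambda>x. \<alpha> (Suc k) (\<beta> k (\<alpha> k x))) \<in> F" for k
    by (rule triple[OF z(3) z(4) z(3) cF[OF A nm(1)] cF[OF B nm(2)]])
      (use z(5,6) cA cB nm[of k] in \<open>auto simp: less_imp_le\<close>)
  have tB: "(B (m k), A (n (Suc (Suc k))), \<lambda>x. \<beta> (Suc k) (\<alpha> (Suc k) (\<beta> k x))) \<in> F" for k
    by (rule triple[OF z(4) z(3) z(4) cF[OF B nm(2)] cF[OF A nm(1)]])
      (use z(5,6) cA cB nm[of k] nm[of "Suc k"] in \<open>auto simp: less_imp_le\<close>)
  \<comment> \<open>The intertwining maps, taken in order, are cut into consecutive groups of three.
    Groups starting in the first and in the second system alternate, and two groups advance the
    index by three.\<close>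
  define \<alpha>' where "\<alpha>' k x = \<alpha> (Suc (3 * k)) (\<beta> (3 * k) (\<alpha> (3 * k) x))" for k x
  define \<beta>' where "\<beta>' k x = \<beta> (Suc (Suc (3 * k))) (\<alpha> (Suc (Suc (3 * k))) (\<beta> (Suc (3 * k)) x))" for k x
  have n3: "3 * Suc k = Suc (Suc (Suc (3 * k)))" for k by simp
  have le: "n j \<le> n k" "m j \<le> m k" if "j \<le> k" for j k
    using z(1,2) that by (simp_all add: strict_mono_less_eq)
  have A3: "\<beta> (Suc (Suc k)) (\<alpha> (Suc (Suc k)) (\<beta> (Suc k) (\<alpha> (Suc k) (\<beta> k (\<alpha> k x))))) = connecting_map \<phi> (n k) (n (Suc (Suc (Suc k)))) x"
    if x: "x \<in> alg (A (n k))" for k x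
    using x a_alg b_alg le by (simp add: z(5) A.cmap_alg connecting_map_comp cA)
  have B3: "\<alpha> (Suc (Suc (Suc k))) (\<beta> (Suc (Suc k)) (\<alpha> (Suc (Suc k)) (\<beta> (Suc k) (\<alpha> (Suc k) (\<beta> k x))))) = connecting_map \<psi> (m k) (m (Suc (Suc (Suc k)))) x"
    if x: "x \<in> alg (B (m k))" for k x
    using x a_alg b_alg le by (simp add: z(6) B.cmap_alg connecting_map_comp cB)
  show "Sys_isomorphic F A \<phi> B \<psi>"
    unfolding Sys_isomorphic_def
  proof (rule exI[of _ "\<lambda>k. n (3 * k)"], rule exI[of _ "\<lambda>k. m (Suc (3 * k))"],
      rule exI[of _ \<alpha>'], rule exI[of _ \<beta>'], intro conjI allI ballI)
    show "strict_mono (\<lambda>k. n (3 * k))" "strict_mono (\<lambda>k. m (Suc (3 * k)))"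
      using z(1,2) by (auto simp: strict_mono_def)
    show "(A (n (3 * k)), B (m (Suc (3 * k))), \<alpha>' k) \<in> F" for k
      unfolding \<alpha>'_def by (rule tA)
    show "(B (m (Suc (3 * k))), A (n (3 * Suc k)), \<beta>' k) \<in> F" for k
      unfolding \<beta>'_def n3 by (rule tB)
    show "\<beta>' k (\<alpha>' k a) = connecting_map \<phi> (n (3 * k)) (n (3 * Suc k)) a" if "a \<in> alg (A (n (3 * k)))" for k a
      unfolding \<alpha>'_def \<beta>'_def n3 by (rule A3[OF that])
    show "\<alpha>' (Suc k) (\<beta>' k b) = connecting_map \<psi> (m (Suc (3 * k))) (m (Suc (3 * Suc k))) b" if "b \<in> alg (B (m (Suc (3 * k))))" for k b
      unfolding \<alpha>'_def \<beta>'_def n3 by (rule B3[OF that])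
  qed
qed

section \<open>The matrix algebras and their direct sums\<close>

subsection \<open>The operator norm\<close>

lemma mat_adjoint_index:
  "a \<in> carrier_mat N N \<Longrightarrow> i < N \<Longrightarrow> j < N \<Longrightarrow> mat_adjoint a $$ (i, j) = cnj (a $$ (j, i))"
  by (auto simp: mat_adjoint_def mat_of_rows_def)

lemma mat_adjoint_carrier[simp, intro]: "a \<in> carrier_mat N N \<Longrightarrow> mat_adjoint a \<in> carrier_mat N N"
  by (auto simp: mat_adjoint_def mat_of_rows_def)

definition vnorm :: "complex vec \<Rightarrow> real" where "vnorm v = sqrt (Re (v \<bullet>c v))"

lemma cscalar_self: "v \<bullet>c v = of_real (\<Sum>i<dim_vec v. (cmod (v $ i))\<^sup>2)"
  unfolding scalar_prod_def
  by (auto simp: atLeast0LessThan complex_norm_square simp del: of_real_power intro!: sum.cong)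

lemma vnorm_L2: "vnorm v = L2_set (\<lambda>i. cmod (v $ i)) {..<dim_vec v}"
  by (simp add: vnorm_def cscalar_self L2_set_def)

lemma vnorm_nonneg[simp]: "vnorm v \<ge> 0" by (simp add: vnorm_L2)

lemma vnorm_sq: "of_real ((vnorm v)\<^sup>2) = v \<bullet>c v"
  by (simp add: vnorm_def cscalar_self sum_nonneg del: of_real_sum of_real_power)

lemma vnorm_triangle: "v \<in> carrier_vec N \<Longrightarrow> w \<in> carrier_vec N \<Longrightarrow> vnorm (v + w) \<le> vnorm v + vnorm w"
proof -
  assume v: "v \<in> carrier_vec N" and w: "w \<in> carrier_vec N"
  have "vnorm (v + w) \<le> L2_set (\<lambda>i. cmod (v $ i) + cmod (w $ i)) {..<N}"
    unfolding vnorm_L2 using v w by (auto intro!: L2_set_mono norm_triangle_ineq)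
  also have "\<dots> \<le> vnorm v + vnorm w" unfolding vnorm_L2 using v w L2_set_triangle_ineq by auto
  finally show ?thesis .
qed

lemma vnorm_smult: "vnorm (c \<cdot>\<^sub>v v) = cmod c * vnorm v"
  by (simp add: vnorm_L2 L2_set_right_distrib norm_mult cong: L2_set_cong_simp)

lemma vnorm_eq_0: "v \<in> carrier_vec N \<Longrightarrow> vnorm v = 0 \<Longrightarrow> v = 0\<^sub>v N"
  by (auto simp: vnorm_L2 L2_set_eq_0_iff intro!: eq_vecI)

lemma cauchy_schwarz: assumes "v \<in> carrier_vec N" "w \<in> carrier_vec N" shows "cmod (v \<bullet>c w) \<le> vnorm v * vnorm w"
proof -
  have "cmod (v \<bullet>c w) \<le> (\<Sum>i<N. \<bar>cmod (v $ i)\<bar> * \<bar>cmod (w $ i)\<bar>)"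
    using assms unfolding scalar_prod_def
    by (auto simp: atLeast0LessThan norm_mult intro!: order_trans[OF norm_sum] sum_mono)
  also have "\<dots> \<le> L2_set (\<lambda>i. cmod (v $ i)) {..<N} * L2_set (\<lambda>i. cmod (w $ i)) {..<N}" by (rule L2_set_mult_ineq)
  also have "\<dots> = vnorm v * vnorm w" using assms unfolding vnorm_L2 by auto
  finally show ?thesis .
qed

lemma adjoint_cscalar:
  fixes a :: "complex mat"
  assumes "a \<in> carrier_mat N N" "v \<in> carrier_vec N" "w \<in> carrier_vec N"
  shows "(a *\<^sub>v v) \<bullet>c w = v \<bullet>c (mat_adjoint a *\<^sub>v w)"
proof -
  have "(a *\<^sub>v v) \<bullet>c w = (\<Sum>i<N. \<Sum>j<N. a $$ (i, j) * v $ j * cnj (w $ i))"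
    using assms by (auto simp: scalar_prod_def atLeast0LessThan sum_distrib_right intro!: sum.cong)
  also have "\<dots> = (\<Sum>j<N. \<Sum>i<N. a $$ (i, j) * v $ j * cnj (w $ i))" by (rule sum.swap)
  also have "\<dots> = v \<bullet>c (mat_adjoint a *\<^sub>v w)"
    using assms by (auto simp: scalar_prod_def atLeast0LessThan sum_distrib_left mat_adjoint_index[OF assms(1)]
      carrier_matD[OF mat_adjoint_carrier[OF assms(1)]] mult_ac intro!: sum.cong)
  finally show ?thesis .
qed

lemma op_norm_alt: "op_norm a = (SUP v\<in>{v \<in> carrier_vec (dim_col a). vnorm v \<le> 1}. vnorm (a *\<^sub>v v))"
proof -
  have "Re (v \<bullet>c v) \<le> 1 \<longleftrightarrow> vnorm v \<le> 1" for v :: "complex vec" by (simp add: vnorm_def)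
  then show ?thesis by (simp add: op_norm_def vnorm_def)
qed

text \<open>A crude bound, good enough to make the supremum in \<open>op_norm\<close> one over a
  bounded set.\<close>

lemma mat_vec_bounded: assumes "a \<in> carrier_mat N N"
  shows "\<exists>C. \<forall>v\<in>carrier_vec N. vnorm (a *\<^sub>v v) \<le> C * vnorm v"
proof -
  have "vnorm (a *\<^sub>v v) \<le> (\<Sum>i<N. \<Sum>j<N. cmod (a $$ (i, j))) * vnorm v" if v: "v \<in> carrier_vec N" for v
  proof -
    have "vnorm (a *\<^sub>v v) \<le> (\<Sum>i<N. cmod ((a *\<^sub>v v) $ i))"
      unfolding vnorm_L2 using assms by (intro order_trans[OF L2_set_le_sum]) auto
    also have "\<dots> \<le> (\<Sum>i<N. \<Sum>j<N. cmod (a $$ (i, j)) * vnorm v)"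
    proof (rule sum_mono)
      fix i assume "i \<in> {..<N}"
      then have "cmod ((a *\<^sub>v v) $ i) \<le> (\<Sum>j<N. cmod (a $$ (i, j) * v $ j))"
        using assms v by (auto simp: scalar_prod_def atLeast0LessThan intro!: order_trans[OF norm_sum] sum_mono)
      also have "\<dots> \<le> (\<Sum>j<N. cmod (a $$ (i, j)) * vnorm v)"
      proof (rule sum_mono)
        fix j assume "j \<in> {..<N}"
        then have "cmod (v $ j) \<le> vnorm v" unfolding vnorm_L2 using v member_le_L2_set[of "{..<N}" j "\<lambda>i. cmod (v $ i)"] by auto
        then show "cmod (a $$ (i, j) * v $ j) \<le> cmod (a $$ (i, j)) * vnorm v" by (simp add: norm_mult mult_left_mono)
      qed
      finally show "cmod ((a *\<^sub>v v) $ i) \<le> (\<Sum>j<N. cmod (a $$ (i, j)) * vnorm v)" .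
    qed
    finally show ?thesis by (simp add: sum_distrib_right)
  qed
  then show ?thesis by blast
qed

lemma op_norm_bdd: assumes "a \<in> carrier_mat N N"
  shows "bdd_above ((\<lambda>v. vnorm (a *\<^sub>v v)) ` {v \<in> carrier_vec N. vnorm v \<le> 1})"
proof -
  obtain C where C: "\<And>v. v \<in> carrier_vec N \<Longrightarrow> vnorm (a *\<^sub>v v) \<le> C * vnorm v" using mat_vec_bounded[OF assms] by blast
  have "vnorm (a *\<^sub>v v) \<le> max 0 C" if "v \<in> carrier_vec N" "vnorm v \<le> 1" for v
  proof -
    have "vnorm (a *\<^sub>v v) \<le> max 0 C * vnorm v"
      using C[OF that(1)] by (rule order_trans) (simp add: mult_right_mono)
    also have "\<dots> \<le> max 0 C * 1" using that by (intro mult_left_mono) auto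
    finally show ?thesis by simp
  qed
  then show ?thesis by (intro bdd_aboveI2[of _ _ "max 0 C"]) auto
qed

lemma op_norm_ge: assumes a: "a \<in> carrier_mat N N" and v: "v \<in> carrier_vec N"
  shows "vnorm (a *\<^sub>v v) \<le> op_norm a * vnorm v"
proof (cases "vnorm v = 0")
  case True
  then have "v = 0\<^sub>v N" using vnorm_eq_0 v by auto
  then have "a *\<^sub>v v = 0\<^sub>v N" using a by auto
  moreover have "vnorm (0\<^sub>v N) = 0" by (simp add: vnorm_L2 L2_set_eq_0_iff)
  ultimately show ?thesis using True by simp
next
  case False
  then have pos: "vnorm v > 0" using vnorm_nonneg[of v] by linarith
  define w where "w = complex_of_real (1 / vnorm v) \<cdot>\<^sub>v v"
  have w: "w \<in> carrier_vec N" "vnorm w \<le> 1" using v pos by (auto simp: w_def vnorm_smult norm_divide)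
  have "vnorm (a *\<^sub>v w) \<le> op_norm a"
    unfolding op_norm_alt using a w op_norm_bdd[OF a] by (intro cSUP_upper) auto
  moreover have "a *\<^sub>v w = complex_of_real (1 / vnorm v) \<cdot>\<^sub>v (a *\<^sub>v v)"
    unfolding w_def using a v by (auto intro!: mult_mat_vec)
  ultimately show ?thesis using pos by (simp add: vnorm_smult norm_divide divide_le_eq)
qed

lemma op_norm_le: assumes a: "a \<in> carrier_mat N N" and C: "C \<ge> 0" "\<And>v. v \<in> carrier_vec N \<Longrightarrow> vnorm (a *\<^sub>v v) \<le> C * vnorm v"
  shows "op_norm a \<le> C"
  unfolding op_norm_alt
proof (rule cSUP_least)
  have "0\<^sub>v N \<in> {v \<in> carrier_vec (dim_col a). vnorm v \<le> 1}" using a by (simp add: vnorm_L2 L2_set_def)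
  then show "{v \<in> carrier_vec (dim_col a). vnorm v \<le> 1} \<noteq> {}" by blast
  fix v assume "v \<in> {v \<in> carrier_vec (dim_col a). vnorm v \<le> 1}"
  then have v: "v \<in> carrier_vec N" "vnorm v \<le> 1" using a by auto
  have "vnorm (a *\<^sub>v v) \<le> C * vnorm v" by (rule C(2)[OF v(1)])
  also have "\<dots> \<le> C * 1" using v C by (intro mult_left_mono) auto
  finally show "vnorm (a *\<^sub>v v) \<le> C" by simp
qed

lemma op_norm_nonneg: assumes a: "a \<in> carrier_mat N N" shows "op_norm a \<ge> 0"
proof -
  have "vnorm (a *\<^sub>v 0\<^sub>v N) \<le> op_norm a"
    unfolding op_norm_alt using a op_norm_bdd[OF a] by (intro cSUP_upper) (auto simp: vnorm_L2 L2_set_def)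
  then show ?thesis using vnorm_nonneg order_trans by blast
qed

lemma op_norm_add: assumes "a \<in> carrier_mat N N" "b \<in> carrier_mat N N"
  shows "op_norm (a + b) \<le> op_norm a + op_norm b"
proof (rule op_norm_le[of _ N])
  fix v :: "complex vec" assume v: "v \<in> carrier_vec N"
  have "(a + b) *\<^sub>v v = a *\<^sub>v v + b *\<^sub>v v" using assms v by (simp add: add_mult_distrib_mat_vec[of _ N N])
  then have "vnorm ((a + b) *\<^sub>v v) \<le> vnorm (a *\<^sub>v v) + vnorm (b *\<^sub>v v)"
    using vnorm_triangle[OF mult_mat_vec_carrier[OF assms(1) v] mult_mat_vec_carrier[OF assms(2) v]] by simp
  also have "\<dots> \<le> op_norm a * vnorm v + op_norm b * vnorm v" using assms v by (intro add_mono op_norm_ge)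
  finally show "vnorm ((a + b) *\<^sub>v v) \<le> (op_norm a + op_norm b) * vnorm v" by (simp add: distrib_right)
qed (use assms op_norm_nonneg in auto)

lemma op_norm_mult: assumes "a \<in> carrier_mat N N" "b \<in> carrier_mat N N"
  shows "op_norm (a * b) \<le> op_norm a * op_norm b"
proof (rule op_norm_le[of _ N])
  fix v :: "complex vec" assume v: "v \<in> carrier_vec N"
  have "(a * b) *\<^sub>v v = a *\<^sub>v (b *\<^sub>v v)" using assms v by simp
  also have "vnorm \<dots> \<le> op_norm a * vnorm (b *\<^sub>v v)" using assms v by (intro op_norm_ge) auto
  also have "\<dots> \<le> op_norm a * (op_norm b * vnorm v)" using assms v by (intro mult_left_mono op_norm_ge op_norm_nonneg)
  finally show "vnorm ((a * b) *\<^sub>v v) \<le> op_norm a * op_norm b * vnorm v" by (simp add: mult.assoc)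
qed (use assms op_norm_nonneg in auto)

lemma op_norm_smult_le: assumes "a \<in> carrier_mat N N" shows "op_norm (c \<cdot>\<^sub>m a) \<le> cmod c * op_norm a"
proof (rule op_norm_le[of _ N])
  fix v :: "complex vec" assume v: "v \<in> carrier_vec N"
  have "(c \<cdot>\<^sub>m a) *\<^sub>v v = c \<cdot>\<^sub>v (a *\<^sub>v v)" using assms v by (auto intro!: eq_vecI)
  then show "vnorm ((c \<cdot>\<^sub>m a) *\<^sub>v v) \<le> cmod c * op_norm a * vnorm v"
    using op_norm_ge[OF assms v] by (simp add: vnorm_smult mult_left_mono mult.assoc)
qed (use assms op_norm_nonneg in auto)

lemma op_norm_smult: assumes "a \<in> carrier_mat N N" shows "op_norm (c \<cdot>\<^sub>m a) = cmod c * op_norm a"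
proof (cases "c = 0")
  case True
  have "op_norm (0 \<cdot>\<^sub>m a) \<ge> 0" by (rule op_norm_nonneg) (use assms in auto)
  then show ?thesis using op_norm_smult_le[OF assms, of 0] True by simp
next
  case False
  have "(1 / c) \<cdot>\<^sub>m (c \<cdot>\<^sub>m a) = a" using False by (auto intro!: eq_matI)
  then have "op_norm a \<le> cmod (1 / c) * op_norm (c \<cdot>\<^sub>m a)"
    using op_norm_smult_le[of "c \<cdot>\<^sub>m a" N "1 / c"] assms by auto
  then show ?thesis using op_norm_smult_le[OF assms, of c] False by (simp add: norm_divide field_simps)
qed

text \<open>The left side is the inner product of \<open>v\<close> with the second vector on the
  right, so this is the Cauchy-Schwarz inequality.\<close>

lemma vnorm_sq_le: assumes a: "a \<in> carrier_mat N N" and v: "v \<in> carrier_vec N" 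
  shows "(vnorm (a *\<^sub>v v))\<^sup>2 \<le> vnorm v * vnorm (mat_adjoint a *\<^sub>v (a *\<^sub>v v))"
proof -
  have "complex_of_real ((vnorm (a *\<^sub>v v))\<^sup>2) = v \<bullet>c (mat_adjoint a *\<^sub>v (a *\<^sub>v v))"
    unfolding vnorm_sq by (rule adjoint_cscalar) (use a v in auto)
  then have "(vnorm (a *\<^sub>v v))\<^sup>2 = cmod (v \<bullet>c (mat_adjoint a *\<^sub>v (a *\<^sub>v v)))"
    by (metis norm_of_real abs_of_nonneg zero_le_power2)
  also have "\<dots> \<le> vnorm v * vnorm (mat_adjoint a *\<^sub>v (a *\<^sub>v v))"
    using a v by (intro cauchy_schwarz[of _ N] mult_mat_vec_carrier[of _ N N] mat_adjoint_carrier)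
  finally show ?thesis .
qed

lemma op_norm_cstar: assumes a: "a \<in> carrier_mat N N" shows "(op_norm a)\<^sup>2 \<le> op_norm (mat_adjoint a * a)"
proof -
  have aa: "mat_adjoint a * a \<in> carrier_mat N N" using a by (intro mult_carrier_mat[of _ N N] mat_adjoint_carrier)
  have "op_norm a \<le> sqrt (op_norm (mat_adjoint a * a))"
  proof (rule op_norm_le[OF a])
    fix v :: "complex vec" assume v: "v \<in> carrier_vec N"
    have "(vnorm (a *\<^sub>v v))\<^sup>2 \<le> vnorm v * vnorm ((mat_adjoint a * a) *\<^sub>v v)"
      using vnorm_sq_le[OF a v] a v assoc_mult_mat_vec[of "mat_adjoint a" N N a N v] by simp
    also have "\<dots> \<le> vnorm v * (op_norm (mat_adjoint a * a) * vnorm v)"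
      by (intro mult_left_mono op_norm_ge[OF aa v]) auto
    finally have "vnorm (a *\<^sub>v v) \<le> sqrt (vnorm v * (op_norm (mat_adjoint a * a) * vnorm v))"
      by (rule real_le_rsqrt)
    moreover have "vnorm v * (c * vnorm v) = c * (vnorm v)\<^sup>2" for c by (simp add: power2_eq_square)
    ultimately show "vnorm (a *\<^sub>v v) \<le> sqrt (op_norm (mat_adjoint a * a)) * vnorm v"
      by (simp add: real_sqrt_mult)
  qed (simp add: op_norm_nonneg[OF aa])
  then have "(op_norm a)\<^sup>2 \<le> (sqrt (op_norm (mat_adjoint a * a)))\<^sup>2"
    by (rule power_mono) (rule op_norm_nonneg[OF a])
  then show ?thesis using op_norm_nonneg[OF aa] by simp
qed

lemma mat_adjoint_adjoint: "a \<in> carrier_mat N N \<Longrightarrow> mat_adjoint (mat_adjoint a) = (a :: complex mat)"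
proof -
  assume a: "a \<in> carrier_mat N N"
  note c = mat_adjoint_carrier[OF a]
  note cc = mat_adjoint_carrier[OF c]
  show ?thesis
    by (rule eq_matI) (use carrier_matD[OF a] carrier_matD[OF cc] in \<open>simp_all add: mat_adjoint_index[OF c] mat_adjoint_index[OF a]\<close>)
qed

text \<open>By the C*-inequality and submultiplicativity the square of the norm of \<open>a\<close>
  is at most the product of both norms; one factor cancels.\<close>

lemma op_norm_adj_le: assumes a: "a \<in> carrier_mat N N" shows "op_norm (mat_adjoint a) \<ge> op_norm a"
proof (cases "op_norm a = 0")
  case False
  then have pos: "op_norm a > 0" using op_norm_nonneg[OF a] by simp
  have "op_norm a * op_norm a \<le> op_norm (mat_adjoint a) * op_norm a"
    using op_norm_cstar[OF a] op_norm_mult[of "mat_adjoint a" N a] a by (simp add: power2_eq_square)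
  then show ?thesis using pos by simp
qed (use op_norm_nonneg[OF mat_adjoint_carrier[OF a]] in simp)

lemma op_norm_adj: assumes a: "a \<in> carrier_mat N N" shows "op_norm (mat_adjoint a) = op_norm a"
  using op_norm_adj_le[OF a] op_norm_adj_le[OF mat_adjoint_carrier[OF a]] mat_adjoint_adjoint[OF a] by simp

lemma op_norm_zeroD: assumes a: "a \<in> carrier_mat N N" and z: "op_norm a = 0" shows "a = 0\<^sub>m N N"
proof (rule eq_matI)
  fix i j assume "i < dim_row (0\<^sub>m N N :: complex mat)" "j < dim_col (0\<^sub>m N N :: complex mat)"
  then have ij: "i < N" "j < N" by auto
  have "vnorm (a *\<^sub>v unit_vec N j) \<le> 0" using op_norm_ge[OF a, of "unit_vec N j"] z by simp
  then have "a *\<^sub>v unit_vec N j = 0\<^sub>v N" using vnorm_nonneg a by (intro vnorm_eq_0) (auto intro: antisym)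
  then have "(a *\<^sub>v unit_vec N j) $ i = 0" using ij by simp
  then have "a $$ (i, j) = 0" using a ij by (simp add: scalar_prod_right_unit)
  then show "a $$ (i, j) = 0\<^sub>m N N $$ (i, j)" using a ij by simp
qed (use a in auto)

section \<open>Passage between matrices and finitely supported matrices\<close>

definition emb :: "nat \<Rightarrow> complex mat \<Rightarrow> fmat" where
  "emb N a = mx_of N (\<lambda>i j. a $$ (i, j))"

definition cmat :: "nat \<Rightarrow> fmat \<Rightarrow> complex mat" where
  "cmat N x = mat N N (\<lambda>(i, j). entry x i j)"

lemma entry_emb: "entry (emb N a) i j = (if i < N \<and> j < N then a $$ (i, j) else 0)"
  by (simp add: emb_def entry_mx_of)

lemma emb_mx[simp, intro]: "emb N a \<in> mx N N" by (auto simp: emb_def)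

lemma cmat_carrier[simp, intro]: "cmat N x \<in> carrier_mat N N" by (simp add: cmat_def)

lemma cmat_dim[simp]: "dim_row (cmat N x) = N" "dim_col (cmat N x) = N" by (simp_all add: cmat_def)

lemma cmat_index[simp]: "i < N \<Longrightarrow> j < N \<Longrightarrow> cmat N x $$ (i, j) = entry x i j" by (simp add: cmat_def)

lemma cmat_emb: "a \<in> carrier_mat N N \<Longrightarrow> cmat N (emb N a) = a"
  by (auto intro!: eq_matI simp: cmat_def entry_emb)

lemma emb_cmat: "x \<in> mx N N \<Longrightarrow> emb N (cmat N x) = x"
  by (rule fmat_eqI) (use mx_zero[of x N N] in \<open>auto simp: entry_emb not_less\<close>)

text \<open>Equations between matrices are proved by applying \<open>emb\<close> and computing in
  the ring \<open>fmat\<close>.\<close>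

lemma emb_inj: "a \<in> carrier_mat N N \<Longrightarrow> b \<in> carrier_mat N N \<Longrightarrow> emb N a = emb N b \<Longrightarrow> a = b"
  by (metis cmat_emb)

lemma emb_add: "a \<in> carrier_mat N N \<Longrightarrow> b \<in> carrier_mat N N \<Longrightarrow> emb N (a + b) = emb N a + emb N b"
  by (auto intro!: fmat_eqI simp: entry_emb)

lemma emb_mult: "a \<in> carrier_mat N N \<Longrightarrow> b \<in> carrier_mat N N \<Longrightarrow> emb N (a * b) = emb N a * emb N b"
  by (rule fmat_eqI, subst entry_mult_mx[of _ N N _ N])
    (auto simp: entry_emb scalar_prod_def atLeast0LessThan)

lemma emb_smult: "a \<in> carrier_mat N N \<Longrightarrow> emb N (c \<cdot>\<^sub>m a) = scl c (emb N a)"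
  by (auto intro!: fmat_eqI simp: entry_emb)

lemma emb_adj: "a \<in> carrier_mat N N \<Longrightarrow> emb N (mat_adjoint a) = adj (emb N a)"
  by (auto intro!: fmat_eqI simp: entry_emb mat_adjoint_index)

lemma emb_zero: "emb N (0\<^sub>m N N) = 0"
  by (auto intro!: fmat_eqI simp: entry_emb)

lemma emb_one: "emb N (1\<^sub>m N) = idm N"
  by (auto intro!: fmat_eqI simp: entry_emb)

lemma cmat_add: "cmat N (x + y) = cmat N x + cmat N y" by (auto intro!: eq_matI simp: cmat_def)
lemma cmat_scl: "cmat N (scl c x) = c \<cdot>\<^sub>m cmat N x" by (auto intro!: eq_matI simp: cmat_def)
lemma cmat_zero: "cmat N 0 = 0\<^sub>m N N" by (auto intro!: eq_matI simp: cmat_def)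

section \<open>Block upper triangular matrix algebras\<close>

lemma T3_simps[simp]:
  "car (T3_alg n) = carrier_mat (3 * n) (3 * n)" "cadd (T3_alg n) = (+)" "czero (T3_alg n) = 0\<^sub>m (3 * n) (3 * n)"
  "cmult (T3_alg n) = (*)" "cscale (T3_alg n) = (\<cdot>\<^sub>m)" "cadj (T3_alg n) = mat_adjoint" "cnorm (T3_alg n) = op_norm"
  by (simp_all add: T3_alg_def)

lemma T3_alg_iff: "a \<in> alg (T3_alg n) \<longleftrightarrow> a \<in> carrier_mat (3 * n) (3 * n) \<and> emb (3 * n) a \<in> tri n"
  by (auto simp: T3_alg_def tri_def entry_emb)

lemma E_N: "s < N \<Longrightarrow> t < N \<Longrightarrow> E s t \<in> mx N N" by auto

text \<open>The corner of \<open>x\<close> at \<open>E s t\<close> is its entry at that position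
  times \<open>E s s\<close>. A unit occurring in a triangular matrix sits at a position of the
  triangular part, and hence is itself triangular.\<close>

lemma T3_unit_system:
  assumes "n > 0"
  shows "unit_system (T3_alg n) ((\<lambda>(s, t). cmat (3 * n) (E s t)) ` ({..<3 * n} \<times> {..<3 * n}))"
    (is "unit_system ?A ?U")
proof -
  define N where "N = 3 * n"
  have rp: "range_proj ?A (cmat N (E s t)) = cmat N (E s s)" if "s < N" "t < N" for s t
  proof (rule emb_inj[of _ N])
    show "emb N (range_proj ?A (cmat N (E s t))) = emb N (cmat N (E s s))"
      using that by (simp add: range_proj_def emb_mult emb_adj emb_cmat E_N E_mult)
  qed (auto simp: range_proj_def intro!: mult_carrier_mat[of _ N N])
  have co: "corner ?A (cmat N (E s t)) x = x $$ (s, t) \<cdot>\<^sub>m cmat N (E s s)" if st: "s < N" "t < N" and x: "x \<in> carrier_mat N N" for s t x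
  proof (rule emb_inj[of _ N])
    have ax: "cmat N (E s s) * x \<in> carrier_mat N N" using x by (intro mult_carrier_mat[of _ N N]) auto
    show "corner ?A (cmat N (E s t)) x \<in> carrier_mat N N"
      unfolding corner_def rp[OF st] using ax by (auto intro!: mult_carrier_mat[of _ N N])
    show "emb N (corner ?A (cmat N (E s t)) x) = emb N (x $$ (s, t) \<cdot>\<^sub>m cmat N (E s s))"
      unfolding corner_def rp[OF st] using st x ax
      by (simp add: emb_mult emb_adj emb_smult emb_cmat E_N E_sandwich entry_emb)
  qed auto
  have nz: "cmat N (E s s) \<noteq> 0\<^sub>m N N" if "s < N" for s
  proof
    assume "cmat N (E s s) = 0\<^sub>m N N"
    then have "cmat N (E s s) $$ (s, s) = 0\<^sub>m N N $$ (s, s)" by simp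
    then show False using that by simp
  qed
  have co0: "corner ?A (cmat N (E s t)) x \<noteq> 0\<^sub>m N N" if "s < N" "t < N" "x \<in> carrier_mat N N" "x $$ (s, t) \<noteq> 0" for s t x
  proof
    assume "corner ?A (cmat N (E s t)) x = 0\<^sub>m N N"
    then have "(x $$ (s, t) \<cdot>\<^sub>m cmat N (E s s)) $$ (s, s) = 0\<^sub>m N N $$ (s, s)" using co[OF that(1-3)] by simp
    then show False using that by simp
  qed
  show ?thesis unfolding unit_system_def N_def[symmetric]
  proof (intro conjI ballI allI impI)
    show "finite ((\<lambda>(s, t). cmat N (E s t)) ` ({..<N} \<times> {..<N}))" by simp
    show "(\<lambda>(s, t). cmat N (E s t)) ` ({..<N} \<times> {..<N}) \<subseteq> car ?A" by (auto simp: N_def[symmetric])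
  next
    fix e assume "e \<in> (\<lambda>(s, t). cmat N (E s t)) ` ({..<N} \<times> {..<N})"
    then obtain s t where e: "e = cmat N (E s t)" and st: "s < N" "t < N" by auto
    show "cmult ?A (range_proj ?A e) (range_proj ?A e) = range_proj ?A e"
      unfolding e rp[OF st] using st
      by (intro emb_inj[of _ N]) (auto simp: emb_mult emb_cmat E_N E_mult intro!: mult_carrier_mat[of _ N N])
    show "cmult ?A (range_proj ?A e) e = e"
      unfolding e rp[OF st] using st
      by (intro emb_inj[of _ N]) (auto simp: emb_mult emb_cmat E_N E_mult intro!: mult_carrier_mat[of _ N N])
    show "\<exists>c. corner ?A e x = cscale ?A c (range_proj ?A e)" if "x \<in> car ?A" for x
      unfolding e rp[OF st] using co[OF st, of x] that by (auto simp: N_def[symmetric])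
    show "e \<in> alg ?A" if x: "x \<in> alg ?A" "corner ?A e x \<noteq> czero ?A" for x
    proof -
      have xN: "x \<in> carrier_mat N N" using x(1) by (simp add: T3_alg_iff N_def)
      have "x $$ (s, t) \<noteq> 0"
      proof
        assume "x $$ (s, t) = 0"
        then have "corner ?A e x = 0\<^sub>m N N" unfolding e co[OF st xN] by (auto intro!: eq_matI)
        then show False using x(2) by (simp add: N_def)
      qed
      then have "s div n \<le> t div n" using x(1) st by (auto simp: T3_alg_def N_def not_less[symmetric])
      then show ?thesis unfolding e T3_alg_iff N_def[symmetric] using st assms
        by (simp add: emb_cmat E_N E_tri N_def)
    qed
  next
    fix x D assume x: "x \<in> car ?A" and D: "closed_span ?A D"
      and U: "\<forall>e\<in>(\<lambda>(s, t). cmat N (E s t)) ` ({..<N} \<times> {..<N}). corner ?A e x \<noteq> czero ?A \<longrightarrow> e \<in> D"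
    have xN: "x \<in> carrier_mat N N" using x by (simp add: N_def)
    have sum_D: "cmat N (sum f A) \<in> D" if "\<And>a. a \<in> A \<Longrightarrow> cmat N (f a) \<in> D" for f and A :: "nat set"
      using that
    proof (induction A rule: infinite_finite_induct)
      case (insert a A)
      then show ?case using D by (simp add: cmat_add closed_span_def)
    qed (use D in \<open>simp_all add: cmat_zero closed_span_def N_def[symmetric]\<close>)
    have "cmat N (\<Sum>s<N. \<Sum>t<N. scl (entry (emb N x) s t) (E s t)) \<in> D"
    proof (intro sum_D)
      fix s t assume st: "s \<in> {..<N}" "t \<in> {..<N}"
      show "cmat N (scl (entry (emb N x) s t) (E s t)) \<in> D"
      proof (cases "x $$ (s, t) = 0")
        case True
        then have "cmat N (scl (entry (emb N x) s t) (E s t)) = 0\<^sub>m N N"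
          using st by (simp add: entry_emb scl_simps cmat_zero)
        then show ?thesis using D by (simp add: closed_span_def N_def[symmetric])
      next
        case False
        then have "corner ?A (cmat N (E s t)) x \<noteq> czero ?A" using co0[of s t x] st xN by (simp add: N_def)
        then have "cmat N (E s t) \<in> D" using U st by auto
        then show ?thesis using D by (simp add: cmat_scl closed_span_def)
      qed
    qed
    then show "x \<in> D" using mx_expand[OF emb_mx, of N x] cmat_emb[OF xN] by simp
  qed
qed

lemma T3_fd_cstar: assumes "n > 0" shows "fd_cstar (T3_alg n)"
proof -
  define N where "N = 3 * n"
  note [simp] = N_def[symmetric]
  show ?thesis
  proof
    show "\<exists>U. unit_system (T3_alg n) U" using T3_unit_system[OF assms] by blast
    show "\<exists>a\<in>alg (T3_alg n). \<exists>b\<in>alg (T3_alg n). x = cadd (T3_alg n) a (cadj (T3_alg n) b)" if x: "x \<in> car (T3_alg n)" for x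
    proof -
      \<comment> \<open>The diagonal blocks go to \<open>a\<close> alone; \<open>b\<close> takes the
        adjoint of the part strictly below them.\<close>
      define a where "a = mat N N (\<lambda>(i, j). if i div n \<le> j div n then x $$ (i, j) else 0)"
      define b where "b = mat N N (\<lambda>(i, j). if i div n < j div n then cnj (x $$ (j, i)) else 0)"
      have ai: "a $$ (i, j) = (if i div n \<le> j div n then x $$ (i, j) else 0)"
        and bi: "b $$ (i, j) = (if i div n < j div n then cnj (x $$ (j, i)) else 0)" if "i < N" "j < N" for i j
        using that by (simp_all add: a_def b_def)
      have ab: "a \<in> carrier_mat N N" "b \<in> carrier_mat N N" by (simp_all add: a_def b_def)
      have "a \<in> alg (T3_alg n)" "b \<in> alg (T3_alg n)" by (auto simp: T3_alg_def a_def b_def)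
      moreover have "x = a + mat_adjoint b"
        using x ab carrier_matD[OF mat_adjoint_carrier[OF ab(2)]]
        by (intro eq_matI) (auto simp: mat_adjoint_index[OF ab(2)] ai bi)
      ultimately show ?thesis by auto
    qed
  next
    fix x y :: "complex mat" assume x: "x \<in> car (T3_alg n)" and y: "y \<in> car (T3_alg n)"
    then have xy: "x \<in> carrier_mat N N" "y \<in> carrier_mat N N" by auto
    have xy': "x * y \<in> carrier_mat N N" using xy by auto
    show "cadj (T3_alg n) (cmult (T3_alg n) x y) = cmult (T3_alg n) (cadj (T3_alg n) y) (cadj (T3_alg n) x)"
      using xy xy' by (intro emb_inj[of _ N])
        (auto simp: emb_mult emb_adj mat_adjoint_carrier intro!: mult_carrier_mat[of _ N N])
    show "cadj (T3_alg n) (cadd (T3_alg n) x y) = cadd (T3_alg n) (cadj (T3_alg n) x) (cadj (T3_alg n) y)"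
      using xy by (intro emb_inj[of _ N]) (auto simp: emb_add emb_adj mat_adjoint_carrier)
    show "cnorm (T3_alg n) (cmult (T3_alg n) x y) \<le> cnorm (T3_alg n) x * cnorm (T3_alg n) y"
      using xy op_norm_mult by simp
    show "cnorm (T3_alg n) (cadd (T3_alg n) x y) \<le> cnorm (T3_alg n) x + cnorm (T3_alg n) y"
      using xy op_norm_add by simp
  next
    fix c x assume "x \<in> car (T3_alg n)"
    then have x: "x \<in> carrier_mat N N" by simp
    show "cadd (T3_alg n) x (cscale (T3_alg n) (-1) x) = czero (T3_alg n)"
      using x by (auto intro!: eq_matI)
    show "x = czero (T3_alg n)" if "cnorm (T3_alg n) x = 0" using x that op_norm_zeroD by simp
    show "cscale (T3_alg n) c (cscale (T3_alg n) d x) = cscale (T3_alg n) (c * d) x" for d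
      by (auto intro!: eq_matI simp: mult.assoc)
    show "cscale (T3_alg n) 1 x = x" "cscale (T3_alg n) 0 x = czero (T3_alg n)"
      using x by (auto intro!: eq_matI)
    show "cadj (T3_alg n) (cscale (T3_alg n) c x) = cscale (T3_alg n) (cnj c) (cadj (T3_alg n) x)"
      using x by (intro emb_inj[of _ N]) (auto simp: emb_smult emb_adj mat_adjoint_carrier)
  qed (auto simp: T3_alg_def[of n] algebra_simps mat_adjoint_adjoint op_norm_nonneg op_norm_smult op_norm_adj
      op_norm_cstar intro!: assoc_mult_mat[of _ N N _ N _ N] add_mult_distrib_mat[of _ N N _ _ N] mult_add_distrib_mat[of _ N N _ N])
qed

section \<open>Finite direct sums\<close>

lemma direct_sum_car: "xs \<in> car (direct_sum As) \<longleftrightarrow> length xs = length As \<and> (\<forall>i<length As. xs ! i \<in> car (As ! i))"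
  by (auto simp: direct_sum_def list_all2_conv_all_nth)

lemma direct_sum_alg: "xs \<in> alg (direct_sum As) \<longleftrightarrow> length xs = length As \<and> (\<forall>i<length As. xs ! i \<in> alg (As ! i))"
  by (auto simp: direct_sum_def list_all2_conv_all_nth)

lemma direct_sum_ops:
  "cadd (direct_sum As) xs ys = map (\<lambda>i. cadd (As ! i) (xs ! i) (ys ! i)) [0..<length As]"
  "cmult (direct_sum As) xs ys = map (\<lambda>i. cmult (As ! i) (xs ! i) (ys ! i)) [0..<length As]"
  "cscale (direct_sum As) c xs = map (\<lambda>i. cscale (As ! i) c (xs ! i)) [0..<length As]"
  "cadj (direct_sum As) xs = map (\<lambda>i. cadj (As ! i) (xs ! i)) [0..<length As]"
  "czero (direct_sum As) = map czero As"
  by (simp_all add: direct_sum_def)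

lemma direct_sum_norm: "cnorm (direct_sum As) xs = Max ((\<lambda>i. cnorm (As ! i) (xs ! i)) ` {..<length As})"
  by (simp add: direct_sum_def)

text \<open>The inclusion of the \<open>i\<close>-th summand; \<open>partial_map\<close> restricts a
  map along it.\<close>

definition inj_at :: "'a opalg list \<Rightarrow> nat \<Rightarrow> 'a \<Rightarrow> 'a list" where
  "inj_at As i a = (map czero As)[i := a]"

lemma length_inj_at[simp]: "length (inj_at As i a) = length As" by (simp add: inj_at_def)

lemma nth_inj_at: "j < length As \<Longrightarrow> inj_at As i a ! j = (if j = i then a else czero (As ! j))"
  by (auto simp: inj_at_def nth_list_update)

lemma list_ext:
  "length xs = N \<Longrightarrow> length ys = N \<Longrightarrow> (\<And>i. i < N \<Longrightarrow> xs ! i = ys ! i) \<Longrightarrow> xs = ys"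
  by (intro nth_equalityI) auto

context
  fixes As :: "'a opalg list"
  assumes fd_all: "\<forall>A\<in>set As. fd_cstar A"
begin

lemma summand_fd: "i < length As \<Longrightarrow> fd_cstar (As ! i)"
  using fd_all by simp

lemma inj_at_zero: "i < length As \<Longrightarrow> inj_at As i (czero (As ! i)) = czero (direct_sum As)"
  by (rule list_ext[of _ "length As"]) (auto simp: direct_sum_ops nth_inj_at)

lemma inj_at_add: "i < length As \<Longrightarrow> inj_at As i (cadd (As ! i) a b) = cadd (direct_sum As) (inj_at As i a) (inj_at As i b)"
  by (rule list_ext[of _ "length As"]) (use summand_fd in \<open>auto simp: direct_sum_ops nth_inj_at fd_cstar.add_zero fd_cstar.zero_cl\<close>)

lemma inj_at_mult: "i < length As \<Longrightarrow> inj_at As i (cmult (As ! i) a b) = cmult (direct_sum As) (inj_at As i a) (inj_at As i b)"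
  by (rule list_ext[of _ "length As"]) (use summand_fd in \<open>auto simp: direct_sum_ops nth_inj_at fd_cstar.zero_mult fd_cstar.zero_cl\<close>)

lemma inj_at_mult_orth:
  "\<lbrakk>i < length As; j < length As; i \<noteq> j; a \<in> car (As ! i); b \<in> car (As ! j)\<rbrakk>
    \<Longrightarrow> cmult (direct_sum As) (inj_at As i a) (inj_at As j b) = czero (direct_sum As)"
  by (rule list_ext[of _ "length As"])
    (use summand_fd in \<open>auto simp: direct_sum_ops nth_inj_at fd_cstar.zero_mult fd_cstar.mult_zero fd_cstar.zero_cl\<close>)

lemma inj_at_scale: "i < length As \<Longrightarrow> inj_at As i (cscale (As ! i) c a) = cscale (direct_sum As) c (inj_at As i a)"
  by (rule list_ext[of _ "length As"]) (use summand_fd in \<open>auto simp: direct_sum_ops nth_inj_at fd_cstar.scale_zero fd_cstar.zero_cl\<close>)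

lemma inj_at_adj: "i < length As \<Longrightarrow> inj_at As i (cadj (As ! i) a) = cadj (direct_sum As) (inj_at As i a)"
  by (rule list_ext[of _ "length As"]) (use summand_fd in \<open>auto simp: direct_sum_ops nth_inj_at fd_cstar.adj_zero fd_cstar.zero_cl\<close>)

lemma inj_at_car: "i < length As \<Longrightarrow> a \<in> car (As ! i) \<Longrightarrow> inj_at As i a \<in> car (direct_sum As)"
  using fd_cstar.zero_cl[OF summand_fd] by (auto simp: direct_sum_car nth_inj_at)

lemma inj_at_alg: "i < length As \<Longrightarrow> a \<in> alg (As ! i) \<Longrightarrow> inj_at As i a \<in> alg (direct_sum As)"
  using fd_cstar.alg_zero[OF summand_fd] by (auto simp: direct_sum_alg nth_inj_at)

text \<open>Truncations that lead from zero to \<open>x\<close> in steps of one summand, for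
  inductions over the summands.\<close>

definition partial_list :: "'a list \<Rightarrow> nat \<Rightarrow> 'a list" where
  "partial_list x k = map (\<lambda>i. if i < k then x ! i else czero (As ! i)) [0..<length As]"

lemma partial_list_0: "partial_list x 0 = czero (direct_sum As)"
  by (rule list_ext[of _ "length As"]) (auto simp: direct_sum_ops partial_list_def)

lemma partial_list_length: "x \<in> car (direct_sum As) \<Longrightarrow> partial_list x (length As) = x"
  by (rule list_ext[of _ "length As"]) (auto simp: direct_sum_car partial_list_def)

lemma partial_list_car: "x \<in> car (direct_sum As) \<Longrightarrow> partial_list x k \<in> car (direct_sum As)"
  using fd_cstar.zero_cl[OF summand_fd] by (auto simp: direct_sum_car partial_list_def)

lemma partial_list_Suc:
  "k < length As \<Longrightarrow> x \<in> car (direct_sum As) \<Longrightarrow>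
    partial_list x (Suc k) = cadd (direct_sum As) (partial_list x k) (inj_at As k (x ! k))"
  using summand_fd by (intro list_ext[of _ "length As"])
    (auto simp: direct_sum_ops nth_inj_at direct_sum_car partial_list_def fd_cstar.add_zero fd_cstar.add_zero_left fd_cstar.zero_cl less_Suc_eq)

text \<open>The matrix units are those of the summands, put in their positions. The norm
  inequalities are checked in coordinates, using that the maximum is attained.\<close>

lemma direct_sum_fd_cstar:
  assumes ne: "As \<noteq> []"
  shows "fd_cstar (direct_sum As)"
proof -
  let ?S = "direct_sum As"
  have norm_le: "cnorm ?S xs \<le> c \<longleftrightarrow> (\<forall>i<length As. cnorm (As ! i) (xs ! i) \<le> c)" for xs c
    unfolding direct_sum_norm using ne by (subst Max_le_iff) auto
  have norm_ge: "cnorm (As ! i) (xs ! i) \<le> cnorm ?S xs" if "i < length As" for i xs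
    unfolding direct_sum_norm using that by (intro Max_ge) auto
  have norm_att: "\<exists>i<length As. cnorm ?S xs = cnorm (As ! i) (xs ! i)" for xs
  proof -
    have "cnorm ?S xs \<in> (\<lambda>i. cnorm (As ! i) (xs ! i)) ` {..<length As}"
      unfolding direct_sum_norm using ne by (intro Max_in) auto
    then show ?thesis by auto
  qed
  have norm_nonneg: "cnorm ?S xs \<ge> 0" if "xs \<in> car ?S" for xs
    using norm_att[of xs] that fd_cstar.norm_nonneg[OF summand_fd] by (auto simp: direct_sum_car)
  have ext: "xs = ys" if "length xs = length As" "length ys = length As" "\<And>i. i < length As \<Longrightarrow> xs ! i = ys ! i" for xs ys :: "'a list"
    using that by (intro nth_equalityI) auto
  note simps = direct_sum_car direct_sum_alg direct_sum_ops
  have inj_rp: "range_proj ?S (inj_at As i e) = inj_at As i (range_proj (As ! i) e)" if "i < length As" for i e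
    by (rule ext) (use that summand_fd in \<open>auto simp: range_proj_def direct_sum_ops nth_inj_at fd_cstar.adj_zero fd_cstar.zero_mult fd_cstar.zero_cl\<close>)
  have inj_co: "corner ?S (inj_at As i e) x = inj_at As i (corner (As ! i) e (x ! i))" if "i < length As" "x \<in> car ?S" for i e x
    unfolding corner_def inj_rp[OF that(1)]
    by (rule ext) (use that summand_fd in \<open>auto simp: direct_sum_car direct_sum_ops nth_inj_at fd_cstar.adj_zero fd_cstar.zero_mult fd_cstar.zero_cl\<close>)
  note inj_0 = inj_at_zero and inj_add = inj_at_add and inj_mult = inj_at_mult and inj_scale = inj_at_scale
  have inj_inj: "inj_at As i a = inj_at As i b \<longleftrightarrow> a = b" if "i < length As" for i a b
    using that by (metis nth_inj_at)
  define U where "U i = fd_cstar.mat_units (As ! i)" for i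
  have U: "finite (U i)" "U i \<subseteq> car (As ! i)"
    "e \<in> U i \<Longrightarrow> cmult (As ! i) (range_proj (As ! i) e) (range_proj (As ! i) e) = range_proj (As ! i) e"
    "e \<in> U i \<Longrightarrow> cmult (As ! i) (range_proj (As ! i) e) e = e"
    "e \<in> U i \<Longrightarrow> x \<in> car (As ! i) \<Longrightarrow> \<exists>c. corner (As ! i) e x = cscale (As ! i) c (range_proj (As ! i) e)"
    "e \<in> U i \<Longrightarrow> x \<in> alg (As ! i) \<Longrightarrow> corner (As ! i) e x \<noteq> czero (As ! i) \<Longrightarrow> e \<in> alg (As ! i)"
    if "i < length As" for i e x
    unfolding U_def using fd_cstar.mat_units[OF summand_fd[OF that]] by blast+
  have units: "unit_system ?S (\<Union>i<length As. inj_at As i ` U i)"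
    unfolding unit_system_def
  proof (intro conjI ballI allI impI)
    show "finite (\<Union>i<length As. inj_at As i ` U i)" using U(1) by auto
    show "(\<Union>i<length As. inj_at As i ` U i) \<subseteq> car ?S"
      using fd_cstar.zero_cl[OF summand_fd] by (auto simp: direct_sum_car nth_inj_at dest: subsetD[OF U(2)])
  next
    fix e assume "e \<in> (\<Union>i<length As. inj_at As i ` U i)"
    then obtain i e' where i: "i < length As" and e: "e = inj_at As i e'" and e': "e' \<in> U i" by blast
    show "cmult ?S (range_proj ?S e) (range_proj ?S e) = range_proj ?S e"
      unfolding e inj_rp[OF i] inj_mult[OF i, symmetric] U(3)[OF i e'] ..
    show "cmult ?S (range_proj ?S e) e = e"
      unfolding e inj_rp[OF i] inj_mult[OF i, symmetric] U(4)[OF i e'] ..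
    show "\<exists>c. corner ?S e x = cscale ?S c (range_proj ?S e)" if x: "x \<in> car ?S" for x
    proof -
      obtain c where "corner (As ! i) e' (x ! i) = cscale (As ! i) c (range_proj (As ! i) e')"
        using U(5)[OF i e', of "x ! i"] x i by (auto simp: direct_sum_car)
      then show ?thesis unfolding e inj_co[OF i x] inj_rp[OF i] by (auto simp: inj_scale[OF i])
    qed
    show "e \<in> alg ?S" if x: "x \<in> alg ?S" "corner ?S e x \<noteq> czero ?S" for x
    proof -
      have xc: "x \<in> car ?S" using x(1) by (auto simp: simps dest: subsetD[OF fd_cstar.alg_car[OF summand_fd]])
      have "corner (As ! i) e' (x ! i) \<noteq> czero (As ! i)"
        using x(2) unfolding e inj_co[OF i xc] using inj_0[OF i] by auto
      then have "e' \<in> alg (As ! i)" using U(6)[OF i e'] x(1) i by (auto simp: direct_sum_alg)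
      then show ?thesis using fd_cstar.alg_zero[OF summand_fd] i by (auto simp: e direct_sum_alg nth_inj_at)
    qed
  next
    fix x D assume x: "x \<in> car ?S" and D: "closed_span ?S D"
      and UD: "\<forall>e\<in>(\<Union>i<length As. inj_at As i ` U i). corner ?S e x \<noteq> czero ?S \<longrightarrow> e \<in> D"
    have xi: "inj_at As i (x ! i) \<in> D" if i: "i < length As" for i
    proof -
      have "x ! i \<in> {y. inj_at As i y \<in> D}"
      proof (rule fd_cstar.unit_span[OF summand_fd[OF i]])
        show "x ! i \<in> car (As ! i)" using x i by (simp add: direct_sum_car)
        show "czero (As ! i) \<in> {y. inj_at As i y \<in> D}" using inj_0[OF i] D by (simp add: closed_span_def)
        show "cadd (As ! i) y z \<in> {y. inj_at As i y \<in> D}" if "y \<in> {y. inj_at As i y \<in> D}" "z \<in> {y. inj_at As i y \<in> D}" for y z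
          using that D by (simp add: inj_add[OF i] closed_span_def)
        show "cscale (As ! i) c y \<in> {y. inj_at As i y \<in> D}" if "y \<in> {y. inj_at As i y \<in> D}" for c y
          using that D by (simp add: inj_scale[OF i] closed_span_def)
        fix e assume e: "e \<in> fd_cstar.mat_units (As ! i)" "corner (As ! i) e (x ! i) \<noteq> czero (As ! i)"
        have "corner ?S (inj_at As i e) x \<noteq> czero ?S"
          unfolding inj_co[OF i x] using e(2) inj_0[OF i] inj_inj[OF i] by metis
        then show "e \<in> {y. inj_at As i y \<in> D}" using UD i e(1) unfolding U_def by blast
      qed
      then show ?thesis by simp
    qed
    have "k \<le> length As \<Longrightarrow> partial_list x k \<in> D" for k
    proof (induction k)
      case 0
      then show ?case using D by (simp add: partial_list_0 closed_span_def)
    next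
      case (Suc k)
      then show ?case using x xi[of k] D by (simp add: partial_list_Suc closed_span_def)
    qed
    then show "x \<in> D" using partial_list_length[OF x] by (metis order_refl)
  qed
  show ?thesis
  proof
    show "\<exists>U. unit_system ?S U" using units by blast
    show "\<exists>a\<in>alg ?S. \<exists>b\<in>alg ?S. x = cadd ?S a (cadj ?S b)" if x: "x \<in> car ?S" for x
    proof -
      have "\<forall>i<length As. \<exists>a b. a \<in> alg (As ! i) \<and> b \<in> alg (As ! i) \<and> x ! i = cadd (As ! i) a (cadj (As ! i) b)"
        using fd_cstar.alg_generates[OF summand_fd] x by (fastforce simp: direct_sum_car)
      then obtain a b where ab: "\<And>i. i < length As \<Longrightarrow> a i \<in> alg (As ! i) \<and> b i \<in> alg (As ! i) \<and> x ! i = cadd (As ! i) (a i) (cadj (As ! i) (b i))"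
        by metis
      have "x = cadd ?S (map a [0..<length As]) (cadj ?S (map b [0..<length As]))"
        by (rule ext) (use x ab in \<open>auto simp: simps\<close>)
      moreover have "map a [0..<length As] \<in> alg ?S" "map b [0..<length As] \<in> alg ?S" using ab by (auto simp: direct_sum_alg)
      ultimately show ?thesis by blast
    qed
    show "cnorm ?S (cadd ?S x y) \<le> cnorm ?S x + cnorm ?S y" if "x \<in> car ?S" "y \<in> car ?S" for x y
      unfolding norm_le
    proof (intro allI impI)
      fix i assume i: "i < length As"
      then show "cnorm (As ! i) (cadd ?S x y ! i) \<le> cnorm ?S x + cnorm ?S y"
        using fd_cstar.norm_add[OF summand_fd[OF i], of "x ! i" "y ! i"] norm_ge[OF i, of x] norm_ge[OF i, of y] that by (simp add: simps)
    qed
    show "cnorm ?S (cmult ?S x y) \<le> cnorm ?S x * cnorm ?S y" if xy: "x \<in> car ?S" "y \<in> car ?S" for x y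
      unfolding norm_le
    proof (intro allI impI)
      fix i assume i: "i < length As"
      have "cnorm (As ! i) (cmult (As ! i) (x ! i) (y ! i)) \<le> cnorm (As ! i) (x ! i) * cnorm (As ! i) (y ! i)"
        by (rule fd_cstar.norm_mult[OF summand_fd[OF i]]) (use xy i in \<open>auto simp: simps\<close>)
      also have "\<dots> \<le> cnorm ?S x * cnorm ?S y"
        using norm_ge[OF i] norm_nonneg[OF xy(1)] fd_cstar.norm_nonneg[OF summand_fd[OF i]] xy i by (intro mult_mono) (auto simp: simps)
      finally show "cnorm (As ! i) (cmult ?S x y ! i) \<le> cnorm ?S x * cnorm ?S y" using i by (simp add: simps)
    qed
    show "cnorm ?S (cscale ?S c x) = cmod c * cnorm ?S x" if x: "x \<in> car ?S" for c x
    proof (rule antisym)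
      show "cnorm ?S (cscale ?S c x) \<le> cmod c * cnorm ?S x"
        unfolding norm_le using norm_ge x fd_cstar.norm_scale[OF summand_fd] by (auto simp: simps mult_left_mono)
      obtain i where i: "i < length As" "cnorm ?S x = cnorm (As ! i) (x ! i)" using norm_att by blast
      then show "cmod c * cnorm ?S x \<le> cnorm ?S (cscale ?S c x)"
        using norm_ge[OF i(1), of "cscale ?S c x"] x fd_cstar.norm_scale[OF summand_fd[OF i(1)]] by (simp add: simps)
    qed
    show "cnorm ?S (cadj ?S x) = cnorm ?S x" if x: "x \<in> car ?S" for x
      unfolding direct_sum_norm using x fd_cstar.norm_adj[OF summand_fd] by (intro arg_cong[of _ _ Max] image_cong) (auto simp: simps)
    show "(cnorm ?S x)\<^sup>2 \<le> cnorm ?S (cmult ?S (cadj ?S x) x)" if x: "x \<in> car ?S" for x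
    proof -
      obtain i where i: "i < length As" "cnorm ?S x = cnorm (As ! i) (x ! i)" using norm_att by blast
      then show ?thesis
        using norm_ge[OF i(1), of "cmult ?S (cadj ?S x) x"] x fd_cstar.norm_cstar[OF summand_fd[OF i(1)], of "x ! i"] by (simp add: simps)
    qed
    show "x = czero ?S" if x: "x \<in> car ?S" "cnorm ?S x = 0" for x
    proof (rule ext)
      fix i assume i: "i < length As"
      have "cnorm (As ! i) (x ! i) = 0"
        using norm_ge[OF i, of x] x i fd_cstar.norm_nonneg[OF summand_fd[OF i], of "x ! i"] by (auto simp: direct_sum_car)
      then show "x ! i = czero ?S ! i" using fd_cstar.norm_zeroD[OF summand_fd[OF i]] x i by (simp add: simps)
    qed (use x in \<open>auto simp: simps\<close>)
    show "alg ?S \<subseteq> car ?S" by (auto simp: simps intro!: subsetD[OF fd_cstar.alg_car[OF summand_fd]])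
    show "0 \<le> cnorm ?S x" if "x \<in> car ?S" for x by (rule norm_nonneg[OF that])
  qed (use summand_fd in \<open>auto simp: simps fd_cstar.add_cl fd_cstar.mult_cl fd_cstar.scale_cl fd_cstar.adj_cl fd_cstar.zero_cl
      fd_cstar.alg_zero fd_cstar.alg_add fd_cstar.alg_scale
      intro!: ext fd_cstar.add_assoc fd_cstar.add_comm fd_cstar.add_zero fd_cstar.add_neg fd_cstar.scale_scale
        fd_cstar.scale_one fd_cstar.scale_0 fd_cstar.scale_add fd_cstar.mult_assoc fd_cstar.distr fd_cstar.distl fd_cstar.scale_mult
        fd_cstar.mult_scale fd_cstar.adj_add fd_cstar.adj_mult fd_cstar.adj_scale fd_cstar.adj_adj\<close>)
qed

end

section \<open>Regular embeddings\<close>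

definition hat :: "nat \<Rightarrow> nat \<Rightarrow> (complex mat \<Rightarrow> complex mat) \<Rightarrow> fmat \<Rightarrow> fmat" where
  "hat n m h x = emb (3 * m) (h (cmat (3 * n) x))"

lemma cmat_mult: "x \<in> mx N N \<Longrightarrow> y \<in> mx N N \<Longrightarrow> cmat N (x * y) = cmat N x * cmat N y"
  by (rule emb_inj[of _ N]) (auto simp: emb_mult emb_cmat mx_mult[of x N N y N] intro!: mult_carrier_mat[of _ N N])

lemma cmat_adj: "x \<in> mx N N \<Longrightarrow> cmat N (adj x) = mat_adjoint (cmat N x)"
  by (rule emb_inj[of _ N]) (auto simp: emb_adj emb_cmat mx_closed)

lemma T3_hom:
  assumes "n > 0" "m > 0"
  shows "alg_hom (T3_alg n) (T3_alg m) h \<longleftrightarrow>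
    (\<forall>x\<in>carrier_mat (3*n) (3*n). h x \<in> carrier_mat (3*m) (3*m)) \<and>
    (\<forall>x\<in>carrier_mat (3*n) (3*n). \<forall>y\<in>carrier_mat (3*n) (3*n). h (x + y) = h x + h y \<and> h (x * y) = h x * h y) \<and>
    (\<forall>c. \<forall>x\<in>carrier_mat (3*n) (3*n). h (c \<cdot>\<^sub>m x) = c \<cdot>\<^sub>m h x) \<and>
    (\<forall>x\<in>carrier_mat (3*n) (3*n). h (mat_adjoint x) = mat_adjoint (h x)) \<and>
    (\<forall>a\<in>alg (T3_alg n). h a \<in> alg (T3_alg m))"
  unfolding alg_hom_def star_hom_def
  using fd_cstar.Cstar_car[OF T3_fd_cstar[OF assms(1)]] fd_cstar.Cstar_car[OF T3_fd_cstar[OF assms(2)]] by simp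

lemma hat_tri_hom:
  assumes "n > 0" "m > 0" and h: "alg_hom (T3_alg n) (T3_alg m) h"
  shows "tri_hom n m (hat n m h)"
proof -
  note H = h[unfolded T3_hom[OF assms(1,2)]]
  have cM: "h (cmat (3*n) x) \<in> carrier_mat (3*m) (3*m)" for x using H by auto
  show ?thesis
  proof
    show "hat n m h x \<in> M3 m" for x by (simp add: hat_def)
    show "hat n m h (x + y) = hat n m h x + hat n m h y" for x y
      using H cM by (simp add: hat_def cmat_add emb_add)
    show "hat n m h (x * y) = hat n m h x * hat n m h y" if "x \<in> M3 n" "y \<in> M3 n" for x y
      using H cM that by (simp add: hat_def cmat_mult emb_mult)
    show "hat n m h (scl c x) = scl c (hat n m h x)" for c x
      using H cM by (simp add: hat_def cmat_scl emb_smult)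
    show "hat n m h (adj x) = adj (hat n m h x)" if "x \<in> M3 n" for x
      using H cM that by (simp add: hat_def cmat_adj emb_adj)
    show "hat n m h x \<in> tri m" if "x \<in> tri n" for x
    proof -
      have "cmat (3*n) x \<in> alg (T3_alg n)" using that by (simp add: T3_alg_iff emb_cmat tri_def)
      then have "h (cmat (3*n) x) \<in> alg (T3_alg m)" using H by blast
      then show ?thesis by (simp add: T3_alg_iff hat_def)
    qed
  qed (use assms in auto)
qed

lemma hat_emb: "a \<in> carrier_mat (3*n) (3*n) \<Longrightarrow> hat n m h (emb (3*n) a) = emb (3*m) (h a)"
  by (simp add: hat_def cmat_emb)

lemma hat_comp:
  assumes "n > 0" "m > 0" "alg_hom (T3_alg n) (T3_alg m) h"
  shows "hat m l g (hat n m h x) = hat n l (\<lambda>a. g (h a)) x"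
  using assms(3)[unfolded T3_hom[OF assms(1,2)]] by (simp add: hat_def cmat_emb)

lemma idm_tri: "n > 0 \<Longrightarrow> idm (3 * n) \<in> tri n" by (auto simp: tri_def idm_mx)

lemma one_T3: "n > 0 \<Longrightarrow> 1\<^sub>m (3 * n) \<in> alg (T3_alg n)"
  by (simp add: T3_alg_iff emb_one idm_tri)

text \<open>In \<open>fmat\<close> padding by zeros changes nothing, so the standard form of a map
  of multiplicity one becomes conjugation by a unitary.\<close>

lemma diag_block_emb:
  assumes a: "a \<in> carrier_mat N N" and le: "N \<le> M"
  defines "d \<equiv> diag_block_mat (replicate 1 a @ [0\<^sub>m (M - 1 * N) (M - 1 * N)])"
  shows "d \<in> carrier_mat M M" "emb M d = emb N a"
proof -
  have d: "d = four_block_mat a (0\<^sub>m N (M - N)) (0\<^sub>m (M - N) N) (0\<^sub>m (M - N) (M - N))"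
    using a unfolding d_def by (auto simp: Let_def intro!: eq_matI)
  show c: "d \<in> carrier_mat M M" using a le unfolding d by auto
  show "emb M d = emb N a"
  proof (rule fmat_eqI)
    fix i j show "entry (emb M d) i j = entry (emb N a) i j"
      using a le unfolding entry_emb d by auto
  qed
qed

lemma foldr_emb:
  assumes "\<forall>f\<in>set fs. f a \<in> carrier_mat N N"
  shows "foldr (\<lambda>f s. f a + s) fs (0\<^sub>m N N) \<in> carrier_mat N N \<and>
     emb N (foldr (\<lambda>f s. f a + s) fs (0\<^sub>m N N)) = (\<Sum>i<length fs. emb N ((fs ! i) a))"
  using assms
proof (induction fs)
  case Nil then show ?case by (simp add: emb_zero)
next
  case (Cons f fs)
  then show ?case by (simp add: emb_add sum.lessThan_Suc_shift del: sum.lessThan_Suc)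
qed

text \<open>The isometry is completed to a unitary with the same first \<open>3 * n\<close> columns.
  On matrices supported in the first \<open>3 * n\<close> rows and columns, conjugation by the
  unitary and by \<open>W\<close> coincide.\<close>

lemma sandwich_multiplicity_one:
  assumes pos: "n > 0" "m > 0" and W: "W \<in> mx (3*m) (3*n)" "adj W * W = idm (3*n)" "\<And>a. a \<in> tri n \<Longrightarrow> W * a * adj W \<in> tri m"
  shows "multiplicity_one n m (\<lambda>a. cmat (3*m) (W * emb (3*n) a * adj W))"
proof -
  define \<Psi> where "\<Psi> a = cmat (3*m) (W * emb (3*n) a * adj W)" for a
  have WM: "W * x * adj W \<in> M3 m" if "x \<in> M3 n" for x
    using W(1) that by (intro mx_mult[of _ "3*m" "3*n"] mx_closed) auto
  have e\<Psi>: "emb (3*m) (\<Psi> a) = W * emb (3*n) a * adj W" for a unfolding \<Psi>_def by (rule emb_cmat[OF WM]) simp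
  have c\<Psi>: "\<Psi> a \<in> carrier_mat (3*m) (3*m)" for a by (simp add: \<Psi>_def)
  have hom: "alg_hom (T3_alg n) (T3_alg m) \<Psi>"
    unfolding T3_hom[OF pos]
  proof (intro conjI ballI allI)
    fix x y :: "complex mat" assume xy: "x \<in> carrier_mat (3*n) (3*n)" "y \<in> carrier_mat (3*n) (3*n)"
    show "\<Psi> (x + y) = \<Psi> x + \<Psi> y" 
      by (rule emb_inj[of _ "3*m"]) (use c\<Psi> xy in \<open>auto simp: emb_add e\<Psi> distrib_left distrib_right\<close>)
    have "W * emb (3*n) x * adj W * (W * emb (3*n) y * adj W) = W * emb (3*n) x * (adj W * W * emb (3*n) y) * adj W"
      by (simp only: mult.assoc)
    then have "W * emb (3*n) x * adj W * (W * emb (3*n) y * adj W) = W * (emb (3*n) x * emb (3*n) y) * adj W"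
      by (simp add: W(2) idm_mult[OF emb_mx] mult.assoc)
    then show "\<Psi> (x * y) = \<Psi> x * \<Psi> y" 
      by (intro emb_inj[of _ "3*m"]) (use c\<Psi> xy in \<open>auto simp: emb_mult e\<Psi> intro!: mult_carrier_mat[of _ "3*m" "3*m"]\<close>)
  next
    fix c and x :: "complex mat" assume x: "x \<in> carrier_mat (3*n) (3*n)"
    show "\<Psi> (c \<cdot>\<^sub>m x) = c \<cdot>\<^sub>m \<Psi> x"
      by (rule emb_inj[of _ "3*m"]) (use c\<Psi> x in \<open>auto simp: emb_smult e\<Psi> scl_mult_left scl_mult_right\<close>)
  next
    fix x :: "complex mat" assume x: "x \<in> carrier_mat (3*n) (3*n)"
    show "\<Psi> (mat_adjoint x) = mat_adjoint (\<Psi> x)"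
      by (rule emb_inj[of _ "3*m"]) (use c\<Psi> x in \<open>auto simp: emb_adj e\<Psi> mult.assoc\<close>)
    show "\<Psi> x \<in> carrier_mat (3*m) (3*m)" by (rule c\<Psi>)
  next
    fix a assume "a \<in> alg (T3_alg n)"
    then show "\<Psi> a \<in> alg (T3_alg m)" using W(3) c\<Psi> by (simp add: T3_alg_iff e\<Psi>)
  qed
  obtain u where u: "3*n \<le> 3*m" "u \<in> M3 m" "adj u * u = idm (3*m)" "u * adj u = idm (3*m)" "u * idm (3*n) = W"
    using isometry_extends_to_unitary[OF W(1,2)] by blast
  define U where "U = cmat (3*m) u"
  have U: "U \<in> carrier_mat (3*m) (3*m)" "emb (3*m) U = u" by (simp_all add: U_def emb_cmat u)
  have Ua: "mat_adjoint U \<in> carrier_mat (3*m) (3*m)" "emb (3*m) (mat_adjoint U) = adj u" using U by (auto simp: emb_adj)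
  have "has_multiplicity (3*n) (3*m) \<Psi> 1"
    unfolding has_multiplicity_def
  proof (intro conjI bexI[OF _ U(1)] ballI)
    show "1 * (3*n) \<le> 3*m" using u by simp
    show "U * mat_adjoint U = 1\<^sub>m (3*m)" "mat_adjoint U * U = 1\<^sub>m (3*m)"
      by (rule emb_inj[of _ "3*m"]; use U Ua u in \<open>auto simp: emb_mult emb_one intro!: mult_carrier_mat[of _ "3*m" "3*m"]\<close>)+
    fix a :: "complex mat" assume a: "a \<in> carrier_mat (3*n) (3*n)"
    define d where "d = diag_block_mat (replicate 1 a @ [0\<^sub>m (3*m - 1 * (3*n)) (3*m - 1 * (3*n))])"
    have d: "d \<in> carrier_mat (3*m) (3*m)" "emb (3*m) d = emb (3*n) a"
      unfolding d_def using diag_block_emb[OF a u(1)] by auto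
    have Ud: "U * d \<in> carrier_mat (3*m) (3*m)" using U d by (intro mult_carrier_mat[of _ "3*m" "3*m"])
    have "W * emb (3*n) a * adj W = u * (idm (3*n) * emb (3*n) a * idm (3*n)) * adj u"
      unfolding u(5)[symmetric] by (simp add: mult.assoc)
    also have "\<dots> = u * emb (3*n) a * adj u" by (simp add: idm_mult[OF emb_mx] mult_idm[OF emb_mx])
    finally have "emb (3*m) (\<Psi> a) = emb (3*m) (U * d * mat_adjoint U)"
      using U Ua d Ud by (simp add: e\<Psi> emb_mult)
    then show "\<Psi> a = U * diag_block_mat (replicate 1 a @ [0\<^sub>m (3*m - 1 * (3*n)) (3*m - 1 * (3*n))]) * mat_adjoint U"
      unfolding d_def[symmetric] using c\<Psi> U Ua Ud by (intro emb_inj[of _ "3*m"]) (auto intro!: mult_carrier_mat[of _ "3*m" "3*m"])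
  qed
  moreover have "star_extension (T3_alg n) (T3_alg m) \<Psi> \<Psi>"
    using hom by (simp add: star_extension_def alg_hom_def)
  ultimately show ?thesis unfolding multiplicity_one_def \<Psi>_def[symmetric] by blast
qed

text \<open>The converse passage: only the first \<open>3 * n\<close> columns of the unitary meet
  the padded matrix.\<close>

lemma multiplicity_one_sandwich:
  assumes "has_multiplicity (3*n) (3*m) \<Psi> 1"
  shows "\<exists>W\<in>mx (3*m) (3*n). \<forall>x\<in>M3 n. hat n m \<Psi> x = W * x * adj W"
proof -
  obtain U where le: "1 * (3*n) \<le> 3*m" and U: "U \<in> carrier_mat (3*m) (3*m)"
    and \<Psi>: "\<And>a. a \<in> carrier_mat (3*n) (3*n) \<Longrightarrow> \<Psi> a = U * diag_block_mat (replicate 1 a @ [0\<^sub>m (3*m - 1 * (3*n)) (3*m - 1 * (3*n))]) * mat_adjoint U"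
    using assms unfolding has_multiplicity_def by blast
  define W where "W = emb (3*m) U * idm (3*n)"
  have W: "W \<in> mx (3*m) (3*n)"
    unfolding W_def using le by (intro mx_mult[of _ _ "3*m"] emb_mx mx_mono[OF idm_mx]) auto
  have "hat n m \<Psi> x = W * x * adj W" if x: "x \<in> M3 n" for x
  proof -
    define a where "a = cmat (3*n) x"
    have a: "a \<in> carrier_mat (3*n) (3*n)" by (simp add: a_def)
    define d where "d = diag_block_mat (replicate 1 a @ [0\<^sub>m (3*m - 1 * (3*n)) (3*m - 1 * (3*n))])"
    have d: "d \<in> carrier_mat (3*m) (3*m)" "emb (3*m) d = x"
      unfolding d_def using diag_block_emb[OF a, of "3*m"] le x by (auto simp: a_def emb_cmat)
    have Ud: "U * d \<in> carrier_mat (3*m) (3*m)" using U d by (intro mult_carrier_mat[of _ "3*m" "3*m"])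
    have "hat n m \<Psi> x = emb (3*m) (U * d * mat_adjoint U)"
      unfolding hat_def a_def[symmetric] \<Psi>[OF a] d_def ..
    also have "\<dots> = emb (3*m) U * x * adj (emb (3*m) U)" using U d Ud by (simp add: emb_mult emb_adj)
    also have "\<dots> = emb (3*m) U * (idm (3*n) * x * idm (3*n)) * adj (emb (3*m) U)"
      by (simp add: idm_mult[OF x] mult_idm[OF x])
    finally show ?thesis by (simp add: W_def mult.assoc)
  qed
  then show ?thesis using W by blast
qed

text \<open>Spreads involve \<open>E s t\<close> for \<open>s\<close> and \<open>t\<close> in any
  order, hence the extension \<open>h\<close>, whereas regularity speaks of values on the algebra.
  From commutation, the isometries of \<open>commuting_decompose\<close> give the summands. From
  regularity, each summand is a conjugation by \<open>multiplicity_one_sandwich\<close>, and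
  \<open>commuting_sum\<close> applies once orthogonality and the sum formula are extended from the
  algebra to all matrices.\<close>

lemma regular_iff_commuting:
  assumes pos: "n > 0" "m > 0" and h: "alg_hom (T3_alg n) (T3_alg m) h"
    and \<phi>: "\<And>a. a \<in> alg (T3_alg n) \<Longrightarrow> \<phi> a = h a"
  shows "regular n m \<phi> \<longleftrightarrow> commuting n m (hat n m h)"
proof
  note H = h[unfolded T3_hom[OF pos]]
  interpret tri_hom n m "hat n m h" by (rule hat_tri_hom[OF pos h])
  assume commuting: "commuting n m (hat n m h)"
  have alg_carrier: "a \<in> carrier_mat (3*n) (3*n)" if "a \<in> alg (T3_alg n)" for a using that by (simp add: T3_alg_iff)
  obtain Ws where Ws0: "\<forall>W\<in>set Ws. W \<in> mx (3 * m) (3 * n) \<and> adj W * W = idm (3 * n) \<and> (\<forall>a\<in>tri n. W * a * adj W \<in> tri m)"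
    "\<forall>i<length Ws. \<forall>j<length Ws. i \<noteq> j \<longrightarrow> adj (Ws ! i) * Ws ! j = 0"
    "\<forall>a\<in>M3 n. hat n m h a = (\<Sum>i<length Ws. Ws ! i * a * adj (Ws ! i))"
    using commuting_decompose[OF tri_hom_axioms commuting] by (elim exE conjE) (rule that)
  have Ws: "\<And>W. W \<in> set Ws \<Longrightarrow> W \<in> mx (3*m) (3*n)" "\<And>W. W \<in> set Ws \<Longrightarrow> adj W * W = idm (3*n)"
     "\<And>W a. W \<in> set Ws \<Longrightarrow> a \<in> tri n \<Longrightarrow> W * a * adj W \<in> tri m"
     "\<And>i j. i < length Ws \<Longrightarrow> j < length Ws \<Longrightarrow> i \<noteq> j \<Longrightarrow> adj (Ws ! i) * Ws ! j = 0"
     "\<And>a. a \<in> M3 n \<Longrightarrow> hat n m h a = (\<Sum>i<length Ws. Ws ! i * a * adj (Ws ! i))"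
    using Ws0 by simp_all
  define \<psi> where "\<psi> W a = cmat (3*m) (W * emb (3*n) a * adj W)" for W a
  have e\<psi>: "emb (3*m) (\<psi> W a) = W * emb (3*n) a * adj W" if "W \<in> set Ws" for W a
    unfolding \<psi>_def using Ws(1)[OF that] by (intro emb_cmat mx_mult[of _ "3*m" "3*n"] mx_closed) auto
  have c\<psi>: "\<psi> W a \<in> carrier_mat (3*m) (3*m)" for W a by (simp add: \<psi>_def)
  show "regular n m \<phi>"
    unfolding regular_def
  proof (intro conjI exI[of _ "map \<psi> Ws"] ballI allI impI)
    have "star_extension (T3_alg n) (T3_alg m) \<phi> h"
      using h \<phi> by (simp add: star_extension_def alg_hom_def)
    then show "star_extendible (T3_alg n) (T3_alg m) \<phi>" unfolding star_extendible_def by blast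
  next
    fix f assume "f \<in> set (map \<psi> Ws)"
    then obtain W where "W \<in> set Ws" "f = \<psi> W" by auto
    then show "multiplicity_one n m f"
      using sandwich_multiplicity_one[OF pos Ws(1,2,3)] by (simp add: \<psi>_def[abs_def])
  next
    fix i j a b assume ij: "i < length (map \<psi> Ws)" "j < length (map \<psi> Ws)" "i \<noteq> j"
    let ?V = "Ws ! i" and ?W = "Ws ! j"
    have V: "?V \<in> set Ws" "?W \<in> set Ws" "adj ?V * ?W = 0" using ij Ws(4) by auto
    have "?V * emb (3*n) a * adj ?V * (?W * emb (3*n) b * adj ?W) = ?V * emb (3*n) a * (adj ?V * ?W) * emb (3*n) b * adj ?W"
      by (simp only: mult.assoc)
    then have "?V * emb (3*n) a * adj ?V * (?W * emb (3*n) b * adj ?W) = 0" by (simp add: V(3))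
    then show "(map \<psi> Ws ! i) a * (map \<psi> Ws ! j) b = 0\<^sub>m (3*m) (3*m)"
      using ij c\<psi> by (intro emb_inj[of _ "3*m"]) (auto simp: emb_mult[OF c\<psi> c\<psi>] e\<psi>[OF V(1)] e\<psi>[OF V(2)] emb_zero intro!: mult_carrier_mat[of _ "3*m" "3*m"])
  next
    fix a assume a: "a \<in> alg (T3_alg n)"
    have c: "\<forall>f\<in>set (map \<psi> Ws). f a \<in> carrier_mat (3*m) (3*m)" using c\<psi> by auto
    have "emb (3*m) (foldr (\<lambda>\<psi> s. \<psi> a + s) (map \<psi> Ws) (0\<^sub>m (3*m) (3*m))) = (\<Sum>i<length Ws. emb (3*m) (\<psi> (Ws ! i) a))"
      using foldr_emb[OF c] by simp
    also have "\<dots> = (\<Sum>i<length Ws. Ws ! i * emb (3*n) a * adj (Ws ! i))" by (rule sum.cong) (auto intro: e\<psi>)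
    also have "\<dots> = emb (3*m) (h a)" using Ws(5)[OF emb_mx, of a] hat_emb[OF alg_carrier[OF a]] by simp
    finally have "emb (3*m) (foldr (\<lambda>\<psi> s. \<psi> a + s) (map \<psi> Ws) (0\<^sub>m (3*m) (3*m))) = emb (3*m) (\<phi> a)" using \<phi>[OF a] by simp
    moreover have "\<phi> a \<in> carrier_mat (3*m) (3*m)" using \<phi>[OF a] H alg_carrier[OF a] by simp
    ultimately show "\<phi> a = foldr (\<lambda>\<psi> s. \<psi> a + s) (map \<psi> Ws) (0\<^sub>m (3*m) (3*m))"
      using foldr_emb[OF c] by (intro emb_inj[of _ "3*m"]) auto
  qed
next
  note H = h[unfolded T3_hom[OF pos]]
  interpret tri_hom n m "hat n m h" by (rule hat_tri_hom[OF pos h])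
  have alg_carrier: "a \<in> carrier_mat (3*n) (3*n)" if "a \<in> alg (T3_alg n)" for a using that by (simp add: T3_alg_iff)
  assume "regular n m \<phi>"
  then obtain \<psi>s where \<psi>s0: "\<forall>\<psi>\<in>set \<psi>s. multiplicity_one n m \<psi>"
    "\<forall>i<length \<psi>s. \<forall>j<length \<psi>s. i \<noteq> j \<longrightarrow> (\<forall>a\<in>alg (T3_alg n). \<forall>b\<in>alg (T3_alg n). (\<psi>s ! i) a * (\<psi>s ! j) b = 0\<^sub>m (3 * m) (3 * m))"
    "\<forall>a\<in>alg (T3_alg n). \<phi> a = foldr (\<lambda>\<psi> s. \<psi> a + s) \<psi>s (0\<^sub>m (3 * m) (3 * m))"
    unfolding regular_def by (elim exE conjE) (rule that)
  have \<psi>s: "\<And>\<psi>. \<psi> \<in> set \<psi>s \<Longrightarrow> multiplicity_one n m \<psi>"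
    "\<And>i j a b. i < length \<psi>s \<Longrightarrow> j < length \<psi>s \<Longrightarrow> i \<noteq> j \<Longrightarrow> a \<in> alg (T3_alg n) \<Longrightarrow> b \<in> alg (T3_alg n) \<Longrightarrow>
        (\<psi>s ! i) a * (\<psi>s ! j) b = 0\<^sub>m (3*m) (3*m)"
    "\<And>a. a \<in> alg (T3_alg n) \<Longrightarrow> \<phi> a = foldr (\<lambda>\<psi> s. \<psi> a + s) \<psi>s (0\<^sub>m (3*m) (3*m))"
    using \<psi>s0 by simp_all
  have "\<exists>\<Psi>. star_extension (T3_alg n) (T3_alg m) (\<psi>s ! i) \<Psi> \<and> has_multiplicity (3*n) (3*m) \<Psi> 1" if "i < length \<psi>s" for i
    using \<psi>s(1)[of "\<psi>s ! i"] that unfolding multiplicity_one_def by simp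
  then obtain \<Psi> where \<Psi>: "\<And>i. i < length \<psi>s \<Longrightarrow> star_extension (T3_alg n) (T3_alg m) (\<psi>s ! i) (\<Psi> i)"
     "\<And>i. i < length \<psi>s \<Longrightarrow> has_multiplicity (3*n) (3*m) (\<Psi> i) 1" by metis
  have \<Psi>h: "alg_hom (T3_alg n) (T3_alg m) (\<Psi> i)" and \<Psi>e: "\<And>a. a \<in> alg (T3_alg n) \<Longrightarrow> (\<psi>s ! i) a = \<Psi> i a" if "i < length \<psi>s" for i
    using \<Psi>(1)[OF that] unfolding star_extension_def alg_hom_def by auto
  define g where "g i = hat n m (\<Psi> i)" for i
  have g: "tri_hom n m (g i)" if "i < length \<psi>s" for i
    unfolding g_def by (rule hat_tri_hom[OF pos \<Psi>h[OF that]])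
  have gc: "commuting n m (g i)" if i: "i < length \<psi>s" for i
  proof -
    obtain W where "W \<in> mx (3*m) (3*n)" "\<forall>x\<in>M3 n. hat n m (\<Psi> i) x = W * x * adj W"
      using multiplicity_one_sandwich[OF \<Psi>(2)[OF i]] by (elim bexE) (rule that)
    then show ?thesis unfolding g_def by (intro sandwich_commuting[of W]) auto
  qed
  \<comment> \<open>The algebra contains the unit, so the images of the unit under different
    summands are orthogonal, and they carry the whole ranges.\<close>
  have orth: "g i x * g j y = 0" if ij: "i < length \<psi>s" "j < length \<psi>s" "i \<noteq> j" and xy: "x \<in> M3 n" "y \<in> M3 n" for i j x y
  proof -
    interpret gi: tri_hom n m "g i" by (rule g[OF ij(1)])
    interpret gj: tri_hom n m "g j" by (rule g[OF ij(2)])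
    have one: "1\<^sub>m (3*n) \<in> carrier_mat (3*n) (3*n)" by simp
    have c: "\<Psi> k (1\<^sub>m (3*n)) \<in> carrier_mat (3*m) (3*m)" if "k < length \<psi>s" for k
      using \<Psi>h[OF that, unfolded T3_hom[OF pos]] one by blast
    have "g i (idm (3*n)) * g j (idm (3*n)) = emb (3*m) (\<Psi> i (1\<^sub>m (3*n))) * emb (3*m) (\<Psi> j (1\<^sub>m (3*n)))"
      unfolding g_def emb_one[symmetric] hat_emb[OF one] ..
    also have "\<dots> = emb (3*m) (\<Psi> i (1\<^sub>m (3*n)) * \<Psi> j (1\<^sub>m (3*n)))" using c ij by (simp add: emb_mult)
    also have "\<dots> = 0" using \<psi>s(2)[OF ij one_T3[OF pos(1)] one_T3[OF pos(1)]] \<Psi>e ij one_T3[OF pos(1)] by (simp add: emb_zero)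
    finally have z: "g i (idm (3*n)) * g j (idm (3*n)) = 0" .
    have "g i x * g j y = g i x * g i (idm (3*n)) * (g j (idm (3*n)) * g j y)"
      using gi.h_idm_mult(2)[OF xy(1)] gj.h_idm_mult(1)[OF xy(2)] by simp
    also have "\<dots> = g i x * (g i (idm (3*n)) * g j (idm (3*n))) * g j y" by (simp only: mult.assoc)
    finally show ?thesis using z by simp
  qed
  have sum_alg: "hat n m h (emb (3*n) a) = (\<Sum>i<length \<psi>s. g i (emb (3*n) a))" if a: "a \<in> alg (T3_alg n)" for a
  proof -
    have c: "\<forall>f\<in>set \<psi>s. f a \<in> carrier_mat (3*m) (3*m)"
    proof
      fix f assume f: "f \<in> set \<psi>s"
      obtain i where i: "i < length \<psi>s" "f = \<psi>s ! i" using f by (metis in_set_conv_nth)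
      then show "f a \<in> carrier_mat (3*m) (3*m)" using \<Psi>e[OF i(1) a] \<Psi>h[OF i(1), unfolded T3_hom[OF pos]] alg_carrier[OF a] by simp
    qed
    have "hat n m h (emb (3*n) a) = emb (3*m) (\<phi> a)" using \<phi>[OF a] hat_emb[OF alg_carrier[OF a]] by simp
    also have "\<dots> = (\<Sum>i<length \<psi>s. emb (3*m) ((\<psi>s ! i) a))" unfolding \<psi>s(3)[OF a] by (rule conjunct2[OF foldr_emb[OF c]])
    also have "\<dots> = (\<Sum>i<length \<psi>s. g i (emb (3*n) a))"
      by (rule sum.cong) (use \<Psi>e a alg_carrier[OF a] hat_emb in \<open>auto simp: g_def\<close>)
    finally show ?thesis .
  qed
  \<comment> \<open>Every matrix is the sum of an element of the algebra and the adjoint of another,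
    and both sides are additive and respect adjoints.\<close>
  have total: "hat n m h x = (\<Sum>i<length \<psi>s. g i x)" if x: "x \<in> M3 n" for x
  proof -
    obtain a b where ab: "a \<in> alg (T3_alg n)" "b \<in> alg (T3_alg n)" "cmat (3*n) x = a + mat_adjoint b"
      using fd_cstar.alg_generates[OF T3_fd_cstar[OF pos(1)], of "cmat (3*n) x"] by auto
    have x_eq: "x = emb (3*n) a + adj (emb (3*n) b)"
      using arg_cong[OF ab(3), of "emb (3*n)"] x alg_carrier[OF ab(1)] alg_carrier[OF ab(2)] by (simp add: emb_cmat emb_add emb_adj)
    have "hat n m h x = hat n m h (emb (3*n) a) + adj (hat n m h (emb (3*n) b))"
      unfolding x_eq by (simp add: h_add h_adj mx_closed)
    also have "\<dots> = (\<Sum>i<length \<psi>s. g i (emb (3*n) a) + adj (g i (emb (3*n) b)))"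
      by (simp add: sum_alg[OF ab(1)] sum_alg[OF ab(2)] sum.distrib)
    also have "\<dots> = (\<Sum>i<length \<psi>s. g i x)"
      unfolding x_eq by (rule sum.cong) (auto simp: tri_hom.h_add[OF g] tri_hom.h_adj[OF g] mx_closed)
    finally show ?thesis .
  qed
  have "commuting n m (hat n m h) \<longleftrightarrow> (\<forall>i\<in>{..<length \<psi>s}. commuting n m (g i))"
    by (rule commuting_sum) (use g orth total in auto)
  then show "commuting n m (hat n m h)" using gc by simp
qed

text \<open>Simplicity again, as \<open>slice\<close> applied to the image of the unit: a nonzero
  element of the kernel makes that image vanish. This gives the alternative between embedding and
  zero in \<open>direct_sum_family\<close>.\<close>

lemma T3_hom_zero_or_inj:
  assumes pos: "n > 0" "m > 0" and h: "alg_hom (T3_alg n) (T3_alg m) h"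
  shows "(\<forall>a\<in>carrier_mat (3*n) (3*n). h a = 0\<^sub>m (3*m) (3*m)) \<or> inj_on h (carrier_mat (3*n) (3*n))"
proof (cases "inj_on h (carrier_mat (3*n) (3*n))")
  case False
  note H = h[unfolded T3_hom[OF pos]]
  interpret tri_hom n m "hat n m h" by (rule hat_tri_hom[OF pos h])
  obtain a b where ab: "a \<in> carrier_mat (3*n) (3*n)" "b \<in> carrier_mat (3*n) (3*n)" "h a = h b" "a \<noteq> b"
    using False unfolding inj_on_def by blast
  define z where "z = emb (3*n) a - emb (3*n) b"
  have z: "z \<in> M3 n" "z \<noteq> 0" unfolding z_def using ab emb_inj[OF ab(1,2)] by auto
  have z0: "hat n m h z = 0" unfolding z_def using ab by (simp add: h_diff hat_emb)
  have one0: "hat n m h (idm (3*n)) = 0"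
    by (rule slice[OF z]) (simp_all add: h_idm_mult idm_mx z0)
  have "h c = 0\<^sub>m (3*m) (3*m)" if c: "c \<in> carrier_mat (3*n) (3*n)" for c
  proof (rule emb_inj[of _ "3*m"])
    have "hat n m h (emb (3*n) c) = hat n m h (idm (3*n)) * hat n m h (emb (3*n) c)"
      by (rule h_idm_mult(1)[OF emb_mx, symmetric])
    then show "emb (3*m) (h c) = emb (3*m) (0\<^sub>m (3*m) (3*m))" by (simp add: one0 emb_zero hat_emb[OF c])
  qed (use H c in auto)
  then show ?thesis by blast
qed simp

text \<open>Members of the family are triples of algebras and a map, so the sizes have to be
  recovered from the algebras; the zero element shows the size.\<close>

lemma T3_alg_inject: "T3_alg n = T3_alg m \<Longrightarrow> n = m"
proof -
  assume "T3_alg n = T3_alg m"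
  then have "czero (T3_alg n) = czero (T3_alg m)" by simp
  then have "0\<^sub>m (3 * n) (3 * n) = (0\<^sub>m (3 * m) (3 * m) :: complex mat)" by simp
  then have "dim_row (0\<^sub>m (3 * n) (3 * n) :: complex mat) = dim_row (0\<^sub>m (3 * m) (3 * m) :: complex mat)" by (rule arg_cong)
  then show "n = m" by simp
qed

lemma alg_homD: "alg_hom A B h \<Longrightarrow> x \<in> alg A \<Longrightarrow> h x \<in> alg B"
  by (simp add: alg_hom_def)

section \<open>The family of regular embeddings\<close>

lemma F_reg_T3_cases:
  assumes "(A, B, \<phi>) \<in> F_reg_T3"
  obtains n m h where "n > 0" "m > 0" "A = T3_alg n" "B = T3_alg m" "alg_hom A B h" "\<And>a. a \<in> alg A \<Longrightarrow> \<phi> a = h a"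
    "commuting n m (hat n m h)" "inj_on \<phi> (alg A)"
proof -
  obtain n m where nm: "n > 0" "m > 0" "A = T3_alg n" "B = T3_alg m" "regular n m \<phi>" "inj_on \<phi> (alg A)"
    using assms unfolding F_reg_T3_def by blast
  obtain h where "star_extension A B \<phi> h"
    using nm(5) unfolding regular_def star_extendible_def nm(3,4) by blast
  then have h: "alg_hom A B h" "\<And>a. a \<in> alg A \<Longrightarrow> \<phi> a = h a"
    unfolding star_extension_def alg_hom_def by auto
  then have "commuting n m (hat n m h)" using regular_iff_commuting[OF nm(1,2), of h \<phi>] nm(3-5) by simp
  then show ?thesis using that nm h by blast
qed

lemma F_reg_T3_I:
  assumes "n > 0" "m > 0" "alg_hom (T3_alg n) (T3_alg m) h" "\<And>a. a \<in> alg (T3_alg n) \<Longrightarrow> \<phi> a = h a"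
    "commuting n m (hat n m h)" "inj_on \<phi> (alg (T3_alg n))"
  shows "(T3_alg n, T3_alg m, \<phi>) \<in> F_reg_T3"
  using regular_iff_commuting[OF assms(1-3), of \<phi>] assms unfolding F_reg_T3_def by blast

lemma hat_comp_fun:
  assumes "n > 0" "m > 0" "alg_hom (T3_alg n) (T3_alg m) h"
  shows "hat n l (\<lambda>a. g (h a)) = (\<lambda>x. hat m l g (hat n m h x))"
  by (rule ext) (rule hat_comp[OF assms, symmetric])

theorem isoclassic_F_reg_T3: "isoclassic F_reg_T3"
proof (rule isoclassic_criterion)
  fix A B \<phi> assume "(A, B, \<phi>) \<in> F_reg_T3"
  then show "fd_cstar A \<and> fd_cstar B \<and> star_extendible A B \<phi>"
    unfolding F_reg_T3_def regular_def using T3_fd_cstar by auto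
next
  fix A B C \<phi> \<psi> assume \<phi>: "(A, B, \<phi>) \<in> F_reg_T3" and \<psi>: "(B, C, \<psi>) \<in> F_reg_T3"
  obtain n m h where h: "n > 0" "m > 0" "A = T3_alg n" "B = T3_alg m" "alg_hom A B h" "\<And>a. a \<in> alg A \<Longrightarrow> \<phi> a = h a"
    "commuting n m (hat n m h)" "inj_on \<phi> (alg A)" using F_reg_T3_cases[OF \<phi>] by blast
  obtain m' l g where "m' > 0" "l > 0" and B: "B = T3_alg m'" and "C = T3_alg l" "alg_hom B C g" "\<And>a. a \<in> alg B \<Longrightarrow> \<psi> a = g a"
    "commuting m' l (hat m' l g)" "inj_on \<psi> (alg B)" using F_reg_T3_cases[OF \<psi>] by blast
  moreover have "m' = m" using B h(4) T3_alg_inject by simp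
  ultimately have g: "l > 0" "C = T3_alg l" "alg_hom B C g" "\<And>a. a \<in> alg B \<Longrightarrow> \<psi> a = g a" "commuting m l (hat m l g)" "inj_on \<psi> (alg B)"
    by auto
  note h' = h(5)[unfolded h(3,4)] and g' = g(3)[unfolded g(2) h(4)]
  show "(A, C, \<psi> \<circ> \<phi>) \<in> F_reg_T3"
    unfolding h(3) g(2)
  proof (rule F_reg_T3_I[where h = "\<lambda>x. g (h x)"])
    show "alg_hom (T3_alg n) (T3_alg l) (\<lambda>x. g (h x))" by (rule alg_hom_comp[OF h' g'])
    show "(\<psi> \<circ> \<phi>) a = g (h a)" if "a \<in> alg (T3_alg n)" for a
      using that h(6) g(4) alg_homD[OF h(5)] h(3) by simp
    show "commuting n l (hat n l (\<lambda>x. g (h x)))"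
      unfolding hat_comp_fun[OF h(1,2) h']
      by (rule commuting_comp[OF hat_tri_hom[OF h(1,2) h'] hat_tri_hom[OF h(2) g(1) g'] h(7) g(5)])
    show "inj_on (\<psi> \<circ> \<phi>) (alg (T3_alg n))"
    proof (rule comp_inj_on)
      show "inj_on \<phi> (alg (T3_alg n))" using h(3,8) by simp
      have "\<phi> ` alg (T3_alg n) \<subseteq> alg B" using h(3,6) alg_homD[OF h(5)] by auto
      then show "inj_on \<psi> (\<phi> ` alg (T3_alg n))" by (rule inj_on_subset[OF g(6)])
    qed
  qed (fact h(1) g(1))+
next
  fix A B C D a b c \<chi> \<psi>
  assume a: "alg_hom A B a" and b: "alg_hom B C b" and c: "alg_hom C D c"
    and \<chi>: "(A, C, \<chi>) \<in> F_reg_T3" and \<psi>: "(B, D, \<psi>) \<in> F_reg_T3"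
    and ba: "\<And>x. x \<in> alg A \<Longrightarrow> b (a x) = \<chi> x" and cb: "\<And>x. x \<in> alg B \<Longrightarrow> c (b x) = \<psi> x"
  obtain n l where nl: "n > 0" "l > 0" "A = T3_alg n" "C = T3_alg l" "regular n l \<chi>" "inj_on \<chi> (alg A)"
    using \<chi> unfolding F_reg_T3_def by blast
  obtain m p where mp: "m > 0" "p > 0" "B = T3_alg m" "D = T3_alg p" "regular m p \<psi>" "inj_on \<psi> (alg B)"
    using \<psi> unfolding F_reg_T3_def by blast
  note a' = a[unfolded nl(3) mp(3)] and b' = b[unfolded mp(3) nl(4)] and c' = c[unfolded nl(4) mp(4)]
  have "commuting n l (hat n l (\<lambda>x. b (a x)))"
    using regular_iff_commuting[OF nl(1,2) alg_hom_comp[OF a' b'], of \<chi>] ba nl by simp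
  then have c1: "commuting n l (\<lambda>x. hat m l b (hat n m a x))" unfolding hat_comp_fun[OF nl(1) mp(1) a'] .
  have "commuting m p (hat m p (\<lambda>x. c (b x)))"
    using regular_iff_commuting[OF mp(1,2) alg_hom_comp[OF b' c'], of \<psi>] cb mp by simp
  then have c2: "commuting m p (\<lambda>x. hat l p c (hat m l b x))" unfolding hat_comp_fun[OF mp(1) nl(2) b'] .
  have hat3: "hat n p (\<lambda>x. c (b (a x))) = (\<lambda>x. hat l p c (hat m l b (hat n m a x)))"
    using hat_comp_fun[OF nl(1,2) alg_hom_comp[OF a' b'], of p c] hat_comp_fun[OF nl(1) mp(1) a', of l b] by simp
  show "(A, D, \<lambda>x. c (b (a x))) \<in> F_reg_T3"
    unfolding nl(3) mp(4)
  proof (rule F_reg_T3_I[OF nl(1) mp(2)])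
    show "alg_hom (T3_alg n) (T3_alg p) (\<lambda>x. c (b (a x)))" by (rule alg_hom_comp[OF alg_hom_comp[OF a' b'] c'])
    show "commuting n p (hat n p (\<lambda>x. c (b (a x))))"
      unfolding hat3
      by (rule commuting_triple[OF hat_tri_hom[OF nl(1) mp(1) a'] hat_tri_hom[OF mp(1) nl(2) b'] hat_tri_hom[OF nl(2) mp(2) c'] c1 c2])
    show "inj_on (\<lambda>x. c (b (a x))) (alg (T3_alg n))"
    proof (rule inj_onI)
      fix x y assume xy: "x \<in> alg (T3_alg n)" "y \<in> alg (T3_alg n)" "c (b (a x)) = c (b (a y))"
      then have xyA: "x \<in> alg A" "y \<in> alg A" by (simp_all add: nl(3))
      \<comment> \<open>Injectivity of the triple: cancel \<open>c\<close> and \<open>b\<close> by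
        injectivity of \<open>\<psi>\<close>, then apply \<open>b\<close> and cancel by injectivity
        of \<open>\<chi>\<close>.\<close>
      have "\<psi> (a x) = \<psi> (a y)" using xy(3) cb alg_homD[OF a] xyA by simp
      then have "a x = a y" using inj_onD[OF mp(6)] alg_homD[OF a] xyA by blast
      then have "\<chi> x = \<chi> y" using ba[OF xyA(1)] ba[OF xyA(2)] by simp
      then show "x = y" using inj_onD[OF nl(6)] xyA by blast
    qed
  qed simp
qed

section \<open>Direct sums and partial maps\<close>

definition sizes :: "nat list \<Rightarrow> bool" where "sizes ns \<longleftrightarrow> ns \<noteq> [] \<and> (\<forall>n\<in>set ns. n > 0)"

abbreviation DS :: "nat list \<Rightarrow> complex mat list opalg" where "DS ns \<equiv> Defs.direct_sum (map T3_alg ns)"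

abbreviation pm :: "nat list \<Rightarrow> (complex mat list \<Rightarrow> complex mat list) \<Rightarrow> nat \<Rightarrow> nat \<Rightarrow> complex mat \<Rightarrow> complex mat" where
  "pm ns h i j \<equiv> partial_map (map T3_alg ns) h i j"

lemma sizes_nth: "sizes ns \<Longrightarrow> i < length ns \<Longrightarrow> ns ! i > 0" by (simp add: sizes_def)

lemma sizes_fd: "sizes ns \<Longrightarrow> \<forall>A\<in>set (map T3_alg ns). fd_cstar A"
  by (auto simp: sizes_def T3_fd_cstar)

lemma DS_fd: "sizes ns \<Longrightarrow> fd_cstar (DS ns)"
  by (rule direct_sum_fd_cstar[OF sizes_fd]) (auto simp: sizes_def)

lemma DS_inject: "DS ns = DS ms \<Longrightarrow> ns = ms"
proof -
  assume "DS ns = DS ms"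
  then have "czero (DS ns) = czero (DS ms)" by simp
  then have "map (\<lambda>n. 0\<^sub>m (3 * n) (3 * n) :: complex mat) ns = map (\<lambda>n. 0\<^sub>m (3 * n) (3 * n)) ms"
    by (simp add: direct_sum_ops comp_def)
  then have "map dim_row (map (\<lambda>n. 0\<^sub>m (3 * n) (3 * n) :: complex mat) ns) = map dim_row (map (\<lambda>n. 0\<^sub>m (3 * n) (3 * n) :: complex mat) ms)"
    by simp
  then have "map ((*) 3) ns = map ((*) 3) ms" by (simp add: comp_def)
  then show ?thesis by (rule map_injective) (auto intro: injI)
qed

lemma T3_algebras_list: "set As \<subseteq> T3_algebras \<Longrightarrow> \<exists>ns. As = map T3_alg ns \<and> (\<forall>n\<in>set ns. n > 0)"
proof (induction As)
  case (Cons A As)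
  then obtain ns where "As = map T3_alg ns" "\<forall>n\<in>set ns. n > 0" by auto
  moreover obtain n where "A = T3_alg n" "n > 0" using Cons.prems by (auto simp: T3_algebras_def)
  ultimately show ?case by (intro exI[of _ "n # ns"]) auto
qed simp

lemma partial_map_inj_at: "partial_map As h i j a = h (inj_at As i a) ! j"
  by (simp add: partial_map_def inj_at_def)

context
  fixes ns ms :: "nat list" and h
  assumes ns: "sizes ns" and ms: "sizes ms" and h: "alg_hom (DS ns) (DS ms) h"
begin

lemma DS_hom: 
  "x \<in> car (DS ns) \<Longrightarrow> h x \<in> car (DS ms)"
  "x \<in> car (DS ns) \<Longrightarrow> y \<in> car (DS ns) \<Longrightarrow> h (cadd (DS ns) x y) = cadd (DS ms) (h x) (h y)"
  "x \<in> car (DS ns) \<Longrightarrow> y \<in> car (DS ns) \<Longrightarrow> h (cmult (DS ns) x y) = cmult (DS ms) (h x) (h y)"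
  "x \<in> car (DS ns) \<Longrightarrow> h (cscale (DS ns) c x) = cscale (DS ms) c (h x)"
  "x \<in> car (DS ns) \<Longrightarrow> h (cadj (DS ns) x) = cadj (DS ms) (h x)"
  using h fd_cstar.Cstar_car[OF DS_fd[OF ns]] fd_cstar.Cstar_car[OF DS_fd[OF ms]] unfolding alg_hom_def star_hom_def by auto

lemma DS_hom_zero: "h (czero (DS ns)) = czero (DS ms)"
  by (rule fd_hom.h_zero) (use h DS_fd ns ms in \<open>simp add: fd_hom_def fd_hom_axioms_def alg_hom_def\<close>)

lemma inj_car: "i < length ns \<Longrightarrow> a \<in> carrier_mat (3 * ns ! i) (3 * ns ! i) \<Longrightarrow> inj_at (map T3_alg ns) i a \<in> car (DS ns)"
  using inj_at_car[OF sizes_fd[OF ns], of i a] by simp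

lemma pm_hom:
  assumes i: "i < length ns" and j: "j < length ms"
  shows "alg_hom (T3_alg (ns ! i)) (T3_alg (ms ! j)) (pm ns h i j)"
proof -
  let ?N = "3 * ns ! i"
  note I = inj_car[OF i]
  have add: "inj_at (map T3_alg ns) i (a + b) = cadd (DS ns) (inj_at (map T3_alg ns) i a) (inj_at (map T3_alg ns) i b)" for a b
    using inj_at_add[OF sizes_fd[OF ns], of i a b] i by simp
  have mult: "inj_at (map T3_alg ns) i (a * b) = cmult (DS ns) (inj_at (map T3_alg ns) i a) (inj_at (map T3_alg ns) i b)" for a b
    using inj_at_mult[OF sizes_fd[OF ns], of i a b] i by simp
  have scale: "inj_at (map T3_alg ns) i (c \<cdot>\<^sub>m a) = cscale (DS ns) c (inj_at (map T3_alg ns) i a)" for a c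
    using inj_at_scale[OF sizes_fd[OF ns], of i c a] i by simp
  have adj: "inj_at (map T3_alg ns) i (mat_adjoint a) = cadj (DS ns) (inj_at (map T3_alg ns) i a)" for a
    using inj_at_adj[OF sizes_fd[OF ns], of i a] i by simp
  show ?thesis
    unfolding T3_hom[OF sizes_nth[OF ns i] sizes_nth[OF ms j]]
  proof (intro conjI ballI allI)
    fix x y :: "complex mat" assume xy: "x \<in> carrier_mat ?N ?N" "y \<in> carrier_mat ?N ?N"
    show "pm ns h i j (x + y) = pm ns h i j x + pm ns h i j y"
      unfolding partial_map_inj_at add DS_hom(2)[OF I[OF xy(1)] I[OF xy(2)]] using j by (simp add: direct_sum_ops)
    show "pm ns h i j (x * y) = pm ns h i j x * pm ns h i j y"
      unfolding partial_map_inj_at mult DS_hom(3)[OF I[OF xy(1)] I[OF xy(2)]] using j by (simp add: direct_sum_ops)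
  next
    fix c and x :: "complex mat" assume x: "x \<in> carrier_mat ?N ?N"
    show "pm ns h i j (c \<cdot>\<^sub>m x) = c \<cdot>\<^sub>m pm ns h i j x"
      unfolding partial_map_inj_at scale DS_hom(4)[OF I[OF x]] using j by (simp add: direct_sum_ops)
  next
    fix x :: "complex mat" assume x: "x \<in> carrier_mat ?N ?N"
    show "pm ns h i j (mat_adjoint x) = mat_adjoint (pm ns h i j x)"
      unfolding partial_map_inj_at adj DS_hom(5)[OF I[OF x]] using j by (simp add: direct_sum_ops)
    show "pm ns h i j x \<in> carrier_mat (3 * ms ! j) (3 * ms ! j)"
      using DS_hom(1)[OF I[OF x]] j by (simp add: partial_map_inj_at direct_sum_car)
  next
    fix a assume "a \<in> alg (T3_alg (ns ! i))"
    then have "inj_at (map T3_alg ns) i a \<in> alg (DS ns)" using inj_at_alg[OF sizes_fd[OF ns], of i a] i by simp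
    then have "h (inj_at (map T3_alg ns) i a) \<in> alg (DS ms)" by (rule alg_homD[OF h])
    then show "pm ns h i j a \<in> alg (T3_alg (ms ! j))" using j by (simp add: partial_map_inj_at direct_sum_alg)
  qed
qed

lemma pm_tri_hom:
  assumes "i < length ns" "j < length ms"
  shows "tri_hom (ns ! i) (ms ! j) (hat (ns ! i) (ms ! j) (pm ns h i j))"
  using hat_tri_hom[OF sizes_nth[OF ns assms(1)] sizes_nth[OF ms assms(2)] pm_hom[OF assms]] .

text \<open>Different summands annihilate each other in the domain, and the homomorphism preserves
  this relation.\<close>

lemma pm_orthogonal:
  assumes ij: "i < length ns" "i' < length ns" "i \<noteq> i'" "j < length ms"
  shows "hat (ns ! i) (ms ! j) (pm ns h i j) x * hat (ns ! i') (ms ! j) (pm ns h i' j) y = 0"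
proof -
  let ?a = "cmat (3 * ns ! i) x" and ?b = "cmat (3 * ns ! i') y"
  let ?ia = "inj_at (map T3_alg ns) i ?a" and ?ib = "inj_at (map T3_alg ns) i' ?b"
  have I: "?ia \<in> car (DS ns)" "?ib \<in> car (DS ns)" using ij by (auto intro!: inj_car)
  have "cmult (DS ns) ?ia ?ib = czero (DS ns)"
    by (rule inj_at_mult_orth[OF sizes_fd[OF ns]]) (use ij in auto)
  then have "cmult (DS ms) (h ?ia) (h ?ib) = czero (DS ms)" using DS_hom(3)[OF I] DS_hom_zero by simp
  then have "cmult (DS ms) (h ?ia) (h ?ib) ! j = czero (DS ms) ! j" by simp
  then have z: "pm ns h i j ?a * pm ns h i' j ?b = 0\<^sub>m (3 * ms ! j) (3 * ms ! j)"
    using ij by (simp add: direct_sum_ops partial_map_inj_at)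
  have "pm ns h i j ?a \<in> carrier_mat (3 * ms ! j) (3 * ms ! j)" "pm ns h i' j ?b \<in> carrier_mat (3 * ms ! j) (3 * ms ! j)"
    using DS_hom(1)[OF I(1)] DS_hom(1)[OF I(2)] ij by (auto simp: partial_map_inj_at direct_sum_car)
  then show ?thesis unfolding hat_def by (simp add: emb_mult[symmetric] z emb_zero)
qed

lemma pm_sum:
  assumes y: "y \<in> car (DS ns)" and j: "j < length ms"
  shows "emb (3 * ms ! j) (h y ! j) = (\<Sum>i<length ns. emb (3 * ms ! j) (pm ns h i j (y ! i)))"
proof -
  let ?p = "partial_list (map T3_alg ns) y"
  have pc: "?p k \<in> car (DS ns)" for k using partial_list_car[OF sizes_fd[OF ns]] y by blast
  have yi: "y ! k \<in> carrier_mat (3 * ns ! k) (3 * ns ! k)" if "k < length ns" for k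
    using y that by (simp add: direct_sum_car)
  have "k \<le> length ns \<Longrightarrow> emb (3 * ms ! j) (h (?p k) ! j) = (\<Sum>i<k. emb (3 * ms ! j) (pm ns h i j (y ! i)))" for k
  proof (induction k)
    case 0
    then show ?case using j DS_hom_zero by (simp add: partial_list_0[OF sizes_fd[OF ns]] direct_sum_ops emb_zero)
  next
    case (Suc k)
    then have k: "k < length ns" by simp
    have I: "inj_at (map T3_alg ns) k (y ! k) \<in> car (DS ns)" by (rule inj_car[OF k yi[OF k]])
    have "?p (Suc k) = cadd (DS ns) (?p k) (inj_at (map T3_alg ns) k (y ! k))"
      using partial_list_Suc[OF sizes_fd[OF ns], of k y] k y by simp
    then have "h (?p (Suc k)) ! j = h (?p k) ! j + pm ns h k j (y ! k)"
      using DS_hom(2)[OF pc I] j by (simp add: direct_sum_ops partial_map_inj_at)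
    moreover have "h (?p k) ! j \<in> carrier_mat (3 * ms ! j) (3 * ms ! j)" "pm ns h k j (y ! k) \<in> carrier_mat (3 * ms ! j) (3 * ms ! j)"
      using DS_hom(1)[OF pc] DS_hom(1)[OF I] j by (auto simp: direct_sum_car partial_map_inj_at)
    ultimately show ?case using Suc by (simp add: emb_add)
  qed
  from this[of "length ns"] show ?thesis
    using partial_list_length[OF sizes_fd[OF ns] y] by simp
qed

end

lemma hat_pm_comp:
  assumes ns: "sizes ns" and ms: "sizes ms" and ls: "sizes ls"
    and h: "alg_hom (DS ns) (DS ms) h" and g: "alg_hom (DS ms) (DS ls) g"
    and i: "i < length ns" and k: "k < length ls"
  shows "hat (ns ! i) (ls ! k) (pm ns (\<lambda>x. g (h x)) i k) x
    = (\<Sum>j<length ms. hat (ms ! j) (ls ! k) (pm ms g j k) (hat (ns ! i) (ms ! j) (pm ns h i j) x))"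
proof -
    define a where "a = cmat (3 * ns ! i) x"
    have I: "inj_at (map T3_alg ns) i a \<in> car (DS ns)" unfolding a_def by (rule inj_car[OF ns ms h i]) simp
    have hc: "h (inj_at (map T3_alg ns) i a) \<in> car (DS ms)" by (rule DS_hom(1)[OF ns ms h I])
    have "hat (ns ! i) (ls ! k) (pm ns (\<lambda>x. g (h x)) i k) x = emb (3 * ls ! k) (g (h (inj_at (map T3_alg ns) i a)) ! k)"
      by (simp add: hat_def partial_map_inj_at a_def)
    also have "\<dots> = (\<Sum>j<length ms. emb (3 * ls ! k) (pm ms g j k (h (inj_at (map T3_alg ns) i a) ! j)))"
      by (rule pm_sum[OF ms ls g hc k])
    also have "\<dots> = (\<Sum>j<length ms. hat (ms ! j) (ls ! k) (pm ms g j k) (hat (ns ! i) (ms ! j) (pm ns h i j) x))"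
    proof (rule sum.cong[OF refl])
      fix j assume "j \<in> {..<length ms}"
      then have "h (inj_at (map T3_alg ns) i a) ! j \<in> carrier_mat (3 * ms ! j) (3 * ms ! j)" using hc by (simp add: direct_sum_car)
      then show "emb (3 * ls ! k) (pm ms g j k (h (inj_at (map T3_alg ns) i a) ! j))
         = hat (ms ! j) (ls ! k) (pm ms g j k) (hat (ns ! i) (ms ! j) (pm ns h i j) x)"
        by (simp add: hat_def partial_map_inj_at[of _ h] a_def cmat_emb)
    qed
    finally show "hat (ns ! i) (ls ! k) (pm ns (\<lambda>x. g (h x)) i k) x
      = (\<Sum>j<length ms. hat (ms ! j) (ls ! k) (pm ms g j k) (hat (ns ! i) (ms ! j) (pm ns h i j) x))" .
qed

lemma commuting_pm_comp:
  assumes ns: "sizes ns" and ms: "sizes ms" and ls: "sizes ls"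
    and h: "alg_hom (DS ns) (DS ms) h" and g: "alg_hom (DS ms) (DS ls) g"
    and i: "i < length ns" and k: "k < length ls"
  shows "commuting (ns ! i) (ls ! k) (hat (ns ! i) (ls ! k) (pm ns (\<lambda>x. g (h x)) i k)) \<longleftrightarrow>
    (\<forall>j<length ms. commuting (ns ! i) (ls ! k) (\<lambda>x. hat (ms ! j) (ls ! k) (pm ms g j k) (hat (ns ! i) (ms ! j) (pm ns h i j) x)))"
proof -
  have "commuting (ns ! i) (ls ! k) (hat (ns ! i) (ls ! k) (pm ns (\<lambda>x. g (h x)) i k)) \<longleftrightarrow>
    (\<forall>j\<in>{..<length ms}. commuting (ns ! i) (ls ! k) (\<lambda>x. hat (ms ! j) (ls ! k) (pm ms g j k) (hat (ns ! i) (ms ! j) (pm ns h i j) x)))"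
  proof (rule commuting_sum)
    fix j assume "j \<in> {..<length ms}"
    then have j: "j < length ms" by simp
    show "tri_hom (ns ! i) (ls ! k) (\<lambda>x. hat (ms ! j) (ls ! k) (pm ms g j k) (hat (ns ! i) (ms ! j) (pm ns h i j) x))"
      by (rule tri_hom_comp[OF pm_tri_hom[OF ns ms h i j] pm_tri_hom[OF ms ls g j k]])
  next
    fix j j' x y assume "j \<in> {..<length ms}" "j' \<in> {..<length ms}" "j \<noteq> j'"
    then show "hat (ms ! j) (ls ! k) (pm ms g j k) (hat (ns ! i) (ms ! j) (pm ns h i j) x) *
          hat (ms ! j') (ls ! k) (pm ms g j' k) (hat (ns ! i) (ms ! j') (pm ns h i j') y) = 0"
      by (intro pm_orthogonal[OF ms ls g]) (use k in auto)
  next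
    fix x assume x: "x \<in> M3 (ns ! i)"
    show "hat (ns ! i) (ls ! k) (pm ns (\<lambda>x. g (h x)) i k) x
      = (\<Sum>j<length ms. hat (ms ! j) (ls ! k) (pm ms g j k) (hat (ns ! i) (ms ! j) (pm ns h i j) x))"
      by (rule hat_pm_comp[OF ns ms ls h g i k])
  qed simp
  then show ?thesis by auto
qed

lemma commuting_zero: "(\<And>x. x \<in> M3 n \<Longrightarrow> h x = 0) \<Longrightarrow> commuting n m h"
  unfolding commuting_def spread_def by (auto intro!: sum.neutral simp: mx_closed)

definition commuting_maps :: "nat list \<Rightarrow> nat list \<Rightarrow> (complex mat list \<Rightarrow> complex mat list) \<Rightarrow> bool" where
  "commuting_maps ns ms h \<longleftrightarrow> (\<forall>i<length ns. \<forall>j<length ms. commuting (ns ! i) (ms ! j) (hat (ns ! i) (ms ! j) (pm ns h i j)))"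

lemma pm_cong:
  assumes "sizes ns" "\<forall>a\<in>alg (DS ns). \<phi> a = h a" "i < length ns" "a \<in> alg (T3_alg (ns ! i))"
  shows "pm ns \<phi> i j a = pm ns h i j a"
  using inj_at_alg[OF sizes_fd[OF assms(1)], of i a] assms by (simp add: partial_map_inj_at)

lemma F_reg_T3_tilde_cases:
  assumes "(A, B, \<phi>) \<in> F_reg_T3_tilde"
  obtains ns ms h where "sizes ns" "sizes ms" "A = DS ns" "B = DS ms" "alg_hom A B h" "\<And>a. a \<in> alg A \<Longrightarrow> \<phi> a = h a"
proof -
  obtain As Bs where AB: "A = Defs.direct_sum As" "B = Defs.direct_sum Bs" "As \<noteq> []" "Bs \<noteq> []" "set As \<subseteq> T3_algebras" "set Bs \<subseteq> T3_algebras"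
    "star_extendible A B \<phi>"
    using assms unfolding F_reg_T3_tilde_def direct_sum_family_def by blast
  obtain ns ms where nm: "As = map T3_alg ns" "\<forall>n\<in>set ns. n > 0" "Bs = map T3_alg ms" "\<forall>n\<in>set ms. n > 0"
    using T3_algebras_list[OF AB(5)] T3_algebras_list[OF AB(6)] by blast
  obtain h where "star_extension A B \<phi> h" using AB(7) unfolding star_extendible_def by blast
  then have "alg_hom A B h" "\<And>a. a \<in> alg A \<Longrightarrow> \<phi> a = h a"
    unfolding star_extension_def alg_hom_def by auto
  then show ?thesis using that[of ns ms h] nm AB by (simp add: sizes_def)
qed

text \<open>One condition covers both alternatives of the family: a zero partial map is
  \<open>commuting\<close>, and a \<open>commuting\<close> partial map is either zero or
  injective.\<close>

lemma F_reg_T3_tilde_iff: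
  assumes ns: "sizes ns" and ms: "sizes ms" and h: "alg_hom (DS ns) (DS ms) h" and \<phi>: "\<And>a. a \<in> alg (DS ns) \<Longrightarrow> \<phi> a = h a"
  shows "(DS ns, DS ms, \<phi>) \<in> F_reg_T3_tilde \<longleftrightarrow> commuting_maps ns ms h"
proof
  have \<phi>': "\<forall>a\<in>alg (DS ns). \<phi> a = h a" using \<phi> by blast
  assume "(DS ns, DS ms, \<phi>) \<in> F_reg_T3_tilde"
  then obtain As Bs where AB: "DS ns = Defs.direct_sum As" "DS ms = Defs.direct_sum Bs" "set As \<subseteq> T3_algebras" "set Bs \<subseteq> T3_algebras"
    "\<forall>i<length As. \<forall>j<length Bs. (As ! i, Bs ! j, partial_map As \<phi> i j) \<in> F_reg_T3 \<or>
        (\<forall>a\<in>alg (As ! i). partial_map As \<phi> i j a = czero (Bs ! j))"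
    unfolding F_reg_T3_tilde_def direct_sum_family_def by blast
  obtain ns' ms' where nm: "As = map T3_alg ns'" "Bs = map T3_alg ms'"
    using T3_algebras_list[OF AB(3)] T3_algebras_list[OF AB(4)] by blast
  have [simp]: "ns' = ns" "ms' = ms" using DS_inject AB(1,2) unfolding nm by auto
  show "commuting_maps ns ms h" unfolding commuting_maps_def
  proof (intro allI impI)
    fix i j assume ij: "i < length ns" "j < length ms"
    note ni = sizes_nth[OF ns ij(1)] and mj = sizes_nth[OF ms ij(2)]
    note pmh = pm_hom[OF ns ms h ij]
    consider "(T3_alg (ns ! i), T3_alg (ms ! j), pm ns \<phi> i j) \<in> F_reg_T3"
      | "\<forall>a\<in>alg (T3_alg (ns ! i)). pm ns \<phi> i j a = 0\<^sub>m (3 * ms ! j) (3 * ms ! j)"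
      using AB(5) ij unfolding nm by fastforce
    then show "commuting (ns ! i) (ms ! j) (hat (ns ! i) (ms ! j) (pm ns h i j))"
    proof cases
      case 1
      then obtain n m where "T3_alg (ns ! i) = T3_alg n" "T3_alg (ms ! j) = T3_alg m" "regular n m (pm ns \<phi> i j)"
        unfolding F_reg_T3_def by blast
      then have "regular (ns ! i) (ms ! j) (pm ns \<phi> i j)"
        using T3_alg_inject[of "ns ! i" n] T3_alg_inject[of "ms ! j" m] by simp
      then show ?thesis using regular_iff_commuting[OF ni mj pmh, of "pm ns \<phi> i j"] pm_cong[OF ns \<phi>' ij(1)] by simp
    next
      case 2
      let ?h = "hat (ns ! i) (ms ! j) (pm ns h i j)"
      interpret tri_hom "ns ! i" "ms ! j" ?h by (rule pm_tri_hom[OF ns ms h ij])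
      \<comment> \<open>The algebra contains the unit, so vanishing on the algebra makes the
        extension vanish everywhere.\<close>
      have "pm ns h i j (1\<^sub>m (3 * ns ! i)) = 0\<^sub>m (3 * ms ! j) (3 * ms ! j)"
        using bspec[OF 2 one_T3[OF ni]] unfolding pm_cong[OF ns \<phi>' ij(1) one_T3[OF ni]] .
      then have "?h (emb (3 * ns ! i) (1\<^sub>m (3 * ns ! i))) = 0" by (simp add: hat_emb emb_zero)
      then have "?h (idm (3 * ns ! i)) = 0" by (simp add: emb_one)
      then have "?h x = 0" if "x \<in> M3 (ns ! i)" for x using h_idm_mult(1)[OF that] by simp
      then show ?thesis by (rule commuting_zero)
    qed
  qed
next
  have \<phi>': "\<forall>a\<in>alg (DS ns). \<phi> a = h a" using \<phi> by blast
  assume commuting: "commuting_maps ns ms h"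
  have ext: "star_extendible (DS ns) (DS ms) \<phi>"
    unfolding star_extendible_def star_extension_def using h \<phi> unfolding alg_hom_def by auto
  have "(T3_alg (ns ! i), T3_alg (ms ! j), pm ns \<phi> i j) \<in> F_reg_T3 \<or>
      (\<forall>a\<in>alg (T3_alg (ns ! i)). pm ns \<phi> i j a = 0\<^sub>m (3 * ms ! j) (3 * ms ! j))"
    if ij: "i < length ns" "j < length ms" for i j
  proof -
    note ni = sizes_nth[OF ns ij(1)] and mj = sizes_nth[OF ms ij(2)]
    note pmh = pm_hom[OF ns ms h ij]
    note eq = pm_cong[OF ns \<phi>' ij(1)]
    have sub: "alg (T3_alg (ns ! i)) \<subseteq> carrier_mat (3 * ns ! i) (3 * ns ! i)" by (auto simp: T3_alg_iff)
    from T3_hom_zero_or_inj[OF ni mj pmh] show ?thesis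
    proof
      assume "\<forall>a\<in>carrier_mat (3 * ns ! i) (3 * ns ! i). pm ns h i j a = 0\<^sub>m (3 * ms ! j) (3 * ms ! j)"
      then show ?thesis using eq sub by auto
    next
      assume "inj_on (pm ns h i j) (carrier_mat (3 * ns ! i) (3 * ns ! i))"
      then have "inj_on (pm ns h i j) (alg (T3_alg (ns ! i)))" by (rule inj_on_subset[OF _ sub])
      then have "inj_on (pm ns \<phi> i j) (alg (T3_alg (ns ! i)))" using eq by (simp cong: inj_on_cong)
      moreover have "commuting (ns ! i) (ms ! j) (hat (ns ! i) (ms ! j) (pm ns h i j))" using commuting ij by (simp add: commuting_maps_def)
      ultimately have "(T3_alg (ns ! i), T3_alg (ms ! j), pm ns \<phi> i j) \<in> F_reg_T3"
        using eq by (intro F_reg_T3_I[OF ni mj pmh]) auto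
      then show ?thesis ..
    qed
  qed
  then have "\<forall>i<length (map T3_alg ns). \<forall>j<length (map T3_alg ms). (map T3_alg ns ! i, map T3_alg ms ! j, pm ns \<phi> i j) \<in> F_reg_T3 \<or>
      (\<forall>a\<in>alg (map T3_alg ns ! i). pm ns \<phi> i j a = czero (map T3_alg ms ! j))" by simp
  moreover have "set (map T3_alg ns) \<subseteq> T3_algebras" "set (map T3_alg ms) \<subseteq> T3_algebras" "map T3_alg ns \<noteq> []" "map T3_alg ms \<noteq> []"
    using ns ms by (auto simp: sizes_def T3_algebras_def)
  ultimately show "(DS ns, DS ms, \<phi>) \<in> F_reg_T3_tilde"
    unfolding F_reg_T3_tilde_def direct_sum_family_def using ext
    by (intro CollectI exI[of _ "map T3_alg ns"] exI[of _ "map T3_alg ms"] exI[of _ \<phi>] conjI refl)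
qed

lemma commuting_maps_comp:
  assumes "sizes ns" "sizes ms" "sizes ls" "alg_hom (DS ns) (DS ms) h" "alg_hom (DS ms) (DS ls) g"
  shows "commuting_maps ns ls (\<lambda>x. g (h x)) \<longleftrightarrow> (\<forall>i<length ns. \<forall>j<length ms. \<forall>k<length ls.
    commuting (ns ! i) (ls ! k) (\<lambda>x. hat (ms ! j) (ls ! k) (pm ms g j k) (hat (ns ! i) (ms ! j) (pm ns h i j) x)))"
  unfolding commuting_maps_def using commuting_pm_comp[OF assms] by blast

theorem isoclassic_F_reg_T3_tilde: "isoclassic F_reg_T3_tilde"
proof (rule isoclassic_criterion)
  fix A B \<phi> assume AB: "(A, B, \<phi>) \<in> F_reg_T3_tilde"
  have "star_extendible A B \<phi>" using AB unfolding F_reg_T3_tilde_def direct_sum_family_def by blast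
  moreover obtain ns ms where "sizes ns" "sizes ms" "A = DS ns" "B = DS ms" using F_reg_T3_tilde_cases[OF AB] by blast
  ultimately show "fd_cstar A \<and> fd_cstar B \<and> star_extendible A B \<phi>" using DS_fd by simp
next
  fix A B C \<phi> \<psi> assume \<phi>: "(A, B, \<phi>) \<in> F_reg_T3_tilde" and \<psi>: "(B, C, \<psi>) \<in> F_reg_T3_tilde"
  obtain ns ms h where h: "sizes ns" "sizes ms" "A = DS ns" "B = DS ms" "alg_hom A B h" "\<And>a. a \<in> alg A \<Longrightarrow> \<phi> a = h a"
    using F_reg_T3_tilde_cases[OF \<phi>] by blast
  obtain ms' ls g where "sizes ms'" "sizes ls" and B: "B = DS ms'" and "C = DS ls" "alg_hom B C g" "\<And>a. a \<in> alg B \<Longrightarrow> \<psi> a = g a"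
    using F_reg_T3_tilde_cases[OF \<psi>] by blast
  moreover have "ms' = ms" using B h(4) DS_inject by simp
  ultimately have g: "sizes ls" "C = DS ls" "alg_hom B C g" "\<And>a. a \<in> alg B \<Longrightarrow> \<psi> a = g a" by auto
  note h' = h(5)[unfolded h(3,4)] and g' = g(3)[unfolded g(2) h(4)]
  have ch: "commuting_maps ns ms h" using F_reg_T3_tilde_iff[OF h(1,2) h', of \<phi>] \<phi> h(6) unfolding h(3,4) by simp
  have cg: "commuting_maps ms ls g" using F_reg_T3_tilde_iff[OF h(2) g(1) g', of \<psi>] \<psi> g(4) unfolding h(4) g(2) by simp
  have cgh: "commuting_maps ns ls (\<lambda>x. g (h x))"
    unfolding commuting_maps_comp[OF h(1,2) g(1) h' g']
  proof (intro allI impI)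
    fix i j k assume ijk: "i < length ns" "j < length ms" "k < length ls"
    show "commuting (ns ! i) (ls ! k) (\<lambda>x. hat (ms ! j) (ls ! k) (pm ms g j k) (hat (ns ! i) (ms ! j) (pm ns h i j) x))"
      by (rule commuting_comp[OF pm_tri_hom[OF h(1,2) h'] pm_tri_hom[OF h(2) g(1) g']])
        (use ijk ch cg in \<open>auto simp: commuting_maps_def\<close>)
  qed
  have eq: "(\<psi> \<circ> \<phi>) a = g (h a)" if "a \<in> alg (DS ns)" for a
    using that h(6) g(4) alg_homD[OF h(5)] h(3) by simp
  show "(A, C, \<psi> \<circ> \<phi>) \<in> F_reg_T3_tilde"
    unfolding h(3) g(2) by (rule iffD2[OF F_reg_T3_tilde_iff[OF h(1) g(1) alg_hom_comp[OF h' g'] eq] cgh])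
next
  fix A B C D a b c \<chi> \<psi>
  assume a: "alg_hom A B a" and b: "alg_hom B C b" and c: "alg_hom C D c"
    and \<chi>: "(A, C, \<chi>) \<in> F_reg_T3_tilde" and \<psi>: "(B, D, \<psi>) \<in> F_reg_T3_tilde"
    and ba: "\<And>x. x \<in> alg A \<Longrightarrow> b (a x) = \<chi> x" and cb: "\<And>x. x \<in> alg B \<Longrightarrow> c (b x) = \<psi> x"
  obtain ns ls where nl: "sizes ns" "sizes ls" "A = DS ns" "C = DS ls" using F_reg_T3_tilde_cases[OF \<chi>] by blast
  obtain ms ps where mp: "sizes ms" "sizes ps" "B = DS ms" "D = DS ps" using F_reg_T3_tilde_cases[OF \<psi>] by blast
  note a' = a[unfolded nl(3) mp(3)] and b' = b[unfolded mp(3) nl(4)] and c' = c[unfolded nl(4) mp(4)]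
  note ba' = alg_hom_comp[OF a' b'] and cb' = alg_hom_comp[OF b' c']
  have c1: "commuting_maps ns ls (\<lambda>x. b (a x))" using F_reg_T3_tilde_iff[OF nl(1,2) ba', of \<chi>] \<chi> ba unfolding nl(3,4) by simp
  have c2: "commuting_maps ms ps (\<lambda>x. c (b x))" using F_reg_T3_tilde_iff[OF mp(1,2) cb', of \<psi>] \<psi> cb unfolding mp(3,4) by simp
  note c1' = c1[unfolded commuting_maps_comp[OF nl(1) mp(1) nl(2) a' b']] and c2' = c2[unfolded commuting_maps_comp[OF mp(1) nl(2) mp(2) b' c']]
  have c3: "commuting_maps ns ps (\<lambda>x. c (b (a x)))"
    unfolding commuting_maps_comp[OF nl(1) mp(1) mp(2) a' cb']
  proof (intro allI impI)
    fix i j k assume ijk: "i < length ns" "j < length ms" "k < length ps"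
    let ?f = "hat (ns ! i) (ms ! j) (pm ns a i j)"
    note f = pm_tri_hom[OF nl(1) mp(1) a' ijk(1,2)]
    let ?bl = "\<lambda>l. hat (ms ! j) (ls ! l) (pm ms b j l)" and ?cl = "\<lambda>l. hat (ls ! l) (ps ! k) (pm ls c l k)"
    have tb: "tri_hom (ms ! j) (ls ! l) (?bl l)" if "l < length ls" for l by (rule pm_tri_hom[OF mp(1) nl(2) b' ijk(2) that])
    have tc: "tri_hom (ls ! l) (ps ! k) (?cl l)" if "l < length ls" for l by (rule pm_tri_hom[OF nl(2) mp(2) c' that ijk(3)])
    \<comment> \<open>With \<open>i\<close>, \<open>j\<close> and \<open>k\<close> fixed, the paths
      still run through the summands \<open>l\<close> of the third algebra. Along each path both
      composites of two adjacent matrix maps are \<open>commuting\<close>, so the statement on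
      triples applies path by path.\<close>
    have "commuting (ns ! i) (ps ! k) (\<lambda>x. hat (ms ! j) (ps ! k) (pm ms (\<lambda>x. c (b x)) j k) (?f x)) \<longleftrightarrow>
       (\<forall>l\<in>{..<length ls}. commuting (ns ! i) (ps ! k) (\<lambda>x. ?cl l (?bl l (?f x))))"
    proof (rule commuting_sum)
      fix l assume "l \<in> {..<length ls}"
      then show "tri_hom (ns ! i) (ps ! k) (\<lambda>x. ?cl l (?bl l (?f x)))"
        by (intro tri_hom_comp[OF f tri_hom_comp[OF tb tc]]) auto
    next
      fix l l' x y assume "l \<in> {..<length ls}" "l' \<in> {..<length ls}" "l \<noteq> l'"
      then show "?cl l (?bl l (?f x)) * ?cl l' (?bl l' (?f y)) = 0"
        by (intro pm_orthogonal[OF nl(2) mp(2) c']) (use ijk in auto)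
    next
      fix x show "hat (ms ! j) (ps ! k) (pm ms (\<lambda>x. c (b x)) j k) (?f x) = (\<Sum>l<length ls. ?cl l (?bl l (?f x)))"
        by (rule hat_pm_comp[OF mp(1) nl(2) mp(2) b' c' ijk(2,3)])
    qed simp
    moreover have "commuting (ns ! i) (ps ! k) (\<lambda>x. ?cl l (?bl l (?f x)))" if l: "l \<in> {..<length ls}" for l
    proof -
      have l': "l < length ls" using l by simp
      have "commuting (ns ! i) (ls ! l) (\<lambda>x. ?bl l (?f x))" using c1' ijk(1,2) l' by blast
      moreover have "commuting (ms ! j) (ps ! k) (\<lambda>x. ?cl l (?bl l x))" using c2' ijk(2,3) l' by blast
      ultimately show ?thesis by (rule commuting_triple[OF f tb[OF l'] tc[OF l']])
    qed
    ultimately show "commuting (ns ! i) (ps ! k) (\<lambda>x. hat (ms ! j) (ps ! k) (pm ms (\<lambda>x. c (b x)) j k) (?f x))" by blast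
  qed
  show "(A, D, \<lambda>x. c (b (a x))) \<in> F_reg_T3_tilde"
    unfolding nl(3) mp(4) by (rule iffD2[OF F_reg_T3_tilde_iff[OF nl(1) mp(2) alg_hom_comp[OF ba' c'] refl] c3])
qed

theorem theorem10p2:
  shows "isoclassic F_reg_T3 \<and> isoclassic F_reg_T3_tilde"
  using isoclassic_F_reg_T3 isoclassic_F_reg_T3_tilde by blast

end
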